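(* Let $\mathcal J\in\mathbb C^{p\times p}$ with $\mathcal J^*=\mathcal J^{-1}=-\mathcal J$, let $\mathcal F,\mathcal H$ satisfy (A1)–(A2) of the context, let $A=A_{\min}$ be the minimal relation in $L^2_{\mathcal H}(0,l)$ associated with the canonical system $\mathcal Jf'+\mathcal Ff=\lambda\mathcal Hf$ on $(0,l)$, let $\Pi=(\mathbb C^p,\Gamma_0,\Gamma_1)$ be the boundary triple $\Gamma_0(f,g)=\frac1{\sqrt2}(f(0)+f(l))$, $\Gamma_1(f,g)=-\frac1{\sqrt2}\mathcal J(f(0)-f(l))$ for $A_{\max}$, let $\mathfrak L=\{\delta\otimes u:u\in\mathbb C^p\}$, $L:\mathbb C^p\to\mathfrak L$, $Lu=\sqrt2\,\delta\otimes u$, and let $\mathcal P(\lambda)=L^{-1}\Pi^\lambda_{\mathfrak L}$, $\mathcal Q(\lambda)=L^{\langle*\rangle}(\mathbf R_\lambda-\widehat{\mathbf R}_\lambda\Pi^\lambda_{\mathfrak L})$. Put $M(\lambda)=-\mathcal J(I_p-U(\lambda))(I_p+U(\lambda))^{-1}$ and $K=\mathcal J(\operatorname{Re}M(i))\mathcal J$. Then: (i) For all $\lambda\in\mathbb C$, $$\mathcal P(\lambda)^*=\tfrac1{\sqrt2}U(\cdot,\bar\lambda),\qquad \mathcal Q(\lambda)^*=-\tfrac1{\sqrt2}U(\cdot,\bar\lambda)(\mathcal J+K).$$ (ii) The left $\Pi\mathfrak L$-resolvent matrix is $$W^\ell_{\Pi\mathfrak L}(\lambda)=\frac12\begin{bmatrix}(U(\lambda)-I_p)\mathcal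 J+(U(\lambda)+I_p)K&U(\lambda)+I_p\\ \mathcal J(U(\lambda)+I_p)\mathcal J+\mathcal J(U(\lambda)-I_p)K&\mathcal J(U(\lambda)-I_p)\end{bmatrix}.$$
   Context: Canonical system. (A1) $\mathcal F(t),\mathcal H(t)$ are real Hermitian $p\times p$ matrix functions with entries in $L^1(0,l)$, $\mathcal H(t)\ge0$ a.e. on the finite interval $(0,l)$. (A2) If $f$ is absolutely continuous, $\mathcal Jf'+\mathcal Ff=0$ and $\mathcal Hf=0$ a.e., then $f\equiv0$. $\mathfrak H=L^2_{\mathcal H}(0,l)$ is the Hilbert space of classes of $\mathbb C^p$-valued measurable $f$ with $\int_0^lf^*\mathcal Hf\,dt<\infty$, inner product $\langle f,g\rangle=\int_0^lg^*\mathcal Hf\,dt$, modulo functions of zero seminorm. $A_{\max}$ is the set of pairs of classes $(f,g)$ having representatives with $f\in AC[0,l]$, $\mathcal Jf'+\mathcal Ff=\mathcal Hg$; $A=A_{\min}$ is the closure of its restriction to pairs with $f$ of compact support in $(0,l)$. $A$ is a closed symmetric relation with defect numbers $(p,p)$, $A^*=A_{\max}$. $U(t,\lambda)$ solves $\mathcal J\frac{d}{dt}U+\mathcal FU=\lambda\mathcal HU$, $U(0,\lambda)=I_p$; $U(\lambda)=U(l,\lambda)$. $\operatorname{Re}X=\frac12(X+X^* )$. $\Pi$ is a boundary triple for $A^*$; $A_0=\ker\Gamma_0$ is selfadjoint, $R^0_\lambda=(A_0-\lambda)^{-1}$; Weyl function $M(\lambda)$, $\gamma$-field $\gamma(\lambda)=\sqrt2\,U(\cdot,\lambda)(I_p+U(\lambda))^{-1}$,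 $\lambda\in\rho(A_0)$. Rigging. $\mathfrak H_+=\operatorname{dom}A^*$ with norm $\|f\|_+^2=\|f\|^2+\|P_0f'\|^2$, $(f,f')\in A^*$, $P_0$ the orthogonal projection onto $\overline{\operatorname{dom}A}$; $\mathfrak H_-$ is the space of bounded conjugate-linear functionals on $\mathfrak H_+$, $\langle\mathfrak f,h\rangle_{-,+}=\mathfrak f(h)$; $f\in\mathfrak H$ is viewed in $\mathfrak H_-$ via $h\mapsto\langle f,h\rangle$. $\langle*\rangle$ denotes adjoints with respect to these dualities. Standing: for each $u\in\mathbb C^p$ the functional $\langle\delta\otimes u,f\rangle_{-,+}=f(0)^*u$ is well defined and bounded on $\mathfrak H_+$, so $\delta\otimes u\in\mathfrak H_-$; $L^{\langle*\rangle}f=\sqrt2f(0)$. $\mathbf A=\{(f,\mathfrak f')\in\mathfrak H\times\mathfrak H_-:\langle\mathfrak f',h\rangle_{-,+}=\langle f,h'\rangle\ \forall(h,h')\in A^*\}$. For every $\lambda\in\mathbb C$ one has $\mathfrak H_-=\operatorname{ran}(\mathbf A-\lambda)\dotplus\mathfrak L$ and $\Pi^\lambda_{\mathfrak L}$ is the projection onto $\mathfrak L$ parallel to $\operatorname{ran}(\mathbf A-\lambda)$. For a selfadjoint extension $\tilde A$ of $A$ in a possibly larger space $\widetilde{\mathfrak H}\supseteq\mathfrak H$, $\mathbf R_\lambda=P_{\mathfrak H}(\tilde A-\lambda)^{-1}|_{\mathfrak H}$ (maps $\mathfrak H$ boundedly into $\mathfrak H_+$), $\widetilde{\mathbf R}_\lambda=(\mathbf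 R_{\bar\lambda})^{\langle*\rangle}\in B(\mathfrak H_-,\mathfrak H)$, $\widehat{\mathbf R}_\lambda=\widetilde{\mathbf R}_\lambda-\widetilde{\mathsf R}\in B(\mathfrak H_-,\mathfrak H_+)$, $\widetilde{\mathsf R}=\mathsf R^{\langle*\rangle}$, $\mathsf R=\frac12(R^0_i+R^0_{-i})$; $\widehat R^0_\lambda$ is this for $A_0$. $\mathcal Q(\lambda):\mathfrak H\to\mathbb C^p$ does not depend on the choice of the generalized resolvent $\mathbf R$ holomorphic at $\lambda$. $\mathcal P(\lambda)^*:=\mathcal P(\lambda)^{\langle*\rangle}:\mathbb C^p\to\mathfrak H_+$ and $\mathcal Q(\lambda)^*:=\mathcal Q(\lambda)^{\langle*\rangle}:\mathbb C^p\to\mathfrak H$. For $\lambda\in\rho(A_0)$ let $\mathfrak a_{11}=M(\lambda)$, $\mathfrak a_{12}=\gamma(\bar\lambda)^{\langle*\rangle}L$, $\mathfrak a_{21}=L^{\langle*\rangle}\gamma(\lambda)$, $\mathfrak a_{22}=L^{\langle*\rangle}\widehat R^0_\lambda L$. The left $\Pi\mathfrak L$-resolvent matrix is $$W^\ell_{\Pi\mathfrak L}=\begin{bmatrix}\mathfrak a_{21}^{-1}\mathfrak a_{22}&\mathfrak a_{21}^{-1}\\ \mathfrak a_{11}\mathfrak a_{21}^{-1}\mathfrak a_{22}-\mathfrak a_{12}&\mathfrak a_{11}\mathfrak a_{21}^{-1}\end{bmatrix},\quad\lambda\in\rho(A_0).$$ *)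

theory Defs
  imports "HOL-Analysis.Analysis"
begin

section \<open>Complex vectors and matrices\<close>

text \<open>\<open>cvec_ip u v\<close> is \<open>\<langle>u, v\<rangle> = v\<^sup>* u\<close>; all inner products below are linear in the first argument.\<close>

definition cvec_ip :: "complex^'n \<Rightarrow> complex^'n \<Rightarrow> complex" where
  "cvec_ip u v = (\<Sum>i\<in>UNIV. u $ i * cnj (v $ i))"

definition hadj :: "complex^'n^'m \<Rightarrow> complex^'m^'n" where
  "hadj X = (\<chi> i j. cnj (X $ j $ i))"

definition re_part :: "complex^'n^'n \<Rightarrow> complex^'n^'n" where
  "re_part X = (1/2) *\<^sub>R (X + hadj X)"

definition real_hermitian :: "complex^'n^'n \<Rightarrow> bool" where
  "real_hermitian X \<longleftrightarrow> hadj X = X \<and> (\<forall>i j. X $ i $ j \<in> \<real>)"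

definition pos_semidef :: "complex^'n^'n \<Rightarrow> bool" where
  "pos_semidef X \<longleftrightarrow> hadj X = X \<and> (\<forall>v. 0 \<le> Re (cvec_ip (X *v v) v))"

definition block_matrix ::
  "complex^'n^'n \<Rightarrow> complex^'n^'n \<Rightarrow> complex^'n^'n \<Rightarrow> complex^'n^'n \<Rightarrow> complex^('n + 'n)^('n + 'n)" where
  "block_matrix X11 X12 X21 X22 = (\<chi> i j.
     case i of
       Inl a \<Rightarrow> (case j of Inl b \<Rightarrow> X11 $ a $ b | Inr b \<Rightarrow> X12 $ a $ b)
     | Inr a \<Rightarrow> (case j of Inl b \<Rightarrow> X21 $ a $ b | Inr b \<Rightarrow> X22 $ a $ b))"


section \<open>Complex Hilbert spaces with an explicit carrier\<close>

record 'a hspace =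
  hset :: "'a set"
  hzero :: 'a
  hadd :: "'a \<Rightarrow> 'a \<Rightarrow> 'a"
  hscale :: "complex \<Rightarrow> 'a \<Rightarrow> 'a"
  hip :: "'a \<Rightarrow> 'a \<Rightarrow> complex"

definition hdiff :: "'a hspace \<Rightarrow> 'a \<Rightarrow> 'a \<Rightarrow> 'a" where
  "hdiff E x y = hadd E x (hscale E (-1) y)"

definition hnorm :: "'a hspace \<Rightarrow> 'a \<Rightarrow> real" where
  "hnorm E x = sqrt (Re (hip E x x))"

locale complex_hilbert_space =
  fixes E :: "'a hspace"
  assumes zero_closed: "hzero E \<in> hset E"
    and add_closed: "\<lbrakk>x \<in> hset E; y \<in> hset E\<rbrakk> \<Longrightarrow> hadd E x y \<in> hset E"
    and scale_closed: "x \<in> hset E \<Longrightarrow> hscale E a x \<in> hset E"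
    and add_assoc: "\<lbrakk>x \<in> hset E; y \<in> hset E; z \<in> hset E\<rbrakk>
          \<Longrightarrow> hadd E (hadd E x y) z = hadd E x (hadd E y z)"
    and add_commute: "\<lbrakk>x \<in> hset E; y \<in> hset E\<rbrakk> \<Longrightarrow> hadd E x y = hadd E y x"
    and add_zero: "x \<in> hset E \<Longrightarrow> hadd E (hzero E) x = x"
    and add_inverse: "x \<in> hset E \<Longrightarrow> hdiff E x x = hzero E"
    and scale_add: "\<lbrakk>x \<in> hset E; y \<in> hset E\<rbrakk>
          \<Longrightarrow> hscale E a (hadd E x y) = hadd E (hscale E a x) (hscale E a y)"
    and add_scale: "x \<in> hset E \<Longrightarrow> hscale E (a + b) x = hadd E (hscale E a x) (hscale E b x)"
    and scale_scale: "x \<in> hset E \<Longrightarrow> hscale E a (hscale E b x) = hscale E (a * b) x"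
    and scale_one: "x \<in> hset E \<Longrightarrow> hscale E 1 x = x"
    and ip_add: "\<lbrakk>x \<in> hset E; y \<in> hset E; z \<in> hset E\<rbrakk>
          \<Longrightarrow> hip E (hadd E x y) z = hip E x z + hip E y z"
    and ip_scale: "\<lbrakk>x \<in> hset E; y \<in> hset E\<rbrakk> \<Longrightarrow> hip E (hscale E a x) y = a * hip E x y"
    and ip_cnj: "\<lbrakk>x \<in> hset E; y \<in> hset E\<rbrakk> \<Longrightarrow> hip E y x = cnj (hip E x y)"
    and ip_nonneg: "x \<in> hset E \<Longrightarrow> 0 \<le> Re (hip E x x)"
    and ip_definite: "\<lbrakk>x \<in> hset E; hip E x x = 0\<rbrakk> \<Longrightarrow> x = hzero E"
    and complete: "\<lbrakk>\<And>n. s n \<in> hset E;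
            \<forall>e>0. \<exists>N::nat. \<forall>m\<ge>N. \<forall>n\<ge>N. hnorm E (hdiff E (s m) (s n)) < e\<rbrakk>
          \<Longrightarrow> \<exists>x\<in>hset E. (\<lambda>n. hnorm E (hdiff E (s n) x)) \<longlonglongrightarrow> 0"

definition hclosure :: "'a hspace \<Rightarrow> 'a set \<Rightarrow> 'a set" where
  "hclosure E S = {x \<in> hset E. \<forall>e>0. \<exists>y\<in>S. hnorm E (hdiff E x y) < e}"

text \<open>Orthogonal projection of \<open>x\<close> onto a closed subspace \<open>S\<close>.\<close>

definition hproj :: "'a hspace \<Rightarrow> 'a set \<Rightarrow> 'a \<Rightarrow> 'a" where
  "hproj E S x = (THE y. y \<in> S \<and> (\<forall>z\<in>S. hip E (hdiff E x y) z = 0))"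


section \<open>Linear relations\<close>

definition rel_closure :: "'a hspace \<Rightarrow> ('a \<times> 'a) set \<Rightarrow> ('a \<times> 'a) set" where
  "rel_closure E T = {(f, g). f \<in> hset E \<and> g \<in> hset E \<and>
     (\<forall>e>0. \<exists>(f0, g0)\<in>T. hnorm E (hdiff E f f0) < e \<and> hnorm E (hdiff E g g0) < e)}"

definition rel_adjoint :: "'a hspace \<Rightarrow> ('a \<times> 'a) set \<Rightarrow> ('a \<times> 'a) set" where
  "rel_adjoint E T = {(h, h'). h \<in> hset E \<and> h' \<in> hset E \<and>
     (\<forall>(f, f')\<in>T. hip E f' h = hip E f h')}"

definition rel_selfadjoint :: "'a hspace \<Rightarrow> ('a \<times> 'a) set \<Rightarrow> bool" where
  "rel_selfadjoint E T \<longleftrightarrow> rel_adjoint E T = T"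

definition resolvent_set :: "'a hspace \<Rightarrow> ('a \<times> 'a) set \<Rightarrow> complex set" where
  "resolvent_set E T = {z.
     (\<forall>g\<in>hset E. \<exists>!f. f \<in> hset E \<and> (f, hadd E g (hscale E z f)) \<in> T) \<and>
     (\<exists>C. \<forall>(f, f')\<in>T. hnorm E f \<le> C * hnorm E (hdiff E f' (hscale E z f)))}"

text \<open>\<open>(T - z)\<^sup>-\<^sup>1 g\<close>.\<close>

definition resolvent :: "'a hspace \<Rightarrow> ('a \<times> 'a) set \<Rightarrow> complex \<Rightarrow> 'a \<Rightarrow> 'a" where
  "resolvent E T z g = (THE f. f \<in> hset E \<and> (f, hadd E g (hscale E z f)) \<in> T)"

text \<open>
  A larger space \<open>K \<supseteq> E\<close> is given by an isometric embedding \<open>\<iota>\<close>, along which \<open>E\<close> is identified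
  with a subspace of \<open>K\<close>.
\<close>

definition isometric_embedding :: "'a hspace \<Rightarrow> 'k hspace \<Rightarrow> ('a \<Rightarrow> 'k) \<Rightarrow> bool" where
  "isometric_embedding E K \<iota> \<longleftrightarrow>
     (\<forall>x\<in>hset E. \<iota> x \<in> hset K) \<and>
     (\<forall>x\<in>hset E. \<forall>y\<in>hset E. \<iota> (hadd E x y) = hadd K (\<iota> x) (\<iota> y)) \<and>
     (\<forall>a. \<forall>x\<in>hset E. \<iota> (hscale E a x) = hscale K a (\<iota> x)) \<and>
     (\<forall>x\<in>hset E. \<forall>y\<in>hset E. hip K (\<iota> x) (\<iota> y) = hip E x y)"

definition selfadjoint_extension ::
  "'a hspace \<Rightarrow> ('a \<times> 'a) set \<Rightarrow> 'k hspace \<Rightarrow> ('a \<Rightarrow> 'k) \<Rightarrow> ('k \<times> 'k) set \<Rightarrow> bool" where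
  "selfadjoint_extension E A K \<iota> At \<longleftrightarrow>
     complex_hilbert_space K \<and> isometric_embedding E K \<iota> \<and> rel_selfadjoint K At \<and>
     (\<forall>(f, g)\<in>A. (\<iota> f, \<iota> g) \<in> At)"

text \<open>Compression to \<open>E\<close> of the resolvent of \<open>At\<close>: the orthogonal projection onto \<open>E\<close> is determined
  by \<open>\<langle>P k, e\<rangle> = \<langle>k, \<iota> e\<rangle>\<close> for \<open>e \<in> E\<close>.\<close>

definition generalized_resolvent ::
  "'a hspace \<Rightarrow> 'k hspace \<Rightarrow> ('a \<Rightarrow> 'k) \<Rightarrow> ('k \<times> 'k) set \<Rightarrow> complex \<Rightarrow> 'a \<Rightarrow> 'a" where
  "generalized_resolvent E K \<iota> At z g =
     (THE h. h \<in> hset E \<and> (\<forall>e\<in>hset E. hip E h e = hip K (resolvent K At z (\<iota> g)) (\<iota> e)))"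


section \<open>Rigging\<close>

definition plus_space :: "'a hspace \<Rightarrow> ('a \<times> 'a) set \<Rightarrow> 'a set" where
  "plus_space E A = Domain (rel_adjoint E A)"

text \<open>The choice of \<open>f'\<close> is immaterial: two choices differ by an element of
  \<open>mul A\<^sup>* = (dom A)\<^sup>\<bottom>\<close>, which the projection annihilates.\<close>

definition plus_norm :: "'a hspace \<Rightarrow> ('a \<times> 'a) set \<Rightarrow> 'a \<Rightarrow> real" where
  "plus_norm E A f =
     sqrt ((hnorm E f)\<^sup>2 +
       (hnorm E (hproj E (hclosure E (Domain A)) (SOME f'. (f, f') \<in> rel_adjoint E A)))\<^sup>2)"

text \<open>Functionals on the plus space are extended by \<open>0\<close> to the whole type, so that equality of
  functionals is equality of functions and linear combinations are formed pointwise.\<close>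

definition minus_space :: "'a hspace \<Rightarrow> ('a \<times> 'a) set \<Rightarrow> ('a \<Rightarrow> complex) set" where
  "minus_space E A = {\<phi>.
     (\<forall>h\<in>plus_space E A. \<forall>k\<in>plus_space E A. \<phi> (hadd E h k) = \<phi> h + \<phi> k) \<and>
     (\<forall>a. \<forall>h\<in>plus_space E A. \<phi> (hscale E a h) = cnj a * \<phi> h) \<and>
     (\<exists>C. \<forall>h\<in>plus_space E A. cmod (\<phi> h) \<le> C * plus_norm E A h) \<and>
     (\<forall>h. h \<notin> plus_space E A \<longrightarrow> \<phi> h = 0)}"

definition minus_embed :: "'a hspace \<Rightarrow> ('a \<times> 'a) set \<Rightarrow> 'a \<Rightarrow> ('a \<Rightarrow> complex)" where
  "minus_embed E A f = (\<lambda>h. if h \<in> plus_space E A then hip E f h else 0)"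

definition minus_plus :: "('a \<Rightarrow> complex) \<Rightarrow> 'a \<Rightarrow> complex" where
  "minus_plus \<phi> h = \<phi> h"

definition plus_minus :: "'a \<Rightarrow> ('a \<Rightarrow> complex) \<Rightarrow> complex" where
  "plus_minus h \<phi> = cnj (minus_plus \<phi> h)"

text \<open>
  Adjoint with respect to dualities. If \<open>T : X \<rightarrow> Y\<close>, where \<open>X\<close> is in duality with \<open>X'\<close> via \<open>bX\<close>
  and \<open>Y\<close> with \<open>Y'\<close> via \<open>bY\<close>, then \<open>T\<^sup>\<langle>\<^sup>*\<^sup>\<rangle> : Y' \<rightarrow> X'\<close> is given by
  \<open>bY (T x) y' = bX x (T\<^sup>\<langle>\<^sup>*\<^sup>\<rangle> y')\<close>.
\<close>

definition dual_adjoint ::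
  "'x set \<Rightarrow> 'x1 set \<Rightarrow> ('x \<Rightarrow> 'x1 \<Rightarrow> complex) \<Rightarrow> ('y \<Rightarrow> 'y1 \<Rightarrow> complex) \<Rightarrow> ('x \<Rightarrow> 'y) \<Rightarrow> 'y1 \<Rightarrow> 'x1" where
  "dual_adjoint X X' bX bY T y' = (THE x'. x' \<in> X' \<and> (\<forall>x\<in>X. bY (T x) y' = bX x x'))"

text \<open>The relation \<open>\<bold>A\<close> in \<open>E \<times> E\<^sub>-\<close> and \<open>ran (\<bold>A - z)\<close>.\<close>

definition extended_rel :: "'a hspace \<Rightarrow> ('a \<times> 'a) set \<Rightarrow> ('a \<times> ('a \<Rightarrow> complex)) set" where
  "extended_rel E A = {(f, \<phi>). f \<in> hset E \<and> \<phi> \<in> minus_space E A \<and>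
     (\<forall>(h, h')\<in>rel_adjoint E A. minus_plus \<phi> h = hip E f h')}"

definition extended_ran :: "'a hspace \<Rightarrow> ('a \<times> 'a) set \<Rightarrow> complex \<Rightarrow> ('a \<Rightarrow> complex) set" where
  "extended_ran E A z = {\<lambda>h. \<phi> h - z * minus_embed E A f h | f \<phi>. (f, \<phi>) \<in> extended_rel E A}"

text \<open>\<open>\<Pi>\<^sup>z\<close>: projection onto \<open>\<LL>\<close> parallel to \<open>ran (\<bold>A - z)\<close>.\<close>

definition gauge_proj ::
  "'a hspace \<Rightarrow> ('a \<times> 'a) set \<Rightarrow> ('a \<Rightarrow> complex) set \<Rightarrow> complex \<Rightarrow> ('a \<Rightarrow> complex) \<Rightarrow> ('a \<Rightarrow> complex)" where
  "gauge_proj E A \<LL> z \<phi> = (THE \<psi>. \<psi> \<in> \<LL> \<and> (\<lambda>h. \<phi> h - \<psi> h) \<in> extended_ran E A z)"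


section \<open>Adjoints, regularized resolvents, and the left resolvent matrix\<close>

definition gauge_adj ::
  "'a hspace \<Rightarrow> ('a \<times> 'a) set \<Rightarrow> (complex^'p \<Rightarrow> ('a \<Rightarrow> complex)) \<Rightarrow> 'a \<Rightarrow> complex^'p" where
  "gauge_adj E A L = dual_adjoint UNIV UNIV cvec_ip minus_plus L"

text \<open>\<open>R\<^sup>\<langle>\<^sup>*\<^sup>\<rangle> : E\<^sub>- \<rightarrow> E\<close> for \<open>R : E \<rightarrow> E\<^sub>+\<close>.\<close>

definition res_adj :: "'a hspace \<Rightarrow> ('a \<Rightarrow> 'a) \<Rightarrow> ('a \<Rightarrow> complex) \<Rightarrow> 'a" where
  "res_adj E R = dual_adjoint (hset E) (hset E) (hip E) plus_minus R"

definition mean_resolvent :: "'a hspace \<Rightarrow> ('a \<times> 'a) set \<Rightarrow> 'a \<Rightarrow> 'a" where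
  "mean_resolvent E A0 g =
     hscale E (1/2) (hadd E (resolvent E A0 \<i> g) (resolvent E A0 (-\<i>) g))"

definition regularized_resolvent ::
  "'a hspace \<Rightarrow> ('a \<times> 'a) set \<Rightarrow> (complex \<Rightarrow> 'a \<Rightarrow> 'a) \<Rightarrow> complex \<Rightarrow> ('a \<Rightarrow> complex) \<Rightarrow> 'a" where
  "regularized_resolvent E A0 R z \<phi> =
     hdiff E (res_adj E (R (cnj z)) \<phi>) (res_adj E (mean_resolvent E A0) \<phi>)"

definition calP ::
  "'a hspace \<Rightarrow> ('a \<times> 'a) set \<Rightarrow> (complex^'p \<Rightarrow> ('a \<Rightarrow> complex)) \<Rightarrow> complex \<Rightarrow> ('a \<Rightarrow> complex) \<Rightarrow> complex^'p" where
  "calP E A L z \<phi> = the_inv_into UNIV L (gauge_proj E A (range L) z \<phi>)"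

definition calP_adj ::
  "'a hspace \<Rightarrow> ('a \<times> 'a) set \<Rightarrow> (complex^'p \<Rightarrow> ('a \<Rightarrow> complex)) \<Rightarrow> complex \<Rightarrow> complex^'p \<Rightarrow> 'a" where
  "calP_adj E A L z =
     dual_adjoint (minus_space E A) (plus_space E A) minus_plus cvec_ip (calP E A L z)"

text \<open>\<open>\<Q>(z)\<close> formed with the generalized resolvent \<open>R\<close>.\<close>

definition calQ ::
  "'a hspace \<Rightarrow> ('a \<times> 'a) set \<Rightarrow> ('a \<times> 'a) set \<Rightarrow> (complex^'p \<Rightarrow> ('a \<Rightarrow> complex)) \<Rightarrow>
   (complex \<Rightarrow> 'a \<Rightarrow> 'a) \<Rightarrow> complex \<Rightarrow> 'a \<Rightarrow> complex^'p" where
  "calQ E A A0 L R z f =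
     gauge_adj E A L (hdiff E (R z f)
       (regularized_resolvent E A0 R z (gauge_proj E A (range L) z (minus_embed E A f))))"

definition calQ_adj ::
  "'a hspace \<Rightarrow> ('a \<times> 'a) set \<Rightarrow> ('a \<times> 'a) set \<Rightarrow> (complex^'p \<Rightarrow> ('a \<Rightarrow> complex)) \<Rightarrow>
   (complex \<Rightarrow> 'a \<Rightarrow> 'a) \<Rightarrow> complex \<Rightarrow> complex^'p \<Rightarrow> 'a" where
  "calQ_adj E A A0 L R z =
     dual_adjoint (hset E) (hset E) (hip E) cvec_ip (calQ E A A0 L R z)"

text \<open>Boundary maps \<open>G0\<close>, \<open>G1\<close> act on the elements \<open>(f, f')\<close> of \<open>A\<^sup>*\<close>.\<close>

definition ker_ext ::
  "'a hspace \<Rightarrow> ('a \<times> 'a) set \<Rightarrow> ('a \<times> 'a \<Rightarrow> complex^'p) \<Rightarrow> ('a \<times> 'a) set" where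
  "ker_ext E A G0 = {x \<in> rel_adjoint E A. G0 x = 0}"

definition gamma_field ::
  "'a hspace \<Rightarrow> ('a \<times> 'a) set \<Rightarrow> ('a \<times> 'a \<Rightarrow> complex^'p) \<Rightarrow> complex \<Rightarrow> complex^'p \<Rightarrow> 'a" where
  "gamma_field E A G0 z u =
     (THE h. (h, hscale E z h) \<in> rel_adjoint E A \<and> G0 (h, hscale E z h) = u)"

definition weyl_function ::
  "'a hspace \<Rightarrow> ('a \<times> 'a) set \<Rightarrow> ('a \<times> 'a \<Rightarrow> complex^'p) \<Rightarrow> ('a \<times> 'a \<Rightarrow> complex^'p) \<Rightarrow>
   complex \<Rightarrow> complex^'p \<Rightarrow> complex^'p" where
  "weyl_function E A G0 G1 z u =
     G1 (gamma_field E A G0 z u, hscale E z (gamma_field E A G0 z u))"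

definition left_resolvent_matrix ::
  "'a hspace \<Rightarrow> ('a \<times> 'a) set \<Rightarrow> ('a \<times> 'a \<Rightarrow> complex^'p) \<Rightarrow> ('a \<times> 'a \<Rightarrow> complex^'p) \<Rightarrow>
   (complex^'p \<Rightarrow> ('a \<Rightarrow> complex)) \<Rightarrow> complex \<Rightarrow> complex^('p + 'p)^('p + 'p)" where
  "left_resolvent_matrix E A G0 G1 L z =
    (let A0 = ker_ext E A G0;
         a11 = matrix (weyl_function E A G0 G1 z);
         a12 = matrix (\<lambda>u. dual_adjoint UNIV UNIV cvec_ip plus_minus
                              (gamma_field E A G0 (cnj z)) (L u));
         a21 = matrix (\<lambda>u. gauge_adj E A L (gamma_field E A G0 z u));
         a22 = matrix (\<lambda>u. gauge_adj E A L
                              (regularized_resolvent E A0 (resolvent E A0) z (L u)))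
     in block_matrix
          (matrix_inv a21 ** a22)                (matrix_inv a21)
          (a11 ** matrix_inv a21 ** a22 - a12)   (a11 ** matrix_inv a21))"


section \<open>Canonical systems\<close>

definition abs_continuous_on :: "real \<Rightarrow> real \<Rightarrow> (real \<Rightarrow> 'b::real_normed_vector) \<Rightarrow> bool" where
  "abs_continuous_on a b f \<longleftrightarrow>
     (\<forall>e>0. \<exists>d>0. \<forall>D. D division_of \<Union>D \<and> \<Union>D \<subseteq> {a..b} \<and> (\<Sum>k\<in>D. measure lborel k) < d \<longrightarrow>
        (\<Sum>k\<in>D. norm (f (Sup k) - f (Inf k))) < e)"

text \<open>\<open>f \<in> AC[0,l]\<close> and \<open>J f' + F f = H g\<close> almost everywhere.\<close>

definition canonical_eq ::
  "real \<Rightarrow> complex^'p^'p \<Rightarrow> (real \<Rightarrow> complex^'p^'p) \<Rightarrow> (real \<Rightarrow> complex^'p^'p) \<Rightarrow>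
   (real \<Rightarrow> complex^'p) \<Rightarrow> (real \<Rightarrow> complex^'p) \<Rightarrow> bool" where
  "canonical_eq l J F H f g \<longleftrightarrow> abs_continuous_on 0 l f \<and>
     (AE t in lebesgue_on {0<..<l}. \<exists>d. (f has_vector_derivative d) (at t) \<and>
        J *v d + F t *v f t = H t *v g t)"

definition condition_A1 ::
  "real \<Rightarrow> (real \<Rightarrow> complex^'p^'p) \<Rightarrow> (real \<Rightarrow> complex^'p^'p) \<Rightarrow> bool" where
  "condition_A1 l F H \<longleftrightarrow>
     (\<forall>i j. integrable (lebesgue_on {0<..<l}) (\<lambda>t. F t $ i $ j)) \<and>
     (\<forall>i j. integrable (lebesgue_on {0<..<l}) (\<lambda>t. H t $ i $ j)) \<and>
     (AE t in lebesgue_on {0<..<l}. real_hermitian (F t)) \<and>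
     (AE t in lebesgue_on {0<..<l}. real_hermitian (H t)) \<and>
     (AE t in lebesgue_on {0<..<l}. pos_semidef (H t))"

definition condition_A2 ::
  "real \<Rightarrow> complex^'p^'p \<Rightarrow> (real \<Rightarrow> complex^'p^'p) \<Rightarrow> (real \<Rightarrow> complex^'p^'p) \<Rightarrow> bool" where
  "condition_A2 l J F H \<longleftrightarrow>
     (\<forall>f. canonical_eq l J F H f (\<lambda>t. 0) \<and> (AE t in lebesgue_on {0<..<l}. H t *v f t = 0)
        \<longrightarrow> (\<forall>t\<in>{0..l}. f t = 0))"

definition fundamental_matrix ::
  "real \<Rightarrow> complex^'p^'p \<Rightarrow> (real \<Rightarrow> complex^'p^'p) \<Rightarrow> (real \<Rightarrow> complex^'p^'p) \<Rightarrow>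
   (real \<Rightarrow> complex \<Rightarrow> complex^'p^'p) \<Rightarrow> bool" where
  "fundamental_matrix l J F H U \<longleftrightarrow> (\<forall>z. U 0 z = mat 1 \<and> abs_continuous_on 0 l (\<lambda>t. U t z) \<and>
     (AE t in lebesgue_on {0<..<l}. \<exists>D. ((\<lambda>s. U s z) has_vector_derivative D) (at t) \<and>
        J ** D + F t ** U t z = mat z ** H t ** U t z))"

text \<open>Functions are total on \<open>real\<close>; their values outside \<open>(0,l)\<close> do not affect the class.\<close>

definition L2_fun :: "real \<Rightarrow> (real \<Rightarrow> complex^'p^'p) \<Rightarrow> (real \<Rightarrow> complex^'p) set" where
  "L2_fun l H = {f \<in> borel_measurable (lebesgue_on {0<..<l}).
     integrable (lebesgue_on {0<..<l}) (\<lambda>t. cvec_ip (H t *v f t) (f t))}"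

definition L2_ip ::
  "real \<Rightarrow> (real \<Rightarrow> complex^'p^'p) \<Rightarrow> (real \<Rightarrow> complex^'p) \<Rightarrow> (real \<Rightarrow> complex^'p) \<Rightarrow> complex" where
  "L2_ip l H f g = (LINT t|lebesgue_on {0<..<l}. cvec_ip (H t *v f t) (g t))"

definition L2_rel ::
  "real \<Rightarrow> (real \<Rightarrow> complex^'p^'p) \<Rightarrow> ((real \<Rightarrow> complex^'p) \<times> (real \<Rightarrow> complex^'p)) set" where
  "L2_rel l H = {(f, g). f \<in> L2_fun l H \<and> g \<in> L2_fun l H \<and>
     L2_ip l H (\<lambda>t. f t - g t) (\<lambda>t. f t - g t) = 0}"

definition L2_class ::
  "real \<Rightarrow> (real \<Rightarrow> complex^'p^'p) \<Rightarrow> (real \<Rightarrow> complex^'p) \<Rightarrow> (real \<Rightarrow> complex^'p) set" where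
  "L2_class l H f = L2_rel l H `` {f}"

definition L2_rep :: "(real \<Rightarrow> complex^'p) set \<Rightarrow> (real \<Rightarrow> complex^'p)" where
  "L2_rep X = (SOME f. f \<in> X)"

definition L2H :: "real \<Rightarrow> (real \<Rightarrow> complex^'p^'p) \<Rightarrow> (real \<Rightarrow> complex^'p) set hspace" where
  "L2H l H = \<lparr>
     hset = L2_fun l H // L2_rel l H,
     hzero = L2_class l H (\<lambda>t. 0),
     hadd = (\<lambda>X Y. L2_class l H (\<lambda>t. L2_rep X t + L2_rep Y t)),
     hscale = (\<lambda>a X. L2_class l H (\<lambda>t. a *s L2_rep X t)),
     hip = (\<lambda>X Y. L2_ip l H (L2_rep X) (L2_rep Y)) \<rparr>"

definition A_max ::
  "real \<Rightarrow> complex^'p^'p \<Rightarrow> (real \<Rightarrow> complex^'p^'p) \<Rightarrow> (real \<Rightarrow> complex^'p^'p) \<Rightarrow>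
   ((real \<Rightarrow> complex^'p) set \<times> (real \<Rightarrow> complex^'p) set) set" where
  "A_max l J F H = {(X, Y). X \<in> hset (L2H l H) \<and> Y \<in> hset (L2H l H) \<and>
     (\<exists>f\<in>X. \<exists>g\<in>Y. canonical_eq l J F H f g)}"

definition A_min ::
  "real \<Rightarrow> complex^'p^'p \<Rightarrow> (real \<Rightarrow> complex^'p^'p) \<Rightarrow> (real \<Rightarrow> complex^'p^'p) \<Rightarrow>
   ((real \<Rightarrow> complex^'p) set \<times> (real \<Rightarrow> complex^'p) set) set" where
  "A_min l J F H = rel_closure (L2H l H)
     {(X, Y) \<in> A_max l J F H. \<exists>f\<in>X. \<exists>g\<in>Y. canonical_eq l J F H f g \<and>
        (\<exists>a b. 0 < a \<and> a \<le> b \<and> b < l \<and> (\<forall>t\<in>{0..l}. t \<notin> {a..b} \<longrightarrow> f t = 0))}"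

text \<open>By (A2) the absolutely continuous representative of a pair in \<open>A_max\<close> is unique on \<open>[0,l]\<close>.\<close>

definition ac_rep ::
  "real \<Rightarrow> complex^'p^'p \<Rightarrow> (real \<Rightarrow> complex^'p^'p) \<Rightarrow> (real \<Rightarrow> complex^'p^'p) \<Rightarrow>
   (real \<Rightarrow> complex^'p) set \<times> (real \<Rightarrow> complex^'p) set \<Rightarrow> (real \<Rightarrow> complex^'p)" where
  "ac_rep l J F H = (\<lambda>(X, Y). SOME f. f \<in> X \<and> (\<exists>g\<in>Y. canonical_eq l J F H f g))"

definition Gamma0 ::
  "real \<Rightarrow> complex^'p^'p \<Rightarrow> (real \<Rightarrow> complex^'p^'p) \<Rightarrow> (real \<Rightarrow> complex^'p^'p) \<Rightarrow>
   (real \<Rightarrow> complex^'p) set \<times> (real \<Rightarrow> complex^'p) set \<Rightarrow> complex^'p" where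
  "Gamma0 l J F H x = (1 / sqrt 2) *\<^sub>R (ac_rep l J F H x 0 + ac_rep l J F H x l)"

definition Gamma1 ::
  "real \<Rightarrow> complex^'p^'p \<Rightarrow> (real \<Rightarrow> complex^'p^'p) \<Rightarrow> (real \<Rightarrow> complex^'p^'p) \<Rightarrow>
   (real \<Rightarrow> complex^'p) set \<times> (real \<Rightarrow> complex^'p) set \<Rightarrow> complex^'p" where
  "Gamma1 l J F H x = - ((1 / sqrt 2) *\<^sub>R (J *v (ac_rep l J F H x 0 - ac_rep l J F H x l)))"

text \<open>
  \<open>\<delta> \<otimes> u\<close> depends on a class in \<open>dom A\<^sup>*\<close> only, not on a pair in \<open>A\<^sup>*\<close>. Since \<open>A\<^sup>*\<close> may be multivalued,
  (A2) does not make the value at \<open>0\<close> of an absolutely continuous representative unique; that is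
  the first half of \<open>delta_standing\<close>.
\<close>

definition delta ::
  "real \<Rightarrow> complex^'p^'p \<Rightarrow> (real \<Rightarrow> complex^'p^'p) \<Rightarrow> (real \<Rightarrow> complex^'p^'p) \<Rightarrow>
   complex^'p \<Rightarrow> (real \<Rightarrow> complex^'p) set \<Rightarrow> complex" where
  "delta l J F H u = (\<lambda>X. if X \<in> plus_space (L2H l H) (A_min l J F H)
     then cvec_ip u ((SOME f. f \<in> X \<and> (\<exists>g\<in>L2_fun l H. canonical_eq l J F H f g)) 0)
     else 0)"

definition delta_standing ::
  "real \<Rightarrow> complex^'p^'p \<Rightarrow> (real \<Rightarrow> complex^'p^'p) \<Rightarrow> (real \<Rightarrow> complex^'p^'p) \<Rightarrow> bool" where
  "delta_standing l J F H \<longleftrightarrow>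
     (\<forall>f1 f2. (f1, f2) \<in> L2_rel l H \<and>
        (\<exists>g\<in>L2_fun l H. canonical_eq l J F H f1 g) \<and>
        (\<exists>g\<in>L2_fun l H. canonical_eq l J F H f2 g) \<longrightarrow> f1 0 = f2 0) \<and>
     (\<forall>u. delta l J F H u \<in> minus_space (L2H l H) (A_min l J F H))"

definition gauge_map ::
  "real \<Rightarrow> complex^'p^'p \<Rightarrow> (real \<Rightarrow> complex^'p^'p) \<Rightarrow> (real \<Rightarrow> complex^'p^'p) \<Rightarrow>
   complex^'p \<Rightarrow> ((real \<Rightarrow> complex^'p) set \<Rightarrow> complex)" where
  "gauge_map l J F H u = (\<lambda>X. complex_of_real (sqrt 2) * delta l J F H u X)"

end

theory Submission
  imports Defs
begin

text \<open>
  The matrix identity \<open>U(t, z\<^sup>*)\<^sup>* J U(t, z) = J\<close> and variation of constants turn every element of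
  \<open>A\<^sup>*\<close> into an explicit absolutely continuous solution. Testing a functional on the defect subspace
  \<open>{U(\<cdot>, z\<^sup>*)w}\<close> reads off its component along \<open>\<LL>\<close>: if it vanishes there, then
  \<open>g \<mapsto> \<phi>(h)\<close>, with \<open>h\<close> the solution of the inhomogeneous equation with data \<open>g\<close> and \<open>h(0) = 0\<close>, is
  bounded, and Riesz' theorem puts \<open>\<phi>\<close> into the range of \<open>\<bold>A - z\<close>. This gives \<open>\<P>(z)\<close>. For
  \<open>\<Q>(z)\<close> let \<open>h\<close> solve the equation with data \<open>f\<close> and \<open>h(l) = 0\<close>; Lagrange's identity says that
  \<open>h = R\<^sub>z f - R\<^sub>z L v\<close> with \<open>v = \<P>(z)f\<close> for every generalized resolvent, so only \<open>h(0)\<close> and the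
  mean of the resolvents of \<open>A\<^sub>0\<close> at \<open>\<plusminus>i\<close> enter. The entries of the resolvent matrix are then
  values at \<open>0\<close> of explicit solutions.
\<close>

section \<open>Absolutely continuous functions\<close>

text \<open>The rigging is built on the abstract adjoint of \<open>A_min\<close>, so nothing is
  explicit until that adjoint is identified with \<open>A_max\<close>. The difficulty there is that
  (A2) gives definiteness on the whole interval only, while core elements are supported in its
  interior. Three more obstacles shape the development. The weight may be singular, so a Cauchy
  sequence in L2 determines only a limit of \<open>H f\<close>, and a representative must be
  recovered by solving a singular linear system measurably. The minimal relation need not be densely
  defined, so the plus norm is compared with the graph norm through a projection. Operators are
  given by definite descriptions, so each evaluation needs a uniqueness argument. The matrix K comes
  from the regularization at i and -i: with P(z) the inverse of I + U(l,z), the symplectic identity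
  gives (P(i) + P(-i))J = J + K. Hence \<open>calQ\<close> is J - K applied after
  \<open>calP\<close>, and passing to the adjoint gives the factor -(J + K), because J is skew and K
  Hermitian.\<close>

lemma AC_D:
  assumes "abs_continuous_on a b f" "e > 0"
  obtains d where "d > 0" "\<And>D. D division_of \<Union>D \<Longrightarrow> \<Union>D \<subseteq> {a..b} \<Longrightarrow> (\<Sum>k\<in>D. measure lborel k) < d
     \<Longrightarrow> (\<Sum>k\<in>D. norm (f (Sup k) - f (Inf k))) < e"
proof -
  from assms have "\<exists>d>0. \<forall>D. D division_of \<Union>D \<and> \<Union>D \<subseteq> {a..b} \<and> (\<Sum>k\<in>D. measure lborel k) < d \<longrightarrow>
        (\<Sum>k\<in>D. norm (f (Sup k) - f (Inf k))) < e"
    unfolding abs_continuous_on_def by simp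
  then show thesis using that by (elim exE conjE) simp
qed

lemma AC_division_bounds:
  fixes D :: "real set set"
  assumes "D division_of \<Union>D" "\<Union>D \<subseteq> {a..b}" "k \<in> D"
  shows "Inf k \<in> {a..b}" "Sup k \<in> {a..b}" "Inf k \<le> Sup k" "k = {Inf k..Sup k}"
proof -
  obtain u v where k: "k = cbox u v" using division_ofD(4)[OF assms(1,3)] by blast
  have ne: "k \<noteq> {}" by (rule division_ofD(3)[OF assms(1,3)])
  have sub: "k \<subseteq> {a..b}" using assms by blast
  have uv: "u \<le> v" using k ne by auto
  then have IS: "Inf k = u" "Sup k = v" using k by auto
  have "u \<in> {a..b}" "v \<in> {a..b}" using sub uv unfolding k by auto
  then show "Inf k \<in> {a..b}" "Sup k \<in> {a..b}" "Inf k \<le> Sup k" "k = {Inf k..Sup k}"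
    unfolding IS using uv k by auto
qed

lemma AC_continuous:
  fixes f :: "real \<Rightarrow> 'a::real_normed_vector"
  assumes "abs_continuous_on a b f"
  shows "continuous_on {a..b} f"
proof -
  have "\<exists>d>0. \<forall>y\<in>{a..b}. dist y x < d \<longrightarrow> dist (f y) (f x) \<le> e"
    if x: "x \<in> {a..b}" and "e > 0" for x e
  proof -
    obtain d where d: "d > 0" "\<And>D. D division_of \<Union>D \<Longrightarrow> \<Union>D \<subseteq> {a..b} \<Longrightarrow> (\<Sum>k\<in>D. measure lborel k) < d
       \<Longrightarrow> (\<Sum>k\<in>D. norm (f (Sup k) - f (Inf k))) < e"
      using AC_D[OF assms \<open>e > 0\<close>] by blast
    have "dist (f y) (f x) \<le> e" if y: "y \<in> {a..b}" "dist y x < d" for y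
    proof -
      define u v where "u = min x y" and "v = max x y"
      have uv: "u \<le> v" "v - u < d" "{u..v} \<subseteq> {a..b}" using x y by (auto simp: u_def v_def dist_real_def)
      have "{{u..v}} division_of \<Union>{{u..v}}"
        using uv(1) by (auto intro!: division_of_self simp: box_real[symmetric] simp del: box_real)
      from d(2)[OF this] uv have "norm (f v - f u) < e" by simp
      then show ?thesis
        by (cases "x \<le> y") (simp_all add: u_def v_def dist_norm min_def max_def norm_minus_commute)
    qed
    then show ?thesis using d(1) by blast
  qed
  note * = this
  show ?thesis unfolding continuous_on_iff
  proof (intro ballI allI impI)
    fix x e assume "x \<in> {a..b}" "(e::real) > 0"
    moreover from this obtain d where "d > 0" "\<forall>y\<in>{a..b}. dist y x < d \<longrightarrow> dist (f y) (f x) \<le> e/2"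
      using *[of x "e/2"] by auto
    ultimately show "\<exists>d>0. \<forall>x'\<in>{a..b}. dist x' x < d \<longrightarrow> dist (f x') (f x) < e"
      by (intro exI[of _ d]) force
  qed
qed

text \<open>One estimate serves sums, linear images and products: when the increments of h are
  dominated by those of f and g, smallness of the two variation sums passes to h. Two inner
  functions are allowed because a product is Lipschitz in the pair once both factors are
  bounded.\<close>

lemma AC_compose_lipschitz2:
  assumes "abs_continuous_on a b f" "abs_continuous_on a b g" "C \<ge> 0"
    and lip: "\<And>s t. s \<in> {a..b} \<Longrightarrow> t \<in> {a..b} \<Longrightarrow>
       norm (h t - h s) \<le> C * (norm (f t - f s) + norm (g t - g s))"
  shows "abs_continuous_on a b h"
  unfolding abs_continuous_on_def
proof (intro allI impI)
  fix e :: real assume "e > 0"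
  \<comment> \<open>Dividing by \<open>C + 1\<close> also covers \<open>C = 0\<close> and leaves the
    factor \<open>C / (C + 1) < 1\<close>, which restores the strict inequality lost in the
    estimates.\<close>
  then have e': "e / (2 * (C + 1)) > 0" using assms(3) by simp
  obtain d1 where d1: "d1 > 0" "\<And>D. D division_of \<Union>D \<Longrightarrow> \<Union>D \<subseteq> {a..b} \<Longrightarrow> (\<Sum>k\<in>D. measure lborel k) < d1
       \<Longrightarrow> (\<Sum>k\<in>D. norm (f (Sup k) - f (Inf k))) < e / (2 * (C + 1))"
    using AC_D[OF assms(1) e'] by blast
  obtain d2 where d2: "d2 > 0" "\<And>D. D division_of \<Union>D \<Longrightarrow> \<Union>D \<subseteq> {a..b} \<Longrightarrow> (\<Sum>k\<in>D. measure lborel k) < d2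
       \<Longrightarrow> (\<Sum>k\<in>D. norm (g (Sup k) - g (Inf k))) < e / (2 * (C + 1))"
    using AC_D[OF assms(2) e'] by blast
  have "(\<Sum>k\<in>D. norm (h (Sup k) - h (Inf k))) < e"
    if D: "D division_of \<Union>D" "\<Union>D \<subseteq> {a..b}" "(\<Sum>k\<in>D. measure lborel k) < min d1 d2" for D
  proof -
    have "(\<Sum>k\<in>D. norm (h (Sup k) - h (Inf k)))
       \<le> (\<Sum>k\<in>D. C * (norm (f (Sup k) - f (Inf k)) + norm (g (Sup k) - g (Inf k))))"
      by (intro sum_mono lip AC_division_bounds[OF D(1,2)])
    also have "\<dots> = C * ((\<Sum>k\<in>D. norm (f (Sup k) - f (Inf k))) + (\<Sum>k\<in>D. norm (g (Sup k) - g (Inf k))))"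
      by (simp add: sum_distrib_left[symmetric] sum.distrib)
    also have "\<dots> \<le> C * (e / (2 * (C + 1)) + e / (2 * (C + 1)))"
      using d1(2)[OF D(1,2)] d2(2)[OF D(1,2)] D(3) assms(3) by (intro mult_left_mono add_mono) auto
    also have "\<dots> = e * (C / (C + 1))"
    proof -
      have "e / (2 * (C + 1)) + e / (2 * (C + 1)) = e / (C + 1)"
        using assms(3) by (simp add: divide_simps)
      then show ?thesis by simp
    qed
    also have "\<dots> < e * 1" using \<open>e > 0\<close> assms(3) by (intro mult_strict_left_mono) auto
    finally show ?thesis by simp
  qed
  then show "\<exists>d>0. \<forall>D. D division_of \<Union> D \<and> \<Union> D \<subseteq> {a..b} \<and> (\<Sum>k\<in>D. measure lborel k) < d \<longrightarrow>
            (\<Sum>k\<in>D. norm (h (Sup k) - h (Inf k))) < e"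
    using d1(1) d2(1) by (intro exI[of _ "min d1 d2"]) auto
qed

lemma AC_bilinear:
  fixes f :: "real \<Rightarrow> 'a::real_normed_vector" and g :: "real \<Rightarrow> 'b::real_normed_vector"
  assumes "bounded_bilinear pr" "abs_continuous_on a b f" "abs_continuous_on a b g"
  shows "abs_continuous_on a b (\<lambda>t. pr (f t) (g t))"
proof -
  interpret bounded_bilinear pr by fact
  obtain K where K: "K > 0" "\<And>x y. norm (pr x y) \<le> norm x * norm y * K" using pos_bounded by blast
  have "bounded (f ` {a..b})" "bounded (g ` {a..b})"
    using AC_continuous[OF assms(2)] AC_continuous[OF assms(3)]
    by (auto intro!: compact_imp_bounded compact_continuous_image)
  then obtain B1 B2 where B: "\<And>t. t \<in> {a..b} \<Longrightarrow> norm (f t) \<le> B1" "\<And>t. t \<in> {a..b} \<Longrightarrow> norm (g t) \<le> B2"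
    unfolding bounded_iff by blast
  define B where "B = \<bar>B1\<bar> + \<bar>B2\<bar>"
  have B': "norm (f t) \<le> B" "norm (g t) \<le> B" if "t \<in> {a..b}" for t
    using B[OF that] by (auto simp: B_def)
  show ?thesis
  proof (rule AC_compose_lipschitz2[OF assms(2,3), of "B * K"])
    show "0 \<le> B * K" using K by (simp add: B_def)
    fix s t assume st: "s \<in> {a..b}" "t \<in> {a..b}"
    have "norm (pr (f t) (g t) - pr (f s) (g s)) = norm (pr (f t - f s) (g t) + pr (f s) (g t - g s))"
      by (simp add: diff_left diff_right)
    also have "\<dots> \<le> norm (f t - f s) * norm (g t) * K + norm (f s) * norm (g t - g s) * K"
      by (intro norm_triangle_mono K)
    also have "\<dots> \<le> norm (f t - f s) * B * K + B * norm (g t - g s) * K"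
      using K B'[OF st(1)] B'[OF st(2)] by (intro add_mono mult_right_mono mult_left_mono) auto
    finally show "norm (pr (f t) (g t) - pr (f s) (g s)) \<le> B * K * (norm (f t - f s) + norm (g t - g s))"
      by (simp add: algebra_simps)
  qed
qed

lemma AC_add:
  assumes "abs_continuous_on a b f" "abs_continuous_on a b g"
  shows "abs_continuous_on a b (\<lambda>t. f t + g t)"
  by (rule AC_compose_lipschitz2[OF assms, of 1])
     (auto simp: add_diff_add intro: norm_triangle_ineq)

lemma AC_linear:
  assumes "bounded_linear h" "abs_continuous_on a b f"
  shows "abs_continuous_on a b (\<lambda>t. h (f t))"
proof -
  interpret bounded_linear h by fact
  obtain K where K: "K \<ge> 0" "\<And>x. norm (h x) \<le> norm x * K" using nonneg_bounded by blast
  show ?thesis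
  proof (rule AC_compose_lipschitz2[OF assms(2,2) K(1)])
    fix s t
    have "norm (h (f t) - h (f s)) \<le> norm (f t - f s) * K" using K(2)[of "f t - f s"] by (simp add: diff)
    also have "\<dots> \<le> K * (norm (f t - f s) + norm (f t - f s))" using K(1) by (simp add: algebra_simps)
    finally show "norm (h (f t) - h (f s)) \<le> K * (norm (f t - f s) + norm (f t - f s))" .
  qed
qed

lemma AC_const: "abs_continuous_on a b (\<lambda>t. c)"
  unfolding abs_continuous_on_def by (intro allI impI exI[of _ 1]) simp

lemma AC_diff:
  assumes "abs_continuous_on a b f" "abs_continuous_on a b g"
  shows "abs_continuous_on a b (\<lambda>t. f t - g t)"
  using AC_add[OF assms(1) AC_linear[OF bounded_linear_minus[OF bounded_linear_ident] assms(2)]] by simp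

lemma AC_subinterval:
  assumes "abs_continuous_on a b f" "a \<le> a'" "b' \<le> b"
  shows "abs_continuous_on a' b' f"
proof -
  have "{a'..b'} \<subseteq> {a..b}" using assms by auto
  then have "\<And>X. X \<subseteq> {a'..b'} \<Longrightarrow> X \<subseteq> {a..b}" by blast
  then show ?thesis using assms(1) unfolding abs_continuous_on_def
    by (elim all_forward imp_forward ex_forward conj_forward) auto
qed

section \<open>The fundamental theorem of calculus for absolutely continuous functions, in both
  directions\<close>

lemma AE_lebesgue_on_negligible:
  assumes "S \<in> sets lebesgue"
  shows "(AE t in lebesgue_on S. P t) \<longleftrightarrow> negligible {t\<in>S. \<not> P t}"
proof -
  have "(AE t in lebesgue_on S. P t) \<longleftrightarrow> (AE t in lebesgue. t \<in> S \<longrightarrow> P t)"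
    by (rule AE_restrict_space_iff) (use assms in auto)
  also have "\<dots> \<longleftrightarrow> {t\<in>S. \<not> P t} \<in> null_sets lebesgue"
  proof
    assume "AE t in lebesgue. t \<in> S \<longrightarrow> P t"
    then obtain N where "N \<in> null_sets lebesgue" "{t\<in>S. \<not> P t} \<subseteq> N"
      by (auto simp: eventually_ae_filter)
    then show "{t\<in>S. \<not> P t} \<in> null_sets lebesgue" by (meson negligible_iff_null_sets negligible_subset)
  next
    assume "{t\<in>S. \<not> P t} \<in> null_sets lebesgue"
    then show "AE t in lebesgue. t \<in> S \<longrightarrow> P t"
      by (rule AE_I') auto
  qed
  finally show ?thesis by (simp add: negligible_iff_null_sets)
qed

text \<open>The gauge integral gives this directly. At tags where the derivative exists the straddle
  estimate applies. At tags in the null set \<open>N\<close> the integrand is changed to 0 and the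
  gauge confines the intervals to an open set of measure below \<open>d\<close>, so absolute
  continuity makes the increments of \<open>f\<close> small. Integrability of \<open>q\<close> comes
  out as part of the conclusion.\<close>

lemma ftc_AC:
  fixes f :: "real \<Rightarrow> 'a::banach"
  assumes AC: "abs_continuous_on a b f" and ab: "a \<le> b"
    and der: "AE t in lebesgue_on {a<..<b}. (f has_vector_derivative q t) (at t)"
  shows "(q has_integral (f b - f a)) {a..b}"
proof -
  \<comment> \<open>The endpoints join the null set because differentiability is given on the open
    interval only.\<close>
  define N where "N = {t\<in>{a<..<b}. \<not> (f has_vector_derivative q t) (at t)} \<union> {a,b}"
  have "negligible {t\<in>{a<..<b}. \<not> (f has_vector_derivative q t) (at t)}"
    using der by (subst (asm) AE_lebesgue_on_negligible) auto
  then have N: "negligible N" unfolding N_def by simp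
  define q' where "q' = (\<lambda>t. if t \<in> N then 0 else q t)"
  have derN: "(f has_vector_derivative q' t) (at t)" if "t \<in> {a..b}" "t \<notin> N" for t
    using that by (auto simp: N_def q'_def)
  have "(q' has_integral (f b - f a)) (cbox a b)"
    unfolding has_integral
  proof (intro allI impI)
    fix e :: real assume "e > 0"
    then have "e/2 > 0" by simp
    obtain d where d: "d > 0" "\<And>D. D division_of \<Union>D \<Longrightarrow> \<Union>D \<subseteq> {a..b} \<Longrightarrow> (\<Sum>k\<in>D. measure lborel k) < d
       \<Longrightarrow> (\<Sum>k\<in>D. norm (f (Sup k) - f (Inf k))) < e/2"
      using AC_D[OF AC \<open>e/2 > 0\<close>] by blast
    obtain T where T: "open T" "N \<subseteq> T" "T - N \<in> lmeasurable" "emeasure lebesgue (T - N) < ennreal d"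
      using sets_lebesgue_outer_open[OF _ d(1), of N] N negligible_imp_sets by blast
    have Nm: "N \<in> lmeasurable" "measure lebesgue N = 0" using N negligible_imp_measurable negligible_imp_measure0 by auto
    have Tl: "T \<in> lmeasurable" "measure lebesgue T < d"
    proof -
      have TT: "T = (T - N) \<union> N" using T by blast
      show "T \<in> lmeasurable" by (subst TT) (intro fmeasurable.Un T Nm)
      have "measure lebesgue T \<le> measure lebesgue (T - N) + measure lebesgue N"
        by (subst TT) (intro measure_Un_le fmeasurableD T Nm)
      moreover have "measure lebesgue (T - N) < d"
        using T(3,4) d(1) by (simp add: emeasure_eq_measure2 ennreal_less_iff)
      ultimately show "measure lebesgue T < d" using Nm by simp
    qed
    \<comment> \<open>Summed over a division this contributes at most \<open>e / 4\<close>, which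
      leaves strict room beside the \<open>e / 2\<close> from the null set; the \<open>+ 1\<close>
      admits \<open>a = b\<close>.\<close>
    define e' where "e' = e / (4 * (b - a + 1))"
    have e': "e' > 0" using \<open>e > 0\<close> ab by (simp add: e'_def)
    have "\<exists>r>0. \<forall>y. \<bar>y - x\<bar> < r \<longrightarrow> norm (f y - f x - (y - x) *\<^sub>R q' x) \<le> e' * \<bar>y - x\<bar>"
      if "x \<in> {a..b}" "x \<notin> N" for x
      using derN[OF that] e' unfolding has_vector_derivative_def has_derivative_at_alt
      by (auto simp: real_norm_def)
    then obtain r where r: "\<And>x. x \<in> {a..b} \<Longrightarrow> x \<notin> N \<Longrightarrow> r x > 0"
      "\<And>x y. x \<in> {a..b} \<Longrightarrow> x \<notin> N \<Longrightarrow> \<bar>y - x\<bar> < r x \<Longrightarrow> norm (f y - f x - (y - x) *\<^sub>R q' x) \<le> e' * \<bar>y - x\<bar>"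
      by metis
    define \<gamma> where "\<gamma> = (\<lambda>x. if x \<in> N then T else if x \<in> {a..b} then ball x (r x) else UNIV)"
    have "gauge \<gamma>" unfolding gauge_def \<gamma>_def using T r(1) by auto
    moreover have "norm ((\<Sum>(x, k)\<in>D. measure lborel k *\<^sub>R q' x) - (f b - f a)) < e"
      if D: "D tagged_division_of cbox a b" "\<gamma> fine D" for D
    proof -
      note D' = tagged_division_ofD[OF D(1)]
      have bnds: "x \<in> {a..b} \<and> Inf k \<in> k \<and> Sup k \<in> k \<and> Inf k \<le> x \<and> x \<le> Sup k \<and> measure lborel k = Sup k - Inf k"
        if xk: "(x,k) \<in> D" for x k
      proof -
        obtain u v where k: "k = cbox u v" using D'(4)[OF xk] by blast
        have "x \<in> k" "k \<subseteq> cbox a b" using D'(2,3)[OF xk] by auto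
        then have "a \<le> x" "x \<le> b" "u \<le> x" "x \<le> v" unfolding k by auto
        then show ?thesis unfolding k by simp
      qed
      define E where "E = (\<lambda>(x,k). measure lborel k *\<^sub>R q' x - (f (Sup k) - f (Inf k)))"
      define D1 where "D1 = {(x,k)\<in>D. x \<in> N}"
      define D2 where "D2 = {(x,k)\<in>D. x \<notin> N}"
      have fin: "finite D" "finite D1" "finite D2" using D'(1)
        by (auto simp: D1_def D2_def intro: finite_subset[OF _ D'(1)])
      have "(\<Sum>(x, k)\<in>D. measure lborel k *\<^sub>R q' x) - (f b - f a) = (\<Sum>x\<in>D. E x)"
        using additive_tagged_division_1[OF ab, of D f] D(1)
        by (simp add: E_def case_prod_beta sum_subtractf)
      also have "\<dots> = (\<Sum>x\<in>D1. E x) + (\<Sum>x\<in>D2. E x)"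
        by (subst sum.union_disjoint[symmetric]) (use fin in \<open>auto simp: D1_def D2_def intro!: sum.cong\<close>)
      finally have eq: "(\<Sum>(x, k)\<in>D. measure lborel k *\<^sub>R q' x) - (f b - f a) = (\<Sum>x\<in>D1. E x) + (\<Sum>x\<in>D2. E x)" .
      have "norm (\<Sum>x\<in>D1. E x) < e/2"
      proof -
        have D1t: "D1 tagged_partial_division_of cbox a b"
        proof (rule tagged_partial_division_subset)
          show "D tagged_partial_division_of cbox a b" using D(1) unfolding tagged_division_of_def by blast
          show "D1 \<subseteq> D" by (auto simp: D1_def)
        qed
        note U = tagged_partial_division_of_Union_self[OF D1t]
        have div: "(snd ` D1) division_of \<Union>(snd ` D1)" by (rule division_of_tagged_division[OF U])
        have sub: "\<Union>(snd ` D1) \<subseteq> {a..b}" 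
        proof safe
          fix y x k assume "y \<in> snd (x,k)" "(x,k) \<in> D1"
          then show "y \<in> {a..b}" using D'(3)[of x k] unfolding D1_def box_real by auto
        qed
        have subT: "\<Union>(snd ` D1) \<subseteq> T" 
        proof safe
          fix y x k assume y: "y \<in> snd (x,k)" "(x,k) \<in> D1"
          then have "(x,k) \<in> D" "x \<in> N" unfolding D1_def by auto
          then have "k \<subseteq> T" using fineD[OF D(2), of x k] by (simp add: \<gamma>_def)
          then show "y \<in> T" using y by auto
        qed
        have "(\<Sum>k\<in>snd ` D1. measure lborel k) = measure lebesgue (\<Union>(snd ` D1))"
        proof (intro trans[OF sum.cong[OF refl] content_division[OF div]])
          fix k assume "k \<in> snd ` D1"
          then obtain u v where "k = cbox u v" using division_ofD(4)[OF div] by blast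
          then show "measure lborel k = measure lebesgue k" by simp
        qed
        also have "\<dots> \<le> measure lebesgue T"
          by (intro measure_mono_fmeasurable subT Tl fmeasurableD[OF lmeasurable_division[OF div]])
        also have "\<dots> < d" by (rule Tl)
        finally have small: "(\<Sum>k\<in>snd ` D1. norm (f (Sup k) - f (Inf k))) < e/2" by (intro d(2) div sub)
        have ne: "k \<noteq> {}" if "(x,k) \<in> D1" for x k
          using D'(2)[of x k] that unfolding D1_def by blast
        have "norm (\<Sum>x\<in>D1. E x) \<le> (\<Sum>(x,k)\<in>D1. norm (f (Sup k) - f (Inf k)))"
          by (rule sum_norm_le) (auto simp: D1_def E_def q'_def norm_minus_commute)
        \<comment> \<open>Passing from tagged pairs to intervals requires a summand that vanishes on
          every degenerate box, including the empty one, where \<open>Sup\<close> and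
          \<open>Inf\<close> have no useful value.\<close>
        also have "\<dots> = (\<Sum>(x,k)\<in>D1. if k = {} then 0 else norm (f (Sup k) - f (Inf k)))"
          using ne by (intro sum.cong) auto
        also have "\<dots> = (\<Sum>k\<in>snd ` D1. if k = {} then 0 else norm (f (Sup k) - f (Inf k)))"
        proof (rule sum.over_tagged_division_lemma[OF U])
          fix u v :: real assume "box u v = {}"
          then have "v \<le> u" by (simp add: not_less)
          then show "(if cbox u v = {} then 0 else norm (f (Sup (cbox u v)) - f (Inf (cbox u v)))) = 0"
            by (cases "u = v") auto
        qed
        also have "\<dots> = (\<Sum>k\<in>snd ` D1. norm (f (Sup k) - f (Inf k)))"
          using ne by (intro sum.cong) auto
        finally show ?thesis using small by simp
      qed
      moreover have "norm (\<Sum>x\<in>D2. E x) \<le> e/4"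
      proof -
        have "norm (\<Sum>x\<in>D2. E x) \<le> (\<Sum>(x,k)\<in>D2. e' * measure lborel k)"
        proof (rule sum_norm_le, clarify)
          fix x k assume xk: "(x,k) \<in> D2"
          then have xk': "(x,k) \<in> D" "x \<notin> N" by (auto simp: D2_def)
          note b = bnds[OF xk'(1)]
          have c: "measure lborel k = Sup k - Inf k" using b by blast
          have kb: "k \<subseteq> ball x (r x)" using fineD[OF D(2) xk'(1)] xk'(2) b by (simp add: \<gamma>_def)
          moreover have "Inf k \<in> k" "Sup k \<in> k" using b by auto
          ultimately have "\<bar>Inf k - x\<bar> < r x" "\<bar>Sup k - x\<bar> < r x" by (auto simp: dist_real_def)
          then have *: "norm (f (Sup k) - f x - (Sup k - x) *\<^sub>R q' x) \<le> e' * (Sup k - x)"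
              "norm (f (Inf k) - f x - (Inf k - x) *\<^sub>R q' x) \<le> e' * (x - Inf k)"
            using r(2)[OF _ xk'(2), of "Sup k"] r(2)[OF _ xk'(2), of "Inf k"] b by auto
          have "E (x,k) = (f (Inf k) - f x - (Inf k - x) *\<^sub>R q' x) - (f (Sup k) - f x - (Sup k - x) *\<^sub>R q' x)"
            by (simp only: E_def split_conv c) (simp add: algebra_simps)
          also have "norm \<dots> \<le> e' * (x - Inf k) + e' * (Sup k - x)"
            by (rule order_trans[OF norm_triangle_ineq4 add_mono[OF *(2,1)]])
          also have "\<dots> = e' * measure lborel k"
            by (simp only: c) (simp add: algebra_simps)
          finally show "norm (E (x,k)) \<le> e' * measure lborel k" .
        qed
        also have "\<dots> \<le> (\<Sum>(x,k)\<in>D. e' * measure lborel k)"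
        proof (rule sum_mono2)
          show "D2 \<subseteq> D" unfolding D2_def by blast
          show "0 \<le> (case x of (x,k) \<Rightarrow> e' * measure lborel k)" for x using e' by (cases x) simp
        qed (rule fin)
        also have "\<dots> = e' * (b - a)"
          using additive_content_tagged_division[OF D(1)] ab by (simp add: sum_distrib_left[symmetric] case_prod_beta)
        also have "\<dots> \<le> e/4" using \<open>e > 0\<close> ab by (simp add: e'_def field_simps)
        finally show ?thesis .
      qed
      ultimately show ?thesis unfolding eq using norm_triangle_ineq[of "\<Sum>x\<in>D1. E x" "\<Sum>x\<in>D2. E x"] \<open>e > 0\<close> by linarith
    qed
    ultimately show "\<exists>\<gamma>. gauge \<gamma> \<and> (\<forall>D. D tagged_division_of cbox a b \<and> \<gamma> fine D \<longrightarrow>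
        norm ((\<Sum>(x, k)\<in>D. measure lborel k *\<^sub>R q' x) - (f b - f a)) < e)"
      by (intro exI[of _ \<gamma>] conjI) auto
  qed
  then have "(q' has_integral (f b - f a)) {a..b}" by simp
  then show ?thesis
    by (rule has_integral_spike[OF N, rotated]) (simp add: q'_def)
qed

text \<open>Truncation at height n leaves the remainder p - min p n, which tends to 0 in mean by
  dominated convergence. The bound \<open>p t \<le> r t + c\<close> then says that the integral of
  \<open>p\<close> over a set of measure m is below \<open>e + c * m\<close>.\<close>

lemma integrable_small_on_small_sets:
  fixes p :: "real \<Rightarrow> real"
  assumes p: "integrable lebesgue p" "\<And>t. p t \<ge> 0" and e: "e > 0"
  obtains r c where "integrable lebesgue r" "\<And>t. r t \<ge> 0" "integral\<^sup>L lebesgue r < e" "c > 0" "\<And>t. p t \<le> r t + c"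
proof -
  have [measurable]: "p \<in> borel_measurable lebesgue" using p by simp
  define r where "r = (\<lambda>n::nat. \<lambda>t. p t - min (p t) (real n))"
  have int: "integrable lebesgue (r n)" for n
    by (rule Bochner_Integration.integrable_bound[OF p(1)]) (use p(2) in \<open>auto simp: r_def\<close>)
  have "(\<lambda>n. integral\<^sup>L lebesgue (r n)) \<longlonglongrightarrow> integral\<^sup>L lebesgue (\<lambda>t::real. 0::real)"
  proof (rule Bochner_Integration.integral_dominated_convergence[where M=lebesgue and s=r and f="\<lambda>t. 0" and w=p])
    show "AE t in lebesgue. (\<lambda>n. r n t) \<longlonglongrightarrow> 0"
    proof (rule AE_I2)
      fix t
      obtain N :: nat where "p t \<le> real N" using real_arch_simple by blast
      then have "\<forall>\<^sub>F n in sequentially. r n t = 0"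
        by (intro eventually_sequentiallyI[of N]) (simp add: r_def min_absorb1 order_trans[of "p t" "real N"])
      then show "(\<lambda>n. r n t) \<longlonglongrightarrow> 0" by (rule tendsto_eventually)
    qed
    show "AE t in lebesgue. norm (r n t) \<le> p t" for n using p(2) by (auto simp: r_def)
  qed (use p in \<open>auto simp: r_def\<close>)
  then have "\<forall>\<^sub>F n in sequentially. integral\<^sup>L lebesgue (r n) < e"
    using e by (auto dest: order_tendstoD)
  then obtain n where "integral\<^sup>L lebesgue (r n) < e" by (auto simp: eventually_sequentially)
  then show thesis
    \<comment> \<open>The height is raised by one so that \<open>c\<close> is positive even for
      \<open>n = 0\<close>.\<close>
    using int[of n] by (intro that[of "r n" "real n + 1"]) (auto simp: r_def min_def)
qed

text \<open>A division of small total length picks up at most the integral of the remainder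
  \<open>r\<close> plus \<open>c\<close> times that length; with length below
  \<open>e / (2*c)\<close> neither share exceeds \<open>e / 2\<close>.\<close>

lemma AC_indefinite_integral:
  fixes q :: "real \<Rightarrow> 'a::euclidean_space"
  assumes q: "integrable (lebesgue_on {a<..<b}) q"
  shows "abs_continuous_on a b (\<lambda>t. integral {a..t} q)"
  unfolding abs_continuous_on_def
proof (intro allI impI)
  fix e :: real assume "e > 0"
  define q0 where "q0 = (\<lambda>t. indicator {a<..<b} t *\<^sub>R q t)"
  have q0: "integrable lebesgue q0"
    using q unfolding q0_def by (subst (asm) integrable_restrict_space) auto
  have q0_on: "q0 integrable_on {u..v}" for u v
    using integrable_on_lebesgue[OF q0] integrable_on_subcbox[of q0 UNIV u v] by simp
  have eq: "integral {a..t} q = integral {a..t} q0" if "t \<le> b" for t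
    by (rule integral_spike[of "{a,b}"]) (use that in \<open>auto simp: q0_def\<close>)
  have "e/2 > 0" using \<open>e > 0\<close> by simp
  obtain r c where r: "integrable lebesgue r" "\<And>t. r t \<ge> 0" "integral\<^sup>L lebesgue r < e/2"
    and c: "c > 0" "\<And>t. norm (q0 t) \<le> r t + c"
    using integrable_small_on_small_sets[OF integrable_norm[OF q0] _ \<open>e/2 > 0\<close>] by auto
  have r_abs: "r absolutely_integrable_on S" if "S \<in> sets lebesgue" for S
    unfolding set_integrable_def by (rule integrable_mult_indicator[OF that r(1)])
  have "(\<Sum>k\<in>D. norm (integral {a..Sup k} q - integral {a..Inf k} q)) < e"
    if D: "D division_of \<Union>D" "\<Union>D \<subseteq> {a..b}" "(\<Sum>k\<in>D. measure lborel k) < e / (2*c)" for D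
  proof -
    have step: "norm (integral {a..Sup k} q - integral {a..Inf k} q) \<le> integral k r + c * measure lborel k"
      if k: "k \<in> D" for k
    proof -
      note b = AC_division_bounds[OF D(1,2) k]
      define u v where "u = Inf k" and "v = Sup k"
      have k_eq: "k = {u..v}" using b(4) by (simp add: u_def v_def)
      have uv: "a \<le> u" "u \<le> v" "v \<le> b" using b by (auto simp: u_def v_def)
      have "integral {a..v} q - integral {a..u} q = integral {a..v} q0 - integral {a..u} q0"
        using eq[of u] eq[of v] uv by simp
      also have "\<dots> = integral {u..v} q0"
        using Henstock_Kurzweil_Integration.integral_combine[OF uv(1,2) q0_on] by (simp add: algebra_simps)
      also have "norm \<dots> \<le> integral {u..v} (\<lambda>t. r t + c)"
      proof (rule integral_norm_bound_integral[OF q0_on])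
        show "(\<lambda>t. r t + c) integrable_on {u..v}"
          using r_abs[of "{u..v}"] by (intro integrable_add) (auto simp: absolutely_integrable_on_def)
      qed (rule c(2))
      also have "\<dots> = integral {u..v} r + c * (v - u)"
        using r_abs[of "{u..v}"] uv
        by (subst Henstock_Kurzweil_Integration.integral_add) (auto simp: absolutely_integrable_on_def)
      finally show ?thesis using uv unfolding u_def[symmetric] v_def[symmetric] k_eq by simp
    qed
    have sets: "\<Union>D \<in> sets lebesgue" using lmeasurable_division[OF D(1)] by (rule fmeasurableD)
    have "(\<Sum>k\<in>D. norm (integral {a..Sup k} q - integral {a..Inf k} q))
        \<le> (\<Sum>k\<in>D. integral k r + c * measure lborel k)"
      by (rule sum_mono) (rule step)
    also have "\<dots> = (\<Sum>k\<in>D. integral k r) + c * (\<Sum>k\<in>D. measure lborel k)"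
      by (simp add: sum.distrib sum_distrib_left)
    also have "(\<Sum>k\<in>D. integral k r) = integral (\<Union>D) r"
      using r_abs[OF sets] by (subst integral_combine_division_topdown[OF _ D(1)])
        (auto simp: absolutely_integrable_on_def)
    also have "integral (\<Union>D) r \<le> integral UNIV r"
      using r_abs[OF sets] integrable_on_lebesgue[OF r(1)] r(2)
      by (intro integral_subset_le) (auto simp: absolutely_integrable_on_def)
    also have "integral UNIV r = integral\<^sup>L lebesgue r" by (rule integral_lebesgue[OF r(1)])
    also have "c * (\<Sum>k\<in>D. measure lborel k) \<le> c * (e / (2*c))"
      using D(3) c(1) by (intro mult_left_mono) auto
    also have "c * (e / (2*c)) = e/2" using c(1) by simp
    finally show ?thesis using r(3) by linarith
  qed
  then show "\<exists>d>0. \<forall>D. D division_of \<Union> D \<and> \<Union> D \<subseteq> {a..b} \<and> (\<Sum>k\<in>D. measure lborel k) < d \<longrightarrow>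
            (\<Sum>k\<in>D. norm (integral {a..Sup k} q - integral {a..Inf k} q)) < e"
    using \<open>e > 0\<close> c(1) by (intro exI[of _ "e / (2*c)"]) auto
qed

text \<open>\<open>integrable_ccontinuous_explicit\<close> averages over intervals to the right of a
  point only. Applying it to the reflected function as well gives the averages to the left, and the
  two together give a two-sided derivative.\<close>

lemma has_vector_derivative_indefinite_integral_AE:
  fixes q :: "real \<Rightarrow> 'a::euclidean_space"
  assumes q: "q integrable_on {a..b}"
  shows "AE t in lebesgue_on {a<..<b}. ((\<lambda>s. integral {a..s} q) has_vector_derivative q t) (at t)"
proof -
  define f where "f = (\<lambda>t. if t \<in> {a..b} then q t else 0)"
  have fU: "f integrable_on UNIV" using q unfolding f_def by (subst integrable_restrict_UNIV)
  have f_on: "f integrable_on cbox c d" for c d by (rule integrable_on_subcbox[OF fU]) simp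
  have "(\<lambda>x. f (-x)) integrable_on cbox c d" for c d
    using Henstock_Kurzweil_Integration.integrable_reflect[of f "-c" "-d"] f_on[of "-d" "-c"] unfolding minus_minus by blast
  then obtain N2 where N2: "negligible N2"
    "\<And>x e. x \<notin> N2 \<Longrightarrow> 0 < e \<Longrightarrow> \<exists>d>0. \<forall>h. 0 < h \<and> h < d \<longrightarrow>
        norm (integral (cbox x (x + h *\<^sub>R One)) (\<lambda>x. f (-x)) /\<^sub>R h ^ DIM(real) - f (-x)) < e"
    using integrable_ccontinuous_explicit[of "\<lambda>x. f (-x)"] by metis
  obtain N1 where N1: "negligible N1"
    "\<And>x e. x \<notin> N1 \<Longrightarrow> 0 < e \<Longrightarrow> \<exists>d>0. \<forall>h. 0 < h \<and> h < d \<longrightarrow>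
        norm (integral (cbox x (x + h *\<^sub>R One)) f /\<^sub>R h ^ DIM(real) - f x) < e"
    using integrable_ccontinuous_explicit[of f] f_on by metis
  define N where "N = N1 \<union> uminus ` N2"
  have "negligible N" unfolding N_def
    using N1(1) N2(1) by (intro negligible_Un negligible_differentiable_image_negligible) (auto intro!: derivative_intros)
  moreover have "((\<lambda>s. integral {a..s} q) has_vector_derivative q t) (at t)"
    if t: "t \<in> {a<..<b}" "t \<notin> N" for t
  proof -
    have tN: "t \<notin> N1" "- t \<notin> N2" using t(2) unfolding N_def by (auto simp: image_iff dest: bspec[of _ _ "-t"])
    have "\<exists>d>0. \<forall>y. \<bar>y - t\<bar> < d \<longrightarrow>
       norm (integral {a..y} q - integral {a..t} q - (y - t) *\<^sub>R q t) \<le> e * \<bar>y - t\<bar>" if "e > 0" for e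
    proof -
      obtain d1 where d1: "d1 > 0" "\<And>h. 0 < h \<Longrightarrow> h < d1 \<Longrightarrow> norm (integral {t..t+h} f /\<^sub>R h - f t) < e"
        using N1(2)[OF tN(1) \<open>e > 0\<close>] by auto
      obtain d2 where d2: "d2 > 0" "\<And>h. 0 < h \<Longrightarrow> h < d2 \<Longrightarrow>
          norm (integral {-t..-t+h} (\<lambda>x. f (-x)) /\<^sub>R h - f t) < e"
        using N2(2)[OF tN(2) \<open>e > 0\<close>] by auto
      define d where "d = min (min d1 d2) (min (b - t) (t - a))"
      have "d > 0" using d1 d2 t(1) by (simp add: d_def)
      have ft: "f t = q t" using t(1) by (simp add: f_def)
      have qf: "integral {u..v} f = integral {u..v} q" if "a \<le> u" "v \<le> b" for u v
        by (rule integral_cong) (use that in \<open>auto simp: f_def\<close>)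
      have q_on: "q integrable_on {u..v}" if "a \<le> u" "v \<le> b" for u v
        by (rule integrable_on_subinterval[OF q]) (use that in auto)
      have "norm (integral {a..y} q - integral {a..t} q - (y - t) *\<^sub>R q t) \<le> e * \<bar>y - t\<bar>" if y: "\<bar>y - t\<bar> < d" for y
      proof (cases y t rule: linorder_cases)
        case equal then show ?thesis by simp
      next
        case greater
        define h where "h = y - t"
        have h: "0 < h" "h < d1" "y \<le> b" using greater y by (auto simp: h_def d_def)
        have "integral {a..y} q - integral {a..t} q = integral {t..y} q"
          using Henstock_Kurzweil_Integration.integral_combine[of a t y q] q_on[of a y] t(1) h greater
          by (simp add: algebra_simps)
        also have "\<dots> = integral {t..t+h} f" using qf[of t y] t(1) h by (simp add: h_def)
        finally have "integral {a..y} q - integral {a..t} q - (y - t) *\<^sub>R q t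
            = h *\<^sub>R (integral {t..t+h} f /\<^sub>R h - f t)"
          using h by (simp add: ft h_def[symmetric] scaleR_right_diff_distrib)
        then show ?thesis using d1(2)[OF h(1,2)] h greater
          by (simp add: h_def[symmetric] mult.commute[of e])
      next
        case less
        define h where "h = t - y"
        have h: "0 < h" "h < d2" "a \<le> y" using less y by (auto simp: h_def d_def)
        have "integral {a..t} q - integral {a..y} q = integral {y..t} q"
          using Henstock_Kurzweil_Integration.integral_combine[of a y t q] q_on[of a t] t(1) h less
          by (simp add: algebra_simps)
        also have "\<dots> = integral {y..t} f" using qf[of y t] t(1) h by simp
        also have "\<dots> = integral {-t..-t+h} (\<lambda>x. f (-x))"
          using Henstock_Kurzweil_Integration.integral_reflect_real[of t y f] by (simp add: h_def)
        finally have "integral {a..y} q - integral {a..t} q - (y - t) *\<^sub>R q t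
            = - (h *\<^sub>R (integral {-t..-t+h} (\<lambda>x. f (-x)) /\<^sub>R h - f t))"
        proof -
          assume A: "integral {a..t} q - integral {a..y} q = integral {-t..-t+h} (\<lambda>x. f (-x))"
          have "integral {a..y} q - integral {a..t} q - (y - t) *\<^sub>R q t
             = - (integral {a..t} q - integral {a..y} q) + h *\<^sub>R q t"
            by (simp add: h_def algebra_simps)
          then show ?thesis using h unfolding A by (simp add: ft scaleR_right_diff_distrib)
        qed
        then have "norm (integral {a..y} q - integral {a..t} q - (y - t) *\<^sub>R q t)
            = h * norm (integral {-t..-t+h} (\<lambda>x. f (-x)) /\<^sub>R h - f t)"
          using h by simp
        also have "\<dots> \<le> h * e" using d2(2)[OF h(1,2)] h by (intro mult_left_mono) auto
        also have "\<dots> = e * \<bar>y - t\<bar>" using less by (simp add: h_def)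
        finally show ?thesis .
      qed
      then show ?thesis using \<open>d > 0\<close> by blast
    qed
    then show ?thesis unfolding has_vector_derivative_def has_derivative_at_alt
      by (simp add: bounded_linear_scaleR_left)
  qed
  ultimately show ?thesis
    by (subst AE_lebesgue_on_negligible) (auto intro: negligible_subset)
qed

section \<open>Complex matrices and Hilbert spaces\<close>

lemma bilinear_bounded:
  fixes h :: "'a::euclidean_space \<Rightarrow> 'b::euclidean_space \<Rightarrow> 'c::real_normed_vector"
  assumes "\<And>x y z. h (x + y) z = h x z + h y z" "\<And>x y z. h x (y + z) = h x y + h x z"
    "\<And>r x y. h (r *\<^sub>R x) y = r *\<^sub>R h x y" "\<And>r x y. h x (r *\<^sub>R y) = r *\<^sub>R h x y"
  shows "bounded_bilinear h"
  using assms by (intro bilinear_conv_bounded_bilinear[THEN iffD1]) (auto simp: bilinear_def linear_iff)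

lemma cvec_ip_add1: "cvec_ip (x + y) z = cvec_ip x z + cvec_ip y z"
  by (simp add: cvec_ip_def algebra_simps sum.distrib)
lemma cvec_ip_add2: "cvec_ip x (y + z) = cvec_ip x y + cvec_ip x z"
  by (simp add: cvec_ip_def algebra_simps sum.distrib)
lemma cvec_ip_diff1: "cvec_ip (x - y) z = cvec_ip x z - cvec_ip y z"
  by (simp add: cvec_ip_def algebra_simps sum_subtractf)
lemma cvec_ip_diff2: "cvec_ip x (y - z) = cvec_ip x y - cvec_ip x z"
  by (simp add: cvec_ip_def algebra_simps sum_subtractf)
lemma cvec_ip_minus1: "cvec_ip (- x) z = - cvec_ip x z"
  by (simp add: cvec_ip_def sum_negf)
lemma cvec_ip_minus2: "cvec_ip x (- z) = - cvec_ip x z"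
  by (simp add: cvec_ip_def sum_negf)
lemma cvec_ip_scale1: "cvec_ip (a *s x) y = a * cvec_ip x y"
  by (simp add: cvec_ip_def sum_distrib_left mult.assoc)
lemma cvec_ip_scale2: "cvec_ip x (a *s y) = cnj a * cvec_ip x y"
  by (simp add: cvec_ip_def sum_distrib_left algebra_simps)
lemmas scaleR_complex = scaleR_conv_of_real[where 'a=complex]
lemma cmod2: "(complex_of_real (cmod a))\<^sup>2 = a * cnj a"
  using complex_norm_square[of a] by simp
lemma cvec_ip_scaleR1: "cvec_ip (r *\<^sub>R x) y = of_real r * cvec_ip x y"
  by (simp add: cvec_ip_def scaleR_complex sum_distrib_left mult.assoc)
lemma cvec_ip_scaleR2: "cvec_ip x (r *\<^sub>R y) = of_real r * cvec_ip x y"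
  by (simp add: cvec_ip_def scaleR_complex sum_distrib_left algebra_simps)
lemma cvec_ip_cnj: "cnj (cvec_ip x y) = cvec_ip y x"
  by (simp add: cvec_ip_def mult.commute)
lemma cvec_ip_zero [simp]: "cvec_ip 0 y = 0" "cvec_ip x 0 = 0"
  by (simp_all add: cvec_ip_def)

lemmas cvec_ip_simps = cvec_ip_add1 cvec_ip_add2 cvec_ip_diff1 cvec_ip_diff2 cvec_ip_minus1 cvec_ip_minus2
  cvec_ip_scale1 cvec_ip_scale2 cvec_ip_scaleR1 cvec_ip_scaleR2

lemma Re_cvec_ip: "Re (cvec_ip x y) = inner x y"
  by (simp add: cvec_ip_def inner_vec_def inner_complex_def)

lemma cvec_ip_self: "cvec_ip x x = of_real ((norm x)\<^sup>2)"
proof -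
  have "cnj (cvec_ip x x) = cvec_ip x x" by (rule cvec_ip_cnj)
  then have "Im (cvec_ip x x) = 0" by (simp add: complex_eq_iff)
  then show ?thesis by (simp add: complex_eq_iff Re_cvec_ip power2_norm_eq_inner)
qed

lemma cvec_ip_eqI:
  assumes "\<And>y. cvec_ip x y = cvec_ip x' y"
  shows "x = x'"
proof -
  have "cvec_ip (x - x') (x - x') = 0" using assms by (simp add: cvec_ip_diff1)
  then show ?thesis by (simp add: cvec_ip_self)
qed

lemma cvec_ip_eqI2:
  assumes "\<And>y. cvec_ip y x = cvec_ip y x'"
  shows "x = x'"
  by (rule cvec_ip_eqI) (metis assms cvec_ip_cnj)

lemma cvec_ip_axis: "cvec_ip x (axis i 1) = x $ i"
  by (simp add: cvec_ip_def axis_def if_distrib cong: if_cong)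

lemma bounded_bilinear_cvec_ip: "bounded_bilinear (cvec_ip :: complex^'n \<Rightarrow> _)"
  by (rule bilinear_bounded) (simp_all add: cvec_ip_simps scaleR_complex)

lemma cmod_cvec_ip: "cmod (cvec_ip x y) \<le> norm x * norm y"
proof -
  \<comment> \<open>The unimodular factor \<open>c\<close> turns the complex product into a
    nonnegative real number, so the real Cauchy-Schwarz inequality for \<open>inner\<close>
    applies.\<close>
  obtain c where c: "cmod c = 1" "c * cvec_ip x y = of_real (cmod (cvec_ip x y))"
  proof (cases "cvec_ip x y = 0")
    case True then show ?thesis by (intro that[of 1]) auto
  next
    case False
    then show ?thesis
      by (intro that[of "cnj (cvec_ip x y) / of_real (cmod (cvec_ip x y))"])
         (simp_all add: norm_divide mult.commute[of "cnj _"] complex_norm_square[symmetric] power2_eq_square)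
  qed
  have "cmod (cvec_ip x y) = Re (cvec_ip (c *s x) y)" using c(2) by (simp add: cvec_ip_scale1)
  also have "\<dots> \<le> norm (c *s x) * norm y" unfolding Re_cvec_ip by (rule norm_cauchy_schwarz)
  also have "norm (c *s x) = norm x"
  proof -
    have "complex_of_real ((norm (c *s x))\<^sup>2) = of_real ((norm x)\<^sup>2)"
      unfolding cvec_ip_self[symmetric] cvec_ip_scale1 cvec_ip_scale2
      using c(1) cmod2[of c] by (simp add: mult.commute[of "cnj c"] flip: mult.assoc)
    then have "(norm (c *s x))\<^sup>2 = (norm x)\<^sup>2" using of_real_eq_iff by blast
    then show ?thesis by simp
  qed
  finally show ?thesis .
qed

lemma matrix_vector_scaleR: "(A :: complex^'n^'m) *v (r *\<^sub>R x) = r *\<^sub>R (A *v x)"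
  by (simp add: vec_eq_iff matrix_vector_mult_def scaleR_complex sum_distrib_left mult.left_commute)
lemma scaleR_matrix_vector: "(r *\<^sub>R (A :: complex^'n^'m)) *v x = r *\<^sub>R (A *v x)"
  by (simp add: vec_eq_iff matrix_vector_mult_def scaleR_complex sum_distrib_left mult.assoc)
lemma matrix_mul_scaleR: "(A :: complex^'n^'m) ** (r *\<^sub>R B) = r *\<^sub>R (A ** B)"
  by (simp add: vec_eq_iff matrix_matrix_mult_def scaleR_complex sum_distrib_left mult.left_commute)
lemma scaleR_matrix_mul: "(r *\<^sub>R (A :: complex^'n^'m)) ** B = r *\<^sub>R (A ** B)"
  by (simp add: vec_eq_iff matrix_matrix_mult_def scaleR_complex sum_distrib_left mult.assoc)
lemma matrix_vector_smult: "(A :: complex^'n^'m) *v (a *s x) = a *s (A *v x)"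
  by (simp add: vec_eq_iff matrix_vector_mult_def sum_distrib_left mult.left_commute)
lemma matrix_mul_minus: "(A :: complex^'n^'m) ** (- B) = - (A ** B)" "(- A) ** B = - (A ** B)"
  by (simp_all add: vec_eq_iff matrix_matrix_mult_def sum_negf)
lemma matrix_vector_minus: "(A :: complex^'n^'m) *v (- x) = - (A *v x)" "(- A) *v x = - (A *v x)"
  by (simp_all add: vec_eq_iff matrix_vector_mult_def sum_negf)
lemma matrix_mul_diff: "(A :: complex^'n^'m) ** (B - C) = A ** B - A ** C"
  "((A :: complex^'n^'m) - A') ** B' = A ** B' - A' ** B'"
  by (simp_all add: vec_eq_iff matrix_matrix_mult_def algebra_simps sum_subtractf)
lemma matrix_mul_add: "(A :: complex^'n^'m) ** (B + C) = A ** B + A ** C"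
  "((A :: complex^'n^'m) + A') ** B' = A ** B' + A' ** B'"
  by (simp_all add: vec_eq_iff matrix_matrix_mult_def algebra_simps sum.distrib)
lemma mat_mul: "mat z ** A = (\<chi> i. z *s (A $ i))" "(mat z :: complex^'n^'n) *v x = z *s x"
  by (simp_all add: vec_eq_iff mat_def matrix_matrix_mult_def matrix_vector_mult_def if_distrib[of "\<lambda>x. x * _"] cong: if_cong)

lemma bounded_bilinear_matrix_vector: "bounded_bilinear ((*v) :: complex^'n^'m \<Rightarrow> _)"
  by (rule bilinear_bounded)
     (simp_all add: matrix_vector_mult_add_rdistrib matrix_vector_right_distrib scaleR_matrix_vector matrix_vector_scaleR)

lemma bounded_linear_hadj: "bounded_linear (hadj :: complex^'n^'m \<Rightarrow> _)"
  by (rule linear_conv_bounded_linear[THEN iffD1])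
     (simp add: linear_iff hadj_def vec_eq_iff scaleR_complex)

lemma hadj_hadj [simp]: "hadj (hadj X) = X" by (simp add: hadj_def vec_eq_iff)
lemma hadj_mat [simp]: "hadj (mat z) = mat (cnj z)" by (auto simp: hadj_def vec_eq_iff mat_def)
lemma hadj_mul: "hadj (X ** Y) = hadj Y ** hadj X"
  by (simp add: hadj_def vec_eq_iff matrix_matrix_mult_def mult.commute)
lemma hadj_add: "hadj (X + Y) = hadj X + hadj Y" by (simp add: hadj_def vec_eq_iff)
lemma hadj_diff: "hadj (X - Y) = hadj X - hadj Y" by (simp add: hadj_def vec_eq_iff)
lemma hadj_scaleR: "hadj (r *\<^sub>R X) = r *\<^sub>R hadj X" by (simp add: hadj_def vec_eq_iff scaleR_complex)

lemma cvec_ip_hadj: "cvec_ip (X *v x) y = cvec_ip x (hadj X *v y)"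
proof -
  have "cvec_ip (X *v x) y = (\<Sum>i\<in>UNIV. \<Sum>j\<in>UNIV. X $ i $ j * x $ j * cnj (y $ i))"
    by (simp add: cvec_ip_def matrix_vector_mult_def sum_distrib_right)
  also have "\<dots> = (\<Sum>j\<in>UNIV. \<Sum>i\<in>UNIV. X $ i $ j * x $ j * cnj (y $ i))" by (rule sum.swap)
  also have "\<dots> = cvec_ip x (hadj X *v y)"
    by (simp add: cvec_ip_def matrix_vector_mult_def hadj_def sum_distrib_left algebra_simps)
  finally show ?thesis .
qed

lemma matrix_inv_mult:
  fixes A :: "complex^'n^'n"
  assumes "invertible A"
  shows "matrix_inv A ** A = mat 1" "A ** matrix_inv A = mat 1"
  using assms unfolding invertible_def matrix_inv_def by (auto intro: someI2_ex)

lemma matrix_inv_unique: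
  fixes A :: "complex^'n^'n"
  assumes "A ** B = mat 1"
  shows "matrix_inv A = B" "invertible A"
proof -
  show inv: "invertible A" using assms invertible_right_inverse by blast
  have "matrix_inv A = matrix_inv A ** (A ** B)" using assms by simp
  also have "\<dots> = B" by (simp add: matrix_mul_assoc matrix_inv_mult[OF inv])
  finally show "matrix_inv A = B" .
qed

lemma invertible_iff_kernel:
  fixes A :: "complex^'n^'n"
  shows "invertible A \<longleftrightarrow> (\<forall>x. A *v x = 0 \<longrightarrow> x = 0)"
proof
  assume "invertible A"
  then show "\<forall>x. A *v x = 0 \<longrightarrow> x = 0"
    by (metis matrix_inv_mult(1) matrix_vector_mul_assoc matrix_vector_mul_lid matrix_vector_mult_0_right)
next
  assume *: "\<forall>x. A *v x = 0 \<longrightarrow> x = 0"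
  have "inj ((*v) A)"
  proof (rule injI)
    fix x y assume "A *v x = A *v y"
    then have "A *v (x - y) = 0" by (simp add: matrix_vector_mult_diff_distrib)
    then show "x = y" using * by auto
  qed
  then show "invertible A" using matrix_left_invertible_injective invertible_left_inverse by blast
qed

lemma scaleR_block_matrix:
  "r *\<^sub>R block_matrix A B C D = block_matrix (r *\<^sub>R A) (r *\<^sub>R B) (r *\<^sub>R C) (r *\<^sub>R D)"
  by (simp add: block_matrix_def vec_eq_iff split: sum.split)

section \<open>Hilbert spaces with explicit carrier: Riesz representation and projections\<close>

context complex_hilbert_space
begin

lemma diff_closed: "x \<in> hset E \<Longrightarrow> y \<in> hset E \<Longrightarrow> hdiff E x y \<in> hset E"
  by (simp add: hdiff_def add_closed scale_closed)

lemmas closed = zero_closed add_closed scale_closed diff_closed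

lemma ip_add2: "x \<in> hset E \<Longrightarrow> y \<in> hset E \<Longrightarrow> z \<in> hset E \<Longrightarrow> hip E z (hadd E x y) = hip E z x + hip E z y"
  using ip_cnj[of "hadd E x y" z] ip_cnj[of x z] ip_cnj[of y z] by (simp add: closed ip_add)

lemma ip_scale2: "x \<in> hset E \<Longrightarrow> y \<in> hset E \<Longrightarrow> hip E y (hscale E a x) = cnj a * hip E y x"
  using ip_cnj[of "hscale E a x" y] ip_cnj[of x y] by (simp add: closed ip_scale)

lemma ip_diff: "x \<in> hset E \<Longrightarrow> y \<in> hset E \<Longrightarrow> z \<in> hset E \<Longrightarrow> hip E (hdiff E x y) z = hip E x z - hip E y z"
  by (simp add: hdiff_def ip_add ip_scale closed)

lemma ip_diff2: "x \<in> hset E \<Longrightarrow> y \<in> hset E \<Longrightarrow> z \<in> hset E \<Longrightarrow> hip E z (hdiff E x y) = hip E z x - hip E z y"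
  by (simp add: hdiff_def ip_add2 ip_scale2 closed)

lemma ip_zero: "x \<in> hset E \<Longrightarrow> hip E (hzero E) x = 0" "x \<in> hset E \<Longrightarrow> hip E x (hzero E) = 0"
  using add_inverse[of x] ip_diff[of x x x] ip_diff2[of x x x] by simp_all

lemmas ips = ip_add ip_scale ip_add2 ip_scale2 ip_diff ip_diff2 ip_zero closed

lemma ip_self: "x \<in> hset E \<Longrightarrow> hip E x x = of_real ((hnorm E x)\<^sup>2)"
  using ip_cnj[of x x] ip_nonneg[of x] by (simp add: hnorm_def complex_eq_iff)

lemma norm_nonneg: "x \<in> hset E \<Longrightarrow> 0 \<le> hnorm E x"
  by (simp add: hnorm_def ip_nonneg)

lemma norm_sq: "x \<in> hset E \<Longrightarrow> (hnorm E x)\<^sup>2 = Re (hip E x x)"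
  by (simp add: hnorm_def ip_nonneg)

lemma diff_zero_eq:
  assumes "x \<in> hset E" "y \<in> hset E" "hdiff E x y = hzero E"
  shows "x = y"
proof -
  have "hadd E (hdiff E x y) y = y" by (simp only: assms(3) add_zero[OF assms(2)])
  then have "y = hadd E (hdiff E x y) y" by (rule sym)
  also have "\<dots> = hadd E x (hadd E y (hscale E (-1) y))"
    using assms(1,2) by (simp add: hdiff_def add_assoc add_commute[of "hscale E (- 1) y" y] closed)
  also have "hadd E y (hscale E (-1) y) = hzero E" using add_inverse[OF assms(2)] by (simp add: hdiff_def)
  also have "hadd E x (hzero E) = x" using assms by (simp add: add_commute[of x] add_zero closed)
  finally show ?thesis by simp
qed

text \<open>The main device for vector identities below: after testing against an arbitrary vector,
  \<open>ips\<close> reduces both sides to scalar algebra, so the module laws of the carrier need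
  not be handled one by one.\<close>

lemma ip_ext:
  assumes "x \<in> hset E" "y \<in> hset E" "\<And>z. z \<in> hset E \<Longrightarrow> hip E x z = hip E y z"
  shows "x = y"
proof (rule diff_zero_eq[OF assms(1,2)], rule ip_definite)
  show "hip E (hdiff E x y) (hdiff E x y) = 0" using assms by (simp add: ip_diff closed)
qed (use assms closed in auto)

lemma ip_ext2:
  assumes "x \<in> hset E" "y \<in> hset E" "\<And>z. z \<in> hset E \<Longrightarrow> hip E z x = hip E z y"
  shows "x = y"
  using assms by (intro ip_ext) (auto simp: ip_cnj[of _ x] ip_cnj[of _ y])

lemma cauchy_schwarz:
  assumes [simp]: "x \<in> hset E" "y \<in> hset E"
  shows "cmod (hip E x y) \<le> hnorm E x * hnorm E y"
proof -
  define a where "a = hip E x y"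
  define b where "b = (hnorm E y)\<^sup>2"
  have yx: "hip E y x = cnj a" using ip_cnj[of x y] by (simp add: a_def)
  have yy: "hip E y y = of_real b" by (simp add: ip_self b_def)
  have xx: "hip E x x = of_real ((hnorm E x)\<^sup>2)" by (simp add: ip_self)
  \<comment> \<open>This is the component of x orthogonal to y, multiplied by the squared norm of y
    to avoid a division.\<close>
  define w where "w = hdiff E (hscale E (of_real b) x) (hscale E a y)"
  have w: "w \<in> hset E" by (simp add: w_def closed)
  have "hip E w w = of_real (b * (b * (hnorm E x)\<^sup>2 - (cmod a)\<^sup>2))"
    by (simp add: w_def ips yx yy xx a_def[symmetric] cmod2 algebra_simps)
  then have ge: "0 \<le> b * (b * (hnorm E x)\<^sup>2 - (cmod a)\<^sup>2)" using ip_nonneg[OF w] by simp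
  have b: "b \<ge> 0" by (simp add: b_def)
  show ?thesis
  proof (cases "b = 0")
    case True
    then have "y = hzero E" using yy by (intro ip_definite) auto
    then show ?thesis by (simp add: ip_zero norm_nonneg closed)
  next
    case False
    with b ge have "(cmod a)\<^sup>2 \<le> b * (hnorm E x)\<^sup>2" by (simp add: zero_le_mult_iff)
    then have "(cmod a)\<^sup>2 \<le> (hnorm E x * hnorm E y)\<^sup>2" by (simp add: b_def power_mult_distrib mult.commute)
    then show ?thesis unfolding a_def by (rule power2_le_imp_le) (simp add: norm_nonneg)
  qed
qed

lemma norm_scale: "x \<in> hset E \<Longrightarrow> hnorm E (hscale E a x) = cmod a * hnorm E x"
proof -
  assume x: "x \<in> hset E"
  have "complex_of_real ((hnorm E (hscale E a x))\<^sup>2) = of_real ((cmod a * hnorm E x)\<^sup>2)"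
    using x ip_self[of "hscale E a x"] ip_self[of x]
    by (simp add: ips power_mult_distrib cmod2 mult.assoc mult.left_commute)
  then have "(hnorm E (hscale E a x))\<^sup>2 = (cmod a * hnorm E x)\<^sup>2" using of_real_eq_iff by blast
  then show ?thesis using x by (simp add: norm_nonneg closed)
qed

lemma norm_add_le:
  assumes [simp]: "x \<in> hset E" "y \<in> hset E"
  shows "hnorm E (hadd E x y) \<le> hnorm E x + hnorm E y"
proof (rule power2_le_imp_le)
  have "(hnorm E (hadd E x y))\<^sup>2 = (hnorm E x)\<^sup>2 + (hnorm E y)\<^sup>2 + 2 * Re (hip E x y)"
    using ip_cnj[of x y] by (simp add: norm_sq ips)
  also have "Re (hip E x y) \<le> hnorm E x * hnorm E y"
    using cauchy_schwarz[of x y] complex_Re_le_cmod[of "hip E x y"] by simp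
  finally show "(hnorm E (hadd E x y))\<^sup>2 \<le> (hnorm E x + hnorm E y)\<^sup>2" by (simp add: power2_sum)
qed (simp add: norm_nonneg)

lemma norm_diff_commute:
  assumes "x \<in> hset E" "y \<in> hset E"
  shows "hnorm E (hdiff E x y) = hnorm E (hdiff E y x)"
  using assms by (simp add: hnorm_def ips algebra_simps)

lemma norm_diff_triangle:
  assumes [simp]: "x \<in> hset E" "y \<in> hset E" "z \<in> hset E"
  shows "hnorm E (hdiff E x z) \<le> hnorm E (hdiff E x y) + hnorm E (hdiff E y z)"
proof -
  have "hdiff E x z = hadd E (hdiff E x y) (hdiff E y z)"
    by (rule ip_ext) (simp_all add: ips)
  then show ?thesis by (simp add: norm_add_le closed)
qed

definition closed_subspace :: "'a set \<Rightarrow> bool" where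
  "closed_subspace S \<longleftrightarrow> S \<subseteq> hset E \<and> hzero E \<in> S \<and> (\<forall>x\<in>S. \<forall>y\<in>S. hadd E x y \<in> S) \<and>
     (\<forall>a. \<forall>x\<in>S. hscale E a x \<in> S) \<and>
     (\<forall>s x. (\<forall>n. s n \<in> S) \<and> x \<in> hset E \<and> (\<lambda>n. hnorm E (hdiff E (s n) x)) \<longlonglongrightarrow> 0 \<longrightarrow> x \<in> S)"

lemma closed_subspace_whole: "closed_subspace (hset E)"
  by (auto simp: closed_subspace_def closed)

lemma parallelogram:
  assumes [simp]: "x \<in> hset E" "y \<in> hset E"
  shows "(hnorm E (hdiff E x y))\<^sup>2 + 4 * (hnorm E (hscale E (1/2) (hadd E x y)))\<^sup>2
     = 2 * (hnorm E x)\<^sup>2 + 2 * (hnorm E y)\<^sup>2"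
  by (simp add: norm_sq ips algebra_simps)

text \<open>The representing vector minimizes \<open>(hnorm E x)\<^sup>2 - 2 * Re (\<phi> x)\<close>
  over S. The functional is conjugate linear, like the elements of the minus space, so this vector
  stands in the first slot of the inner product. Stationarity in direction x is obtained by
  perturbing the members of a minimizing sequence and passing to the limit.\<close>

lemma riesz:
  assumes S: "closed_subspace S"
    and add: "\<And>x y. x \<in> S \<Longrightarrow> y \<in> S \<Longrightarrow> \<phi> (hadd E x y) = \<phi> x + \<phi> y"
    and scale: "\<And>a x. x \<in> S \<Longrightarrow> \<phi> (hscale E a x) = cnj a * \<phi> x"
    and bound: "\<And>x. x \<in> S \<Longrightarrow> cmod (\<phi> x) \<le> C * hnorm E x"
  obtains f where "f \<in> S" "\<And>x. x \<in> S \<Longrightarrow> \<phi> x = hip E f x"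
proof -
  have SE: "\<And>x. x \<in> S \<Longrightarrow> x \<in> hset E" and S0: "hzero E \<in> S"
    and Sadd: "\<And>x y. x \<in> S \<Longrightarrow> y \<in> S \<Longrightarrow> hadd E x y \<in> S"
    and Sscale: "\<And>a x. x \<in> S \<Longrightarrow> hscale E a x \<in> S"
    and Slim: "\<And>s x. (\<forall>n. s n \<in> S) \<Longrightarrow> x \<in> hset E \<Longrightarrow> (\<lambda>n. hnorm E (hdiff E (s n) x)) \<longlonglongrightarrow> 0 \<Longrightarrow> x \<in> S"
    using S unfolding closed_subspace_def by (blast, blast, blast, blast, blast)
  define Q where "Q = (\<lambda>x. (hnorm E x)\<^sup>2 - 2 * Re (\<phi> x))"
  have Qge: "Q x \<ge> - (C\<^sup>2)" if "x \<in> S" for x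
  proof -
    have "Re (\<phi> x) \<le> C * hnorm E x" using bound[OF that] complex_Re_le_cmod[of "\<phi> x"] by linarith
    then have "Q x \<ge> (hnorm E x)\<^sup>2 - 2 * (C * hnorm E x)" by (simp add: Q_def)
    moreover have "(hnorm E x - C)\<^sup>2 \<ge> 0" by simp
    ultimately show ?thesis by (simp add: power2_diff mult.commute mult.left_commute)
  qed
  define m where "m = Inf (Q ` S)"
  have bdd: "bdd_below (Q ` S)" using Qge by (intro bdd_belowI[of _ "-(C\<^sup>2)"]) auto
  have m_le: "m \<le> Q x" if "x \<in> S" for x unfolding m_def by (rule cInf_lower) (use that bdd in auto)
  have "\<exists>x\<in>S. Q x < m + inverse (real (Suc n))" for n
  proof -
    have "Inf (Q ` S) < m + inverse (real (Suc n))" by (simp add: m_def)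
    then show ?thesis using cInf_less_iff[of "Q ` S"] bdd S0 by auto
  qed
  then obtain s where s: "\<And>n. s n \<in> S" "\<And>n. Q (s n) < m + inverse (real (Suc n))" by metis
  have sE [simp]: "s n \<in> hset E" for n by (rule SE[OF s(1)])
  \<comment> \<open>The parallelogram law for the midpoint y, where Q is still at least m.\<close>
  have cauchy: "(hnorm E (hdiff E (s n) (s k)))\<^sup>2 \<le> 2 * inverse (real (Suc n)) + 2 * inverse (real (Suc k))" for n k
  proof -
    define y where "y = hscale E (1/2) (hadd E (s n) (s k))"
    have y: "y \<in> S" by (simp add: y_def Sscale Sadd s)
    have "\<phi> y = (\<phi> (s n) + \<phi> (s k)) / 2" by (simp add: y_def scale add Sadd s)
    then have "Re (\<phi> y) = Re (\<phi> (s n) + \<phi> (s k)) / 2" by (simp only: Re_divide_numeral)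
    then have "4 * Q y = 4 * (hnorm E y)\<^sup>2 - 4 * Re (\<phi> (s n)) - 4 * Re (\<phi> (s k))" by (simp add: Q_def field_simps)
    then have "(hnorm E (hdiff E (s n) (s k)))\<^sup>2 = 2 * Q (s n) + 2 * Q (s k) - 4 * Q y"
      using parallelogram[of "s n" "s k"] by (simp add: Q_def y_def)
    then show ?thesis using s(2)[of n] s(2)[of k] m_le[OF y] by linarith
  qed
  have "\<exists>f\<in>hset E. (\<lambda>n. hnorm E (hdiff E (s n) f)) \<longlonglongrightarrow> 0"
  proof (rule complete, simp, intro allI impI)
    fix e :: real assume "e > 0"
    then obtain N where N: "inverse (real (Suc N)) < e\<^sup>2 / 4"
      using reals_Archimedean[of "e\<^sup>2/4"] by auto
    have "hnorm E (hdiff E (s n) (s k)) < e" if "n \<ge> N" "k \<ge> N" for n k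
    proof (rule power2_less_imp_less)
      have "inverse (real (Suc n)) \<le> inverse (real (Suc N))" "inverse (real (Suc k)) \<le> inverse (real (Suc N))"
        using that by (auto intro!: le_imp_inverse_le)
      then show "(hnorm E (hdiff E (s n) (s k)))\<^sup>2 < e\<^sup>2" using cauchy[of n k] N by linarith
    qed (use \<open>e > 0\<close> in simp)
    then show "\<exists>N. \<forall>m\<ge>N. \<forall>n\<ge>N. hnorm E (hdiff E (s m) (s n)) < e" by blast
  qed
  then obtain f where f: "f \<in> hset E" and lim: "(\<lambda>n. hnorm E (hdiff E (s n) f)) \<longlonglongrightarrow> 0" by blast
  have fS: "f \<in> S" by (rule Slim[OF _ f lim]) (simp add: s)
  have "\<phi> x = hip E f x" if x: "x \<in> S" for x
  proof -
    have xE [simp]: "x \<in> hset E" by (rule SE[OF x])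
    define w where "w = (\<lambda>n. hip E (s n) x - \<phi> x)"
    define w0 where "w0 = hip E f x - \<phi> x"
    have "w \<longlonglongrightarrow> w0"
    proof -
      have "(\<lambda>n. hip E (hdiff E (s n) f) x) \<longlonglongrightarrow> 0"
      proof (rule Lim_null_comparison)
        show "\<forall>\<^sub>F n in sequentially. norm (hip E (hdiff E (s n) f) x) \<le> hnorm E (hdiff E (s n) f) * hnorm E x"
          using f by (intro always_eventually allI cauchy_schwarz) (auto simp: closed)
        show "(\<lambda>n. hnorm E (hdiff E (s n) f) * hnorm E x) \<longlonglongrightarrow> 0" using tendsto_mult_right[OF lim, of "hnorm E x"] by simp
      qed
      then have "(\<lambda>n. hip E (hdiff E (s n) f) x + w0) \<longlonglongrightarrow> 0 + w0" by (intro tendsto_add tendsto_const)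
      moreover have "hip E (hdiff E (s n) f) x + w0 = w n" for n
        using f by (simp add: ip_diff w_def w0_def)
      ultimately show ?thesis by simp
    qed
    \<comment> \<open>A step length so small that the first-order decrease \<open>2 * r\<close>
      outweighs the quadratic term \<open>r\<^sup>2 * (hnorm E x)\<^sup>2\<close>; the
      \<open>1\<close> in the denominator covers x of norm 0.\<close>
    define r where "r = 1 / ((hnorm E x)\<^sup>2 + 1)"
    have r: "r > 0" "r * (hnorm E x)\<^sup>2 < 1" by (auto simp: r_def field_simps add_pos_nonneg sum_power2_gt_zero_iff)
    have key: "- inverse (real (Suc n)) \<le> - 2 * r * (cmod (w n))\<^sup>2 + r\<^sup>2 * (cmod (w n))\<^sup>2 * (hnorm E x)\<^sup>2" for n
    proof -
      \<comment> \<open>\<open>w n\<close> is the error of the representation at \<open>s n\<close>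
        in direction x; the perturbation goes against it.\<close>
      define t where "t = - (of_real r * w n)"
      have "m \<le> Q (hadd E (s n) (hscale E t x))" by (intro m_le Sadd Sscale s x)
      also have "\<dots> = Q (s n) + 2 * Re (cnj t * w n) + (cmod t)\<^sup>2 * (hnorm E x)\<^sup>2"
      proof -
        have "hip E x (s n) = cnj (hip E (s n) x)" by (rule ip_cnj) auto
        then have "(hnorm E (hadd E (s n) (hscale E t x)))\<^sup>2
           = (hnorm E (s n))\<^sup>2 + 2 * Re (cnj t * hip E (s n) x) + (cmod t)\<^sup>2 * (hnorm E x)\<^sup>2"
          by (simp add: norm_sq ips mult.assoc[symmetric] flip: cmod2)
             (simp add: ip_self algebra_simps cmod_power2[of t] power2_eq_square[of "Re _"] power2_eq_square[of "Im _"])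
        then show ?thesis by (simp add: Q_def w_def add scale Sscale s x algebra_simps)
      qed
      also have "cnj t * w n = of_real (- (r * (cmod (w n))\<^sup>2))"
      proof -
        have "cnj t * w n = - (of_real r * (w n * cnj (w n)))" by (simp add: t_def mult_ac)
        also have "w n * cnj (w n) = of_real ((cmod (w n))\<^sup>2)" by (rule complex_norm_square[symmetric])
        finally show ?thesis by simp
      qed
      also have "(cmod t)\<^sup>2 = r\<^sup>2 * (cmod (w n))\<^sup>2" using r by (simp add: t_def norm_mult power_mult_distrib)
      finally show ?thesis using s(2)[of n] by (simp add: algebra_simps)
    qed
    have "0 \<le> - 2 * r * (cmod w0)\<^sup>2 + r\<^sup>2 * (cmod w0)\<^sup>2 * (hnorm E x)\<^sup>2"
    proof (rule LIMSEQ_le)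
      show "(\<lambda>n. - inverse (real (Suc n))) \<longlonglongrightarrow> 0" using tendsto_minus[OF LIMSEQ_inverse_real_of_nat] by simp
      show "(\<lambda>n. - 2 * r * (cmod (w n))\<^sup>2 + r\<^sup>2 * (cmod (w n))\<^sup>2 * (hnorm E x)\<^sup>2) \<longlonglongrightarrow>
          - 2 * r * (cmod w0)\<^sup>2 + r\<^sup>2 * (cmod w0)\<^sup>2 * (hnorm E x)\<^sup>2"
        by (intro tendsto_intros \<open>w \<longlonglongrightarrow> w0\<close>)
    qed (use key in blast)
    also have "\<dots> = r * (cmod w0)\<^sup>2 * (r * (hnorm E x)\<^sup>2 - 2)" by (simp add: power2_eq_square algebra_simps)
    finally have "0 \<le> (r * (cmod w0)\<^sup>2) * (r * (hnorm E x)\<^sup>2 - 2)" .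
    moreover have "r * (hnorm E x)\<^sup>2 - 2 < 0" using r(2) by linarith
    ultimately have "r * (cmod w0)\<^sup>2 \<le> 0" by (simp add: zero_le_mult_iff)
    then have "w0 = 0" using r(1) by (simp add: mult_le_0_iff)
    then show ?thesis by (simp add: w0_def)
  qed
  then show thesis using that fS by blast
qed

text \<open>The projection p is the Riesz vector, taken inside S, of the functional z -> <x, z>; the
  norm bound is Cauchy-Schwarz applied to |p|^2 = <x, p>.\<close>

lemma projection:
  assumes S: "closed_subspace S" and x: "x \<in> hset E"
  shows "hproj E S x \<in> S" "\<And>z. z \<in> S \<Longrightarrow> hip E (hdiff E x (hproj E S x)) z = 0"
    "hnorm E (hproj E S x) \<le> hnorm E x"
proof -
  have SE: "\<And>y. y \<in> S \<Longrightarrow> y \<in> hset E" and Sdiff: "\<And>y z. y \<in> S \<Longrightarrow> z \<in> S \<Longrightarrow> hdiff E y z \<in> S"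
    using S unfolding closed_subspace_def hdiff_def by (blast, blast)
  obtain y where y: "y \<in> S" "\<And>z. z \<in> S \<Longrightarrow> hip E x z = hip E y z"
  proof (rule riesz[OF S, of "\<lambda>z. hip E x z" "hnorm E x"])
    show "hip E x (hadd E u v) = hip E x u + hip E x v" if "u \<in> S" "v \<in> S" for u v
      using that x SE by (simp add: ips)
    show "hip E x (hscale E a u) = cnj a * hip E x u" if "u \<in> S" for a u
      using that x SE by (simp add: ips)
    show "cmod (hip E x u) \<le> hnorm E x * hnorm E u" if "u \<in> S" for u
      using that x SE by (simp add: cauchy_schwarz)
  qed blast
  have "hproj E S x = y" unfolding hproj_def
  proof (rule the_equality)
    show "y \<in> S \<and> (\<forall>z\<in>S. hip E (hdiff E x y) z = 0)" using y x SE by (simp add: ip_diff)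
    fix y' assume y': "y' \<in> S \<and> (\<forall>z\<in>S. hip E (hdiff E x y') z = 0)"
    then have d: "hdiff E y y' \<in> S" using y(1) Sdiff by blast
    then have "hip E x (hdiff E y y') = hip E y' (hdiff E y y')" "hip E x (hdiff E y y') = hip E y (hdiff E y y')"
      using y'  y(2)[OF d] x SE by (auto simp: ip_diff)
    then have "hip E (hdiff E y y') (hdiff E y y') = 0"
      using y(1) y' SE d by (simp add: ip_diff)
    then show "y' = y" using diff_zero_eq[of y y'] ip_definite[of "hdiff E y y'"] y(1) y' SE closed by metis
  qed
  then show 1: "hproj E S x \<in> S" and 2: "\<And>z. z \<in> S \<Longrightarrow> hip E (hdiff E x (hproj E S x)) z = 0"
    using y x SE by (auto simp: ip_diff)
  let ?p = "hproj E S x"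
  have pE: "?p \<in> hset E" by (rule SE[OF 1])
  have "of_real ((hnorm E ?p)\<^sup>2) = hip E x ?p" using 2[OF 1] x pE by (simp add: ip_diff ip_self)
  then have "(hnorm E ?p)\<^sup>2 = cmod (hip E x ?p)" by (metis abs_of_nonneg norm_of_real zero_le_power2)
  also have "\<dots> \<le> hnorm E x * hnorm E ?p" by (rule cauchy_schwarz[OF x pE])
  finally show "hnorm E ?p \<le> hnorm E x"
    using norm_nonneg[OF pE] norm_nonneg[OF x] by (cases "hnorm E ?p = 0") (auto simp: power2_eq_square)
qed

lemma closed_subspace_closure:
  assumes SE: "S \<subseteq> hset E" and S0: "hzero E \<in> S"
    and Sadd: "\<And>x y. x \<in> S \<Longrightarrow> y \<in> S \<Longrightarrow> hadd E x y \<in> S"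
    and Sscale: "\<And>a x. x \<in> S \<Longrightarrow> hscale E a x \<in> S"
  shows "closed_subspace (hclosure E S)"
proof -
  have cl: "x \<in> hclosure E S \<longleftrightarrow> x \<in> hset E \<and> (\<forall>e>0. \<exists>y\<in>S. hnorm E (hdiff E x y) < e)" for x
    by (simp add: hclosure_def)
  have "hzero E \<in> hclosure E S"
    unfolding cl using S0 by (auto simp: closed add_inverse hnorm_def ip_zero intro!: bexI[of _ "hzero E"])
  moreover have "hadd E x y \<in> hclosure E S" if x: "x \<in> hclosure E S" and y: "y \<in> hclosure E S" for x y
    unfolding cl
  proof (intro conjI allI impI)
    show "hadd E x y \<in> hset E" using x y by (auto simp: cl closed)
    fix e :: real assume "e > 0"
    then have "e/2 > 0" by simp
    obtain x' where x': "x' \<in> S" "hnorm E (hdiff E x x') < e/2" using x \<open>e/2 > 0\<close> unfolding cl by blast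
    obtain y' where y': "y' \<in> S" "hnorm E (hdiff E y y') < e/2" using y \<open>e/2 > 0\<close> unfolding cl by blast
    have m: "x \<in> hset E" "y \<in> hset E" "x' \<in> hset E" "y' \<in> hset E" using x y x' y' SE by (auto simp: cl)
    have "hdiff E (hadd E x y) (hadd E x' y') = hadd E (hdiff E x x') (hdiff E y y')"
      by (rule ip_ext) (simp_all add: ips m)
    then have "hnorm E (hdiff E (hadd E x y) (hadd E x' y')) < e"
      using norm_add_le[of "hdiff E x x'" "hdiff E y y'"] x' y' m by (simp add: closed)
    then show "\<exists>z\<in>S. hnorm E (hdiff E (hadd E x y) z) < e" using Sadd[OF x'(1) y'(1)] by blast
  qed
  moreover have "hscale E a x \<in> hclosure E S" if x: "x \<in> hclosure E S" for a x
    unfolding cl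
  proof (intro conjI allI impI)
    show "hscale E a x \<in> hset E" using x by (auto simp: cl closed)
    fix e :: real assume "e > 0"
    then have "e / (cmod a + 1) > 0" by (simp add: add_nonneg_pos)
    then obtain x' where x': "x' \<in> S" "hnorm E (hdiff E x x') < e / (cmod a + 1)" using x by (auto simp: cl)
    have m: "x \<in> hset E" "x' \<in> hset E" using x x' SE by (auto simp: cl)
    have "hdiff E (hscale E a x) (hscale E a x') = hscale E a (hdiff E x x')"
      by (rule ip_ext) (simp_all add: ips m algebra_simps)
    then have "hnorm E (hdiff E (hscale E a x) (hscale E a x')) = cmod a * hnorm E (hdiff E x x')"
      by (simp add: norm_scale closed m)
    also have "\<dots> \<le> (cmod a + 1) * hnorm E (hdiff E x x')"
      using norm_nonneg[of "hdiff E x x'"] m by (intro mult_right_mono) (auto simp: closed)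
    also have "\<dots> < e" using x'(2) by (simp add: pos_less_divide_eq add_nonneg_pos mult.commute)
    finally show "\<exists>z\<in>S. hnorm E (hdiff E (hscale E a x) z) < e" using Sscale[OF x'(1)] by blast
  qed
  moreover have "x \<in> hclosure E S"
    if s: "\<forall>n. s n \<in> hclosure E S" and x: "x \<in> hset E" and lim: "(\<lambda>n. hnorm E (hdiff E (s n) x)) \<longlonglongrightarrow> 0" for s x
    unfolding cl
  proof (intro conjI allI impI x)
    fix e :: real assume "e > 0"
    then have "e/2 > 0" by simp
    then have "\<forall>\<^sub>F n in sequentially. hnorm E (hdiff E (s n) x) < e/2" by (rule order_tendstoD(2)[OF lim])
    then obtain n where n: "hnorm E (hdiff E (s n) x) < e/2" by (auto simp: eventually_sequentially)
    obtain y where y: "y \<in> S" "hnorm E (hdiff E (s n) y) < e/2" using s \<open>e/2 > 0\<close> unfolding cl by blast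
    have "hnorm E (hdiff E x y) \<le> hnorm E (hdiff E x (s n)) + hnorm E (hdiff E (s n) y)"
      using s x y SE by (intro norm_diff_triangle) (auto simp: cl)
    also have "hnorm E (hdiff E x (s n)) = hnorm E (hdiff E (s n) x)"
      using s x by (intro norm_diff_commute) (auto simp: cl)
    finally show "\<exists>y\<in>S. hnorm E (hdiff E x y) < e" using n y by (intro bexI[of _ y]) auto
  qed
  ultimately show ?thesis unfolding closed_subspace_def by (auto simp: cl)
qed

lemma closure_orthogonal:
  assumes x: "x \<in> hset E" and S: "S \<subseteq> hset E" and orth: "\<And>y. y \<in> S \<Longrightarrow> hip E x y = 0"
    and y: "y \<in> hclosure E S"
  shows "hip E x y = 0"
proof -
  have yE: "y \<in> hset E" using y by (simp add: hclosure_def)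
  have "cmod (hip E x y) \<le> 0 + e" if "e > 0" for e
  proof -
    have nx: "hnorm E x \<ge> 0" by (rule norm_nonneg[OF x])
    then have "e / (hnorm E x + 1) > 0" using that by simp
    then obtain y0 where y0: "y0 \<in> S" "hnorm E (hdiff E y y0) < e / (hnorm E x + 1)"
      using y unfolding hclosure_def by blast
    have y0E: "y0 \<in> hset E" using y0 S by blast
    have "hip E x y = hip E x (hdiff E y y0)" using orth[OF y0(1)] x yE y0E by (simp add: ip_diff2)
    also have "cmod \<dots> \<le> hnorm E x * hnorm E (hdiff E y y0)"
      by (rule cauchy_schwarz[OF x diff_closed[OF yE y0E]])
    also have "\<dots> \<le> hnorm E x * (e / (hnorm E x + 1))" using y0(2) nx by (intro mult_left_mono) auto
    also have "\<dots> = (hnorm E x / (hnorm E x + 1)) * e" by simp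
    also have "\<dots> \<le> 1 * e" using nx that by (intro mult_right_mono) auto
    finally show ?thesis by simp
  qed
  then have "cmod (hip E x y) \<le> 0" by (rule field_le_epsilon)
  then show ?thesis by simp
qed

section \<open>Linear relations, their adjoints and resolvents\<close>

lemma rel_closure_superset:
  assumes T: "T \<subseteq> hset E \<times> hset E"
  shows "T \<subseteq> rel_closure E T"
proof clarify
  fix f g assume fg: "(f, g) \<in> T"
  then have m: "f \<in> hset E" "g \<in> hset E" using T by auto
  have "hnorm E (hdiff E f f) = 0" "hnorm E (hdiff E g g) = 0"
    using m by (simp_all add: add_inverse hnorm_def ip_zero zero_closed)
  then have "\<exists>(f0, g0)\<in>T. hnorm E (hdiff E f f0) < e \<and> hnorm E (hdiff E g g0) < e" if "e > 0" for e
    using that fg by (intro bexI[OF _ fg]) simp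
  then show "(f, g) \<in> rel_closure E T" unfolding rel_closure_def using m by simp
qed

text \<open>The adjoint condition is continuous in the pair (f, f'), so it survives limits. This
  lets the adjoint of \<open>A_min\<close> be computed on compactly supported pairs.\<close>

lemma rel_adjoint_closure:
  assumes T: "T \<subseteq> hset E \<times> hset E"
  shows "rel_adjoint E (rel_closure E T) = rel_adjoint E T"
proof (intro equalityI subsetI; clarify)
  fix h h' assume a: "(h, h') \<in> rel_adjoint E (rel_closure E T)"
  then show "(h, h') \<in> rel_adjoint E T"
    using rel_closure_superset[OF T] unfolding rel_adjoint_def by blast
next
  fix h h' assume a: "(h, h') \<in> rel_adjoint E T"
  then have h: "h \<in> hset E" "h' \<in> hset E" by (auto simp: rel_adjoint_def)
  show "(h, h') \<in> rel_adjoint E (rel_closure E T)"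
    unfolding rel_adjoint_def
  proof (clarsimp simp: h)
    fix f f' assume "(f, f') \<in> rel_closure E T"
    then have f: "f \<in> hset E" "f' \<in> hset E"
      and app: "\<And>e. e > 0 \<Longrightarrow> \<exists>(f0, g0)\<in>T. hnorm E (hdiff E f f0) < e \<and> hnorm E (hdiff E f' g0) < e"
      by (auto simp: rel_closure_def)
    define C where "C = hnorm E h + hnorm E h' + 1"
    have C: "C > 0" using norm_nonneg[OF h(1)] norm_nonneg[OF h(2)] by (simp add: C_def)
    have "cmod (hip E f' h - hip E f h') \<le> 0 + e" if "e > 0" for e
    proof -
      have "e / C > 0" using that C by simp
      from app[OF this] obtain f0 g0 where 0: "(f0, g0) \<in> T" "hnorm E (hdiff E f f0) < e / C" "hnorm E (hdiff E f' g0) < e / C"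
        by auto
      have m: "f0 \<in> hset E" "g0 \<in> hset E" using 0(1) T by auto
      have "hip E g0 h = hip E f0 h'" using a 0(1) unfolding rel_adjoint_def by auto
      then have "hip E f' h - hip E f h' = hip E (hdiff E f' g0) h - hip E (hdiff E f f0) h'"
        using m f h by (simp add: ip_diff)
      also have "cmod \<dots> \<le> cmod (hip E (hdiff E f' g0) h) + cmod (hip E (hdiff E f f0) h')"
        by (rule norm_triangle_ineq4)
      also have "\<dots> \<le> hnorm E (hdiff E f' g0) * hnorm E h + hnorm E (hdiff E f f0) * hnorm E h'"
        using m f h by (intro add_mono cauchy_schwarz diff_closed)
      also have "\<dots> \<le> (e / C) * hnorm E h + (e / C) * hnorm E h'"
        using 0(2,3) norm_nonneg h by (intro add_mono mult_right_mono) auto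
      also have "\<dots> = (e / C) * (hnorm E h + hnorm E h')" by (rule distrib_left[symmetric])
      also have "\<dots> = (e / C) * (C - 1)" unfolding C_def add_diff_cancel_right' ..
      also have "\<dots> \<le> e" using that C by (simp add: field_simps)
      finally show ?thesis by simp
    qed
    then have "cmod (hip E f' h - hip E f h') \<le> 0" by (rule field_le_epsilon)
    then show "hip E f' h = hip E f h'" by simp
  qed
qed

lemma rel_selfadjoint_sub:
  "rel_selfadjoint E T \<Longrightarrow> (f, g) \<in> T \<Longrightarrow> f \<in> hset E \<and> g \<in> hset E"
  unfolding rel_selfadjoint_def rel_adjoint_def by blast

lemma resolvent_spec:
  assumes "z \<in> resolvent_set E T" "g \<in> hset E"
  shows "resolvent E T z g \<in> hset E" "(resolvent E T z g, hadd E g (hscale E z (resolvent E T z g))) \<in> T"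
    "\<And>f. f \<in> hset E \<Longrightarrow> (f, hadd E g (hscale E z f)) \<in> T \<Longrightarrow> f = resolvent E T z g"
proof -
  have ex: "\<exists>!f. f \<in> hset E \<and> (f, hadd E g (hscale E z f)) \<in> T"
    using assms unfolding resolvent_set_def by blast
  show "resolvent E T z g \<in> hset E" "(resolvent E T z g, hadd E g (hscale E z (resolvent E T z g))) \<in> T"
    using theI'[OF ex] unfolding resolvent_def by auto
  show "\<And>f. f \<in> hset E \<Longrightarrow> (f, hadd E g (hscale E z f)) \<in> T \<Longrightarrow> f = resolvent E T z g"
    unfolding resolvent_def using the1_equality[OF ex] by auto
qed

text \<open>Membership in the resolvent set is assumed at z alone, so the facts at
  \<open>cnj z\<close> have to be produced: the bounded resolvent at z has a Riesz adjoint, and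
  selfadjointness of T identifies that adjoint with the resolvent at \<open>cnj z\<close>.\<close>

lemma resolvent_cnj:
  assumes T: "rel_selfadjoint E T" and z: "z \<in> resolvent_set E T" and g: "g \<in> hset E"
  shows "resolvent E T (cnj z) g \<in> hset E"
    "(resolvent E T (cnj z) g, hadd E g (hscale E (cnj z) (resolvent E T (cnj z) g))) \<in> T"
    "\<And>x. x \<in> hset E \<Longrightarrow> hip E (resolvent E T z x) g = hip E x (resolvent E T (cnj z) g)"
proof -
  note TE = rel_selfadjoint_sub[OF T]
  have Tadj: "(h, h') \<in> T \<longleftrightarrow> h \<in> hset E \<and> h' \<in> hset E \<and> (\<forall>(f, f')\<in>T. hip E f' h = hip E f h')" for h h'
    using T unfolding rel_selfadjoint_def rel_adjoint_def by blast
  have Tsym: "hip E f' h = hip E f h'" if "(f, f') \<in> T" "(h, h') \<in> T" for f f' h h'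
    using Tadj[of h h'] that by auto
  \<comment> \<open>Linearity of T is inherited from its equality with the adjoint, since an adjoint
    is always linear.\<close>
  have Tadd: "(hadd E f h, hadd E f' h') \<in> T" if "(f, f') \<in> T" "(h, h') \<in> T" for f f' h h'
    unfolding Tadj[of "hadd E f h"] using TE[OF that(1)] TE[OF that(2)] that
    by (auto simp: ips Tsym TE[THEN conjunct1] TE[THEN conjunct2])
  have Tscale: "(hscale E a f, hscale E a f') \<in> T" if "(f, f') \<in> T" for f f' a
    unfolding Tadj[of "hscale E a f"] using TE[OF that] that
    by (auto simp: ips Tsym TE[THEN conjunct1] TE[THEN conjunct2])
  define R where "R = resolvent E T z"
  have R: "R x \<in> hset E" "(R x, hadd E x (hscale E z (R x))) \<in> T"
    "\<And>f. f \<in> hset E \<Longrightarrow> (f, hadd E x (hscale E z f)) \<in> T \<Longrightarrow> f = R x" if "x \<in> hset E" for x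
    using resolvent_spec[OF z that] unfolding R_def by blast+
  obtain C where C: "\<And>f f'. (f, f') \<in> T \<Longrightarrow> hnorm E f \<le> C * hnorm E (hdiff E f' (hscale E z f))"
    using z unfolding resolvent_set_def by blast
  have Rnorm: "hnorm E (R x) \<le> C * hnorm E x" if x: "x \<in> hset E" for x
  proof -
    have "hdiff E (hadd E x (hscale E z (R x))) (hscale E z (R x)) = x"
      by (rule ip_ext) (simp_all add: ips x R(1))
    then show ?thesis using C[OF R(2)[OF x]] by simp
  qed
  have Radd: "R (hadd E x y) = hadd E (R x) (R y)" if xy: "x \<in> hset E" "y \<in> hset E" for x y
  proof (rule R(3)[symmetric])
    have "hadd E (hadd E x y) (hscale E z (hadd E (R x) (R y)))
       = hadd E (hadd E x (hscale E z (R x))) (hadd E y (hscale E z (R y)))"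
      by (rule ip_ext) (simp_all add: ips xy R(1) algebra_simps)
    then show "(hadd E (R x) (R y), hadd E (hadd E x y) (hscale E z (hadd E (R x) (R y)))) \<in> T"
      using Tadd[OF R(2)[OF xy(1)] R(2)[OF xy(2)]] by simp
  qed (simp_all add: ips xy R(1))
  have Rscale: "R (hscale E a x) = hscale E a (R x)" if x: "x \<in> hset E" for x a
  proof (rule R(3)[symmetric])
    have "hadd E (hscale E a x) (hscale E z (hscale E a (R x))) = hscale E a (hadd E x (hscale E z (R x)))"
      by (rule ip_ext) (simp_all add: ips x R(1) algebra_simps)
    then show "(hscale E a (R x), hadd E (hscale E a x) (hscale E z (hscale E a (R x)))) \<in> T"
      using Tscale[OF R(2)[OF x]] by simp
  qed (simp_all add: ips x R(1))
  have unique: "hip E x f = hip E (R x) g"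
    if "f \<in> hset E" "(f, hadd E g (hscale E (cnj z) f)) \<in> T" "x \<in> hset E" for f x
    using Tsym[OF R(2)[OF that(3)] that(2)] that g by (simp add: ips R(1))
  obtain f where f: "f \<in> hset E" "\<And>x. x \<in> hset E \<Longrightarrow> hip E g (R x) = hip E f x"
  proof (rule riesz[OF closed_subspace_whole, of "\<lambda>x. hip E g (R x)" "hnorm E g * C"])
    fix x assume x: "x \<in> hset E"
    have "cmod (hip E g (R x)) \<le> hnorm E g * hnorm E (R x)" by (rule cauchy_schwarz[OF g R(1)[OF x]])
    also have "\<dots> \<le> hnorm E g * (C * hnorm E x)" by (intro mult_left_mono Rnorm x norm_nonneg g)
    finally show "cmod (hip E g (R x)) \<le> hnorm E g * C * hnorm E x" by (simp add: mult.assoc)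
  qed (simp_all add: Radd Rscale ips R(1) g)
  have fT: "(f, hadd E g (hscale E (cnj z) f)) \<in> T"
    unfolding Tadj
  proof (intro conjI ballI, goal_cases)
    case (3 p)
    obtain h h' where p: "p = (h, h')" by (cases p)
    have h: "h \<in> hset E" "h' \<in> hset E" using TE 3 p by auto
    \<comment> \<open>Every pair (h, h') of T arises from the resolvent with data x = h' - z h, so
      the defining property of f on the range of R reaches all of T.\<close>
    define x where "x = hdiff E h' (hscale E z h)"
    have x: "x \<in> hset E" by (simp add: x_def closed h)
    have "hadd E x (hscale E z h) = h'" by (rule ip_ext) (simp_all add: ips h x_def)
    then have "h = R x" using R(3)[OF x h(1)] 3 p by simp
    then have "hip E x f = hip E h g" using f(2)[OF x] x f(1) g h(1)
      using ip_cnj[of f x] ip_cnj[of g h] by (metis \<open>h = R x\<close>)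
    then show ?case unfolding p using h f(1) g by (simp add: x_def ips algebra_simps)
  qed (simp_all add: f g closed)
  have eq: "resolvent E T (cnj z) g = f"
    unfolding resolvent_def
  proof (rule the_equality)
    fix f' assume f': "f' \<in> hset E \<and> (f', hadd E g (hscale E (cnj z) f')) \<in> T"
    show "f' = f"
      using f' f(1) unique[of f'] unique[OF f(1) fT] by (intro ip_ext2) auto
  qed (use f fT in auto)
  show "resolvent E T (cnj z) g \<in> hset E"
    "(resolvent E T (cnj z) g, hadd E g (hscale E (cnj z) (resolvent E T (cnj z) g))) \<in> T"
    "\<And>x. x \<in> hset E \<Longrightarrow> hip E (resolvent E T z x) g = hip E x (resolvent E T (cnj z) g)"
    unfolding eq using f(1) fT unique[OF f(1) fT] by (auto simp: R_def)
qed

text \<open>The compression exists by Riesz' theorem. Its pair lies in the adjoint of A because the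
  selfadjointness of \<open>At\<close>, tested on embedded pairs of A, involves the resolvent only
  through inner products with vectors of E, and these the compression reproduces. The values at
  \<open>cnj z\<close> are what the dual adjoint of a generalized resolvent requires.\<close>

lemma generalized_resolvent_spec:
  assumes ext: "selfadjoint_extension E A K \<iota> At" and AE: "A \<subseteq> hset E \<times> hset E"
    and z: "z \<in> resolvent_set K At"
  defines "R \<equiv> generalized_resolvent E K \<iota> At"
  shows "f \<in> hset E \<Longrightarrow> R z f \<in> hset E"
    "f \<in> hset E \<Longrightarrow> (R z f, hadd E f (hscale E z (R z f))) \<in> rel_adjoint E A"
    "f \<in> hset E \<Longrightarrow> R (cnj z) f \<in> hset E"
    "f \<in> hset E \<Longrightarrow> (R (cnj z) f, hadd E f (hscale E (cnj z) (R (cnj z) f))) \<in> rel_adjoint E A"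
    "f \<in> hset E \<Longrightarrow> x \<in> hset E \<Longrightarrow> hip E (R z f) x = hip E f (R (cnj z) x)"
proof -
  interpret K: complex_hilbert_space K using ext unfolding selfadjoint_extension_def by blast
  have sa: "rel_selfadjoint K At" and AAt: "\<And>f g. (f, g) \<in> A \<Longrightarrow> (\<iota> f, \<iota> g) \<in> At"
    and iota: "\<And>x. x \<in> hset E \<Longrightarrow> \<iota> x \<in> hset K"
      "\<And>x y. x \<in> hset E \<Longrightarrow> y \<in> hset E \<Longrightarrow> \<iota> (hadd E x y) = hadd K (\<iota> x) (\<iota> y)"
      "\<And>a x. x \<in> hset E \<Longrightarrow> \<iota> (hscale E a x) = hscale K a (\<iota> x)"
      "\<And>x y. x \<in> hset E \<Longrightarrow> y \<in> hset E \<Longrightarrow> hip K (\<iota> x) (\<iota> y) = hip E x y"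
    using ext unfolding selfadjoint_extension_def isometric_embedding_def by blast+
  have norm_iota: "hnorm K (\<iota> x) = hnorm E x" if "x \<in> hset E" for x using that by (simp add: hnorm_def iota)
  have comp: "\<exists>!h. h \<in> hset E \<and> (\<forall>e\<in>hset E. hip E h e = hip K k (\<iota> e))" if k: "k \<in> hset K" for k
  proof -
    obtain h where h: "h \<in> hset E" "\<And>x. x \<in> hset E \<Longrightarrow> hip K k (\<iota> x) = hip E h x"
    proof (rule riesz[OF closed_subspace_whole, of "\<lambda>e. hip K k (\<iota> e)" "hnorm K k"])
      show "cmod (hip K k (\<iota> x)) \<le> hnorm K k * hnorm E x" if "x \<in> hset E" for x
        using K.cauchy_schwarz[OF k iota(1)[OF that]] by (simp add: norm_iota that)
    qed (simp_all add: iota K.ips k)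
    then show ?thesis by (intro ex1I[of _ h]) (auto intro: ip_ext)
  qed
  have Rg: "R w g \<in> hset E \<and> (R w g, hadd E g (hscale E w (R w g))) \<in> rel_adjoint E A
      \<and> (\<forall>e\<in>hset E. hip E (R w g) e = hip K (resolvent K At w (\<iota> g)) (\<iota> e))"
    if g: "g \<in> hset E" and k: "resolvent K At w (\<iota> g) \<in> hset K"
      "(resolvent K At w (\<iota> g), hadd K (\<iota> g) (hscale K w (resolvent K At w (\<iota> g)))) \<in> At" for w g
  proof -
    let ?k = "resolvent K At w (\<iota> g)"
    have h: "R w g \<in> hset E" "\<And>e. e \<in> hset E \<Longrightarrow> hip E (R w g) e = hip K ?k (\<iota> e)"
      using theI'[OF comp[OF k(1)]] unfolding R_def generalized_resolvent_def by blast+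
    have "(R w g, hadd E g (hscale E w (R w g))) \<in> rel_adjoint E A"
      unfolding rel_adjoint_def
    proof (clarsimp simp: h g closed)
      fix f f' assume ff: "(f, f') \<in> A"
      then have m: "f \<in> hset E" "f' \<in> hset E" using AE by auto
      have kk: "(?k, hadd K (\<iota> g) (hscale K w ?k)) \<in> rel_adjoint K At"
        using k(2) sa unfolding rel_selfadjoint_def by simp
      have "hip K (\<iota> f') ?k = hip K (\<iota> f) (hadd K (\<iota> g) (hscale K w ?k))"
        using kk AAt[OF ff] unfolding rel_adjoint_def by auto
      then have "hip K (\<iota> f') ?k = hip E f g + cnj w * hip K (\<iota> f) ?k"
        using m g k(1) by (simp add: K.ips iota)
      moreover have "hip K (\<iota> e) ?k = hip E e (R w g)" if "e \<in> hset E" for e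
        using h(2)[OF that] ip_cnj[OF h(1) that] K.ip_cnj[OF k(1) iota(1)[OF that]] by simp
      ultimately show "hip E f' (R w g) = hip E f (hadd E g (hscale E w (R w g)))"
        using m g h(1) by (simp add: ips)
    qed
    with h show ?thesis by blast
  qed
  note 1 = Rg[OF _ K.resolvent_spec(1,2)[OF z]]
  note 2 = Rg[OF _ K.resolvent_cnj(1,2)[OF sa z]]
  show "f \<in> hset E \<Longrightarrow> R z f \<in> hset E"
    "f \<in> hset E \<Longrightarrow> (R z f, hadd E f (hscale E z (R z f))) \<in> rel_adjoint E A"
    "f \<in> hset E \<Longrightarrow> R (cnj z) f \<in> hset E"
    "f \<in> hset E \<Longrightarrow> (R (cnj z) f, hadd E f (hscale E (cnj z) (R (cnj z) f))) \<in> rel_adjoint E A"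
    using 1[of f] 2[of f] iota by blast+
  assume fx: "f \<in> hset E" "x \<in> hset E"
  have "hip E (R z f) x = hip K (resolvent K At z (\<iota> f)) (\<iota> x)" using 1[of f] fx iota by blast
  also have "\<dots> = hip K (\<iota> f) (resolvent K At (cnj z) (\<iota> x))"
    by (rule K.resolvent_cnj(3)[OF sa z]) (simp_all add: iota fx)
  also have "\<dots> = cnj (hip K (resolvent K At (cnj z) (\<iota> x)) (\<iota> f))"
    by (rule K.ip_cnj) (simp_all add: iota fx K.resolvent_cnj(1)[OF sa z])
  also have "hip K (resolvent K At (cnj z) (\<iota> x)) (\<iota> f) = hip E (R (cnj z) x) f"
    using 2[of x] fx iota by simp
  also have "cnj (hip E (R (cnj z) x) f) = hip E f (R (cnj z) x)"
    by (rule ip_cnj[symmetric]) (use 2[of x] fx iota in auto)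
  finally show "hip E (R z f) x = hip E f (R (cnj z) x)" .
qed

end

section \<open>The space of square-integrable functions with matrix weight\<close>

lemma measurable_vec_iff:
  fixes f :: "'a \<Rightarrow> complex^'n"
  shows "f \<in> borel_measurable M \<longleftrightarrow> (\<forall>i. (\<lambda>t. f t $ i) \<in> borel_measurable M)"
proof
  assume "f \<in> borel_measurable M"
  then show "\<forall>i. (\<lambda>t. f t $ i) \<in> borel_measurable M"
    by (intro allI borel_measurable_continuous_on[where f="\<lambda>x. x $ i" for i] continuous_intros)
next
  assume *: "\<forall>i. (\<lambda>t. f t $ i) \<in> borel_measurable M"
  have "bounded_linear (\<lambda>c::complex. axis i c :: complex^'n)" for i
    by (rule linear_conv_bounded_linear[THEN iffD1]) (simp add: linear_iff axis_def vec_eq_iff)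
  then have "(\<lambda>t. axis i (f t $ i) :: complex^'n) \<in> borel_measurable M" for i
    using * by (intro borel_measurable_continuous_on[where f="\<lambda>c. axis i c"] linear_continuous_on) auto
  then have "(\<lambda>t. \<Sum>i\<in>UNIV. axis i (f t $ i) :: complex^'n) \<in> borel_measurable M"
    by (intro borel_measurable_sum) auto
  moreover have "(\<Sum>i\<in>UNIV. axis i (f t $ i) :: complex^'n) = f t" for t
    by (simp add: vec_eq_iff axis_def if_distrib cong: if_cong)
  ultimately show "f \<in> borel_measurable M" by simp
qed

lemma measurable_smult: "f \<in> borel_measurable M \<Longrightarrow> (\<lambda>t. (a::complex) *s (f t :: complex^'n)) \<in> borel_measurable M"
  unfolding measurable_vec_iff by (simp add: vector_smult_component borel_measurable_times)

lemma measurable_matrix_vector: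
  fixes X :: "'a \<Rightarrow> complex^'n^'m"
  assumes "\<And>i j. (\<lambda>t. X t $ i $ j) \<in> borel_measurable M" "f \<in> borel_measurable M"
  shows "(\<lambda>t. X t *v f t) \<in> borel_measurable M"
  using assms unfolding measurable_vec_iff[of "\<lambda>t. X t *v f t"] measurable_vec_iff[of f]
  by (auto simp: matrix_vector_mult_def intro!: borel_measurable_sum borel_measurable_times)

lemma measurable_cvec_ip:
  assumes "f \<in> borel_measurable M" "g \<in> borel_measurable M"
  shows "(\<lambda>t. cvec_ip (f t) (g t)) \<in> borel_measurable M"
proof -
  have [measurable]: "(\<lambda>t. f t $ i) \<in> borel_measurable M" "(\<lambda>t. g t $ i) \<in> borel_measurable M" for i
    using assms unfolding measurable_vec_iff by auto
  have "(\<lambda>t. cnj (g t $ i)) \<in> borel_measurable M" for i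
    by (rule borel_measurable_continuous_on[where f=cnj]) (auto intro: continuous_intros)
  then show ?thesis unfolding cvec_ip_def by (intro borel_measurable_sum borel_measurable_times) auto
qed

text \<open>Serves Cramer's rule in the completeness proof, where measurability of a solution is
  read off from its formula.\<close>

lemma measurable_det:
  fixes X :: "'a \<Rightarrow> complex^'n^'n"
  assumes "\<And>i j. (\<lambda>t. X t $ i $ j) \<in> borel_measurable M"
  shows "(\<lambda>t. det (X t)) \<in> borel_measurable M"
  unfolding det_def using assms by (intro borel_measurable_sum borel_measurable_times borel_measurable_prod) auto

text \<open>A bound for the operator norm that is integrable along H directly from the integrability
  of the entries.\<close>

definition entry_norm :: "complex^'n^'m \<Rightarrow> real" where
  "entry_norm X = (\<Sum>i\<in>UNIV. \<Sum>j\<in>UNIV. cmod (X $ i $ j))"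

lemma entry_norm_nonneg: "0 \<le> entry_norm X"
  by (simp add: entry_norm_def sum_nonneg)

lemma norm_matrix_vector_le: "norm (X *v v) \<le> entry_norm X * norm v"
proof -
  have "norm (X *v v) \<le> (\<Sum>i\<in>UNIV. cmod ((X *v v) $ i))"
    unfolding norm_vec_def by (rule L2_set_le_sum) simp
  also have "\<dots> \<le> (\<Sum>i\<in>UNIV. \<Sum>j\<in>UNIV. cmod (X $ i $ j) * norm v)"
  proof (rule sum_mono)
    fix i
    have "cmod ((X *v v) $ i) \<le> (\<Sum>j\<in>UNIV. cmod (X $ i $ j * v $ j))"
      unfolding matrix_vector_mult_def by (simp add: norm_sum)
    also have "\<dots> \<le> (\<Sum>j\<in>UNIV. cmod (X $ i $ j) * norm v)"
      by (intro sum_mono) (simp add: norm_mult mult_left_mono Finite_Cartesian_Product.norm_nth_le)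
    finally show "cmod ((X *v v) $ i) \<le> (\<Sum>j\<in>UNIV. cmod (X $ i $ j) * norm v)" .
  qed
  also have "\<dots> = entry_norm X * norm v" by (simp add: entry_norm_def sum_distrib_right)
  finally show ?thesis .
qed

section \<open>Positive semidefinite quadratic forms\<close>

definition quad :: "complex^'n^'n \<Rightarrow> complex^'n \<Rightarrow> real" where
  "quad X v = Re (cvec_ip (X *v v) v)"

lemma quad_nonneg: "pos_semidef X \<Longrightarrow> 0 \<le> quad X v"
  by (simp add: pos_semidef_def quad_def)

lemma psd_herm: "pos_semidef X \<Longrightarrow> cvec_ip (X *v x) y = cvec_ip x (X *v y)"
  using cvec_ip_hadj[of X x y] by (simp add: pos_semidef_def)

lemma psd_swap: "pos_semidef X \<Longrightarrow> cvec_ip (X *v y) x = cnj (cvec_ip (X *v x) y)"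
  using psd_herm[of X x y] cvec_ip_cnj[of x "X *v y"] by simp

lemma quad_eq: "pos_semidef X \<Longrightarrow> cvec_ip (X *v v) v = of_real (quad X v)"
  using psd_swap[of X v v] by (simp add: quad_def complex_eq_iff)

lemma psd_cauchy_schwarz:
  assumes X: "pos_semidef X"
  shows "(cmod (cvec_ip (X *v x) y))\<^sup>2 \<le> quad X x * quad X y"
proof -
  define a where "a = cvec_ip (X *v x) y"
  have aa: "a * cnj a = of_real ((cmod a)\<^sup>2)" by (rule complex_norm_square[symmetric])
  have *: "0 \<le> quad X x - 2 * r * (cmod a)\<^sup>2 + r\<^sup>2 * (cmod a)\<^sup>2 * quad X y" for r :: real
  proof -
    define t where "t = - (of_real r * a)"
    have "cvec_ip (X *v (x + t *s y)) (x + t *s y)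
        = cvec_ip (X *v x) x + (cnj t * a + t * cnj a) + t * cnj t * cvec_ip (X *v y) y"
      using psd_swap[OF X, of y x]
      by (simp add: matrix_vector_right_distrib matrix_vector_smult cvec_ip_simps a_def algebra_simps)
    also have "cnj t * a + t * cnj a = of_real (- 2 * r * (cmod a)\<^sup>2)"
    proof -
      have "cnj t * a + t * cnj a = - (2 * of_real r * (a * cnj a))" by (simp add: t_def)
      then show ?thesis unfolding aa by simp
    qed
    also have "t * cnj t = of_real (r\<^sup>2 * (cmod a)\<^sup>2)"
    proof -
      have "t * cnj t = (of_real r)\<^sup>2 * (a * cnj a)" by (simp add: t_def power2_eq_square)
      then show ?thesis unfolding aa by simp
    qed
    finally have "quad X (x + t *s y) = Re (of_real (quad X x) + of_real (- 2 * r * (cmod a)\<^sup>2) + of_real (r\<^sup>2 * (cmod a)\<^sup>2) * of_real (quad X y))"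
      unfolding quad_eq[OF X] using of_real_eq_iff by (metis Re_complex_of_real)
    also have "\<dots> = quad X x - 2 * r * (cmod a)\<^sup>2 + r\<^sup>2 * (cmod a)\<^sup>2 * quad X y" by simp
    finally have "quad X (x + t *s y) = quad X x - 2 * r * (cmod a)\<^sup>2 + r\<^sup>2 * (cmod a)\<^sup>2 * quad X y" .
    then show ?thesis using quad_nonneg[OF X, of "x + t *s y"] by simp
  qed
  show ?thesis
  proof (cases "quad X y = 0")
    case True
    have "a = 0"
    proof (rule ccontr)
      assume "a \<noteq> 0"
      then have "(cmod a)\<^sup>2 > 0" by simp
      \<comment> \<open>This value of r would make the lower bound equal to -1.\<close>
      then show False using *[of "(quad X x + 1) / (2 * (cmod a)\<^sup>2)"] True by simp
    qed
    then show ?thesis using True by (simp add: a_def)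
  next
    case False
    then have p: "quad X y > 0" using quad_nonneg[OF X, of y] by simp
    \<comment> \<open>The value of r inserted here minimizes the quadratic bound.\<close>
    have "0 \<le> quad X x - (cmod a)\<^sup>2 / quad X y"
      using *[of "1 / quad X y"] p by (simp add: power2_eq_square)
    then show ?thesis using p by (simp add: a_def field_simps)
  qed
qed

text \<open>Cauchy-Schwarz for the form, applied to x and X x. This is why \<open>H f\<close> is
  integrable for every f of finite seminorm although f itself need not be: it is bounded by the
  geometric mean of two integrable functions.\<close>

lemma norm_psd_le:
  assumes X: "pos_semidef X"
  shows "(norm (X *v x))\<^sup>2 \<le> entry_norm X * quad X x"
proof (cases "X *v x = 0")
  case True then show ?thesis using mult_nonneg_nonneg[OF entry_norm_nonneg quad_nonneg[OF X]] by simp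
next
  case False
  let ?y = "X *v x"
  have "quad X ?y \<le> cmod (cvec_ip (X *v ?y) ?y)" by (simp add: quad_def complex_Re_le_cmod)
  also have "\<dots> \<le> norm (X *v ?y) * norm ?y" by (rule cmod_cvec_ip)
  also have "\<dots> \<le> (entry_norm X * norm ?y) * norm ?y" by (intro mult_right_mono norm_matrix_vector_le) simp
  finally have 1: "quad X ?y \<le> entry_norm X * (norm ?y)\<^sup>2" by (simp add: power2_eq_square)
  have "((norm ?y)\<^sup>2)\<^sup>2 = (cmod (cvec_ip (X *v x) ?y))\<^sup>2" by (simp add: cvec_ip_self norm_power)
  also have "\<dots> \<le> quad X x * quad X ?y" by (rule psd_cauchy_schwarz[OF X])
  also have "\<dots> \<le> quad X x * (entry_norm X * (norm ?y)\<^sup>2)" by (intro mult_left_mono 1 quad_nonneg X)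
  finally have "(norm ?y)\<^sup>2 * (norm ?y)\<^sup>2 \<le> (entry_norm X * quad X x) * (norm ?y)\<^sup>2"
    by (simp only: power2_eq_square ac_simps)
  then show ?thesis by (rule mult_right_le_imp_le) (use False in simp)
qed

lemma quad_le_norm: "quad X v \<le> norm (X *v v) * norm v"
  unfolding quad_def using complex_Re_le_cmod cmod_cvec_ip order_trans by blast

lemma quad_zero_iff: "pos_semidef X \<Longrightarrow> quad X v = 0 \<longleftrightarrow> X *v v = 0"
  using norm_psd_le[of X v] by (auto simp: quad_def)

lemma quad_add_le:
  assumes X: "pos_semidef X"
  shows "quad X (x + y) \<le> 2 * quad X x + 2 * quad X y"
proof -
  have "quad X (x + y) + quad X (x - y) = 2 * quad X x + 2 * quad X y"
    by (simp add: quad_def matrix_vector_right_distrib matrix_vector_mult_diff_distrib cvec_ip_simps)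
  then show ?thesis using quad_nonneg[OF X, of "x - y"] by linarith
qed

lemma quad_smult: "quad X (a *s x) = (cmod a)\<^sup>2 * quad X x"
proof -
  have "cvec_ip (X *v (a *s x)) (a *s x) = of_real ((cmod a)\<^sup>2) * cvec_ip (X *v x) x"
    by (simp add: matrix_vector_smult cvec_ip_simps cmod2)
  then show ?thesis by (simp add: quad_def)
qed

lemma cmod_form_le:
  assumes X: "pos_semidef X"
  shows "cmod (cvec_ip (X *v x) y) \<le> (quad X x + quad X y) / 2"
proof (rule power2_le_imp_le)
  have "(quad X x - quad X y)\<^sup>2 \<ge> 0" by simp
  then show "(cmod (cvec_ip (X *v x) y))\<^sup>2 \<le> ((quad X x + quad X y) / 2)\<^sup>2"
    using psd_cauchy_schwarz[OF X, of x y] by (simp add: power2_eq_square field_simps)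
qed (use quad_nonneg[OF X] in \<open>simp add: add_nonneg_nonneg\<close>)

text \<open>The inequality between arithmetic and geometric mean makes \<open>norm_psd_le\<close>
  linear in the two integrable quantities; the free weight \<open>e\<close> is later set to the
  seminorm of f.\<close>

lemma norm_psd_le_weighted:
  assumes X: "pos_semidef X" and e: "e > 0"
  shows "norm (X *v x) \<le> (e * entry_norm X + quad X x / e) / 2"
proof (rule power2_le_imp_le)
  have "(e * entry_norm X - quad X x / e)\<^sup>2 \<ge> 0" by simp
  then have "4 * (entry_norm X * quad X x) \<le> (e * entry_norm X + quad X x / e)\<^sup>2"
    using e by (simp add: power2_eq_square algebra_simps)
  then show "(norm (X *v x))\<^sup>2 \<le> ((e * entry_norm X + quad X x / e) / 2)\<^sup>2"
    using norm_psd_le[OF X, of x] by (simp add: power_divide)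
qed (use e quad_nonneg[OF X] entry_norm_nonneg[of X] in \<open>simp add: add_nonneg_nonneg\<close>)

text \<open>Regularization selects a solution of \<open>X a = y\<close> for singular \<open>X\<close> that depends measurably on \<open>X\<close> and \<open>y\<close>.\<close>

lemma psd_regularized_solution:
  assumes X: "pos_semidef X" and y: "y \<in> range ((*v) X)"
    and x: "\<And>n. X *v x n + e n *\<^sub>R x n = y" and e: "\<And>n. e n > 0" "e \<longlonglongrightarrow> 0"
  shows "convergent x" "X *v lim x = y"
proof -
  obtain x0 where x0: "y = X *v x0" using y by auto
  have sub: "span (range ((*v) X)) = range ((*v) X)"
    by (rule span_eq_iff[THEN iffD2, OF linear_subspace_image[OF _ subspace_UNIV]]) auto
  \<comment> \<open>Only the component of x0 in the range of X matters: the orthogonal component b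
    lies in the kernel because X is Hermitian.\<close>
  obtain a b where ab: "a \<in> range ((*v) X)" "\<And>w. w \<in> range ((*v) X) \<Longrightarrow> orthogonal b w" "x0 = a + b"
    using orthogonal_subspace_decomp_exists[of "range ((*v) X)" x0] unfolding sub by metis
  have "inner (X *v b) (X *v b) = inner b (X *v (X *v b))"
    unfolding Re_cvec_ip[symmetric] psd_herm[OF X] ..
  also have "\<dots> = 0" using ab(2)[of "X *v (X *v b)"] by (simp add: orthogonal_def)
  finally have "X *v b = 0" by simp
  then have ya: "y = X *v a" using ab x0 by (simp add: matrix_vector_right_distrib)
  obtain w where w: "a = X *v w" using ab by auto
  have bound: "norm (x n - a) \<le> 2 * e n * norm w" for n
  proof -
    \<comment> \<open>With a = X w, the shift by \<open>e n *\<^sub>R w\<close> cancels the term of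
      first order. What remains on the right is \<open>(e n)\<^sup>2 *\<^sub>R w\<close>, and
      coercivity with the small constant \<open>e n\<close> still gives convergence.\<close>
    define v where "v = x n - a + e n *\<^sub>R w"
    have eq: "X *v v + e n *\<^sub>R v = (e n)\<^sup>2 *\<^sub>R w"
      using x[of n] by (simp add: v_def ya w matrix_vector_right_distrib matrix_vector_mult_diff_distrib
          matrix_vector_scaleR algebra_simps power2_eq_square)
    have "e n * (norm v)\<^sup>2 \<le> quad X v + e n * (norm v)\<^sup>2" using quad_nonneg[OF X] by simp
    also have "\<dots> = Re (cvec_ip (X *v v + e n *\<^sub>R v) v)"
      by (simp add: quad_def cvec_ip_simps cvec_ip_self)
    also have "\<dots> = Re (cvec_ip ((e n)\<^sup>2 *\<^sub>R w) v)" by (simp add: eq)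
    also have "\<dots> \<le> norm ((e n)\<^sup>2 *\<^sub>R w) * norm v"
      using complex_Re_le_cmod cmod_cvec_ip order_trans by blast
    finally have "e n * (norm v)\<^sup>2 \<le> (e n)\<^sup>2 * norm w * norm v" by simp
    then have "norm v \<le> e n * norm w" using e(1)[of n] by (cases "v = 0") (auto simp: power2_eq_square)
    moreover have "norm (x n - a) \<le> norm v + e n * norm w"
      using norm_triangle_ineq4[of v "e n *\<^sub>R w"] e(1)[of n] by (simp add: v_def)
    ultimately show ?thesis by simp
  qed
  have "(\<lambda>n. x n - a) \<longlonglongrightarrow> 0"
  proof (rule Lim_null_comparison)
    show "\<forall>\<^sub>F n in sequentially. norm (x n - a) \<le> 2 * e n * norm w" using bound by simp
    show "(\<lambda>n. 2 * e n * norm w) \<longlonglongrightarrow> 0" using tendsto_mult[OF tendsto_mult[OF tendsto_const[of 2] e(2)] tendsto_const[of "norm w"]] by simp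
  qed
  then have "x \<longlonglongrightarrow> a" by (simp add: LIM_zero_iff)
  then show "convergent x" "X *v lim x = y" using ya by (auto simp: convergent_def dest: limI)
qed

lemma psd_regularized_invertible:
  assumes X: "pos_semidef X" and e: "e > 0"
  shows "det (X + mat (of_real e)) \<noteq> 0"
proof -
  have "x = 0" if "(X + mat (of_real e)) *v x = 0" for x
  proof -
    have "Re (cvec_ip ((X + mat (of_real e)) *v x) x) = quad X x + e * (norm x)\<^sup>2"
      by (simp add: matrix_vector_mult_add_rdistrib mat_mul cvec_ip_simps quad_def cvec_ip_self)
    then have "e * (norm x)\<^sup>2 \<le> 0" using quad_nonneg[OF X, of x] by (simp add: that)
    then show ?thesis using e by (simp add: mult_le_0_iff)
  qed
  then show ?thesis using invertible_iff_kernel invertible_det_nz by blast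
qed

section \<open>Square-integrable functions for a possibly singular weight\<close>

locale weight =
  fixes l :: real and H :: "real \<Rightarrow> complex^'p^'p"
  assumes H_int: "\<And>i j. integrable (lebesgue_on {0<..<l}) (\<lambda>t. H t $ i $ j)"
    and H_psd: "AE t in lebesgue_on {0<..<l}. pos_semidef (H t)"
begin

abbreviation "M \<equiv> lebesgue_on {0<..<l}"
abbreviation "LL \<equiv> L2_fun l H"
abbreviation "ip \<equiv> L2_ip l H"
abbreviation "cls \<equiv> L2_class l H"

lemma H_meas: "(\<lambda>t. H t $ i $ j) \<in> borel_measurable M"
  using H_int by (rule borel_measurable_integrable)

lemma entry_norm_int: "integrable M (\<lambda>t. entry_norm (H t))"
  unfolding entry_norm_def using H_int by (intro Bochner_Integration.integrable_sum integrable_norm)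

lemma form_meas: "f \<in> borel_measurable M \<Longrightarrow> g \<in> borel_measurable M \<Longrightarrow>
    (\<lambda>t. cvec_ip (H t *v f t) (g t)) \<in> borel_measurable M"
  by (intro measurable_cvec_ip measurable_matrix_vector H_meas)

lemma quad_meas: "f \<in> borel_measurable M \<Longrightarrow> (\<lambda>t. quad (H t) (f t)) \<in> borel_measurable M"
  unfolding quad_def using form_meas[of f f]
  by (intro borel_measurable_continuous_on[where f=Re]) (auto intro: continuous_intros)

lemma L2_iff: "f \<in> LL \<longleftrightarrow> f \<in> borel_measurable M \<and> integrable M (\<lambda>t. quad (H t) (f t))"
proof -
  have "integrable M (\<lambda>t. cvec_ip (H t *v f t) (f t)) \<longleftrightarrow> integrable M (\<lambda>t. quad (H t) (f t))"
    if "f \<in> borel_measurable M"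
  proof
    assume "integrable M (\<lambda>t. cvec_ip (H t *v f t) (f t))"
    then show "integrable M (\<lambda>t. quad (H t) (f t))" unfolding quad_def by (rule integrable_Re)
  next
    assume "integrable M (\<lambda>t. quad (H t) (f t))"
    then have "integrable M (\<lambda>t. complex_of_real (quad (H t) (f t)))" by (rule integrable_of_real)
    then show "integrable M (\<lambda>t. cvec_ip (H t *v f t) (f t))"
      by (rule integrable_cong_AE_imp[OF _ form_meas[OF that that]])
         (use H_psd in eventually_elim, simp add: quad_eq)
  qed
  then show ?thesis unfolding L2_fun_def by blast
qed

lemma L2_meas: "f \<in> LL \<Longrightarrow> f \<in> borel_measurable M" by (simp add: L2_iff)
lemma L2_quad: "f \<in> LL \<Longrightarrow> integrable M (\<lambda>t. quad (H t) (f t))" by (simp add: L2_iff)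

lemma L2_add: assumes "f \<in> LL" "g \<in> LL" shows "(\<lambda>t. f t + g t) \<in> LL"
  unfolding L2_iff
proof
  show m: "(\<lambda>t. f t + g t) \<in> borel_measurable M" using assms by (intro borel_measurable_add L2_meas)
  show "integrable M (\<lambda>t. quad (H t) (f t + g t))"
  proof (rule Bochner_Integration.integrable_bound)
    show "integrable M (\<lambda>t. 2 * quad (H t) (f t) + 2 * quad (H t) (g t))" using assms L2_quad by simp
    show "AE t in M. norm (quad (H t) (f t + g t)) \<le> norm (2 * quad (H t) (f t) + 2 * quad (H t) (g t))"
      using H_psd
    proof eventually_elim
      case (elim t)
      show ?case using quad_add_le[OF elim, of "f t" "g t"] quad_nonneg[OF elim, of "f t + g t"] by simp
    qed
  qed (rule quad_meas[OF m])
qed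

lemma L2_scale: assumes "f \<in> LL" shows "(\<lambda>t. a *s f t) \<in> LL"
  using assms unfolding L2_iff quad_smult by (auto intro: measurable_smult)

lemma L2_zero: "(\<lambda>t. 0) \<in> LL"
  by (simp add: L2_iff quad_def)

lemma L2_diff: assumes "f \<in> LL" "g \<in> LL" shows "(\<lambda>t. f t - g t) \<in> LL"
  using L2_add[OF assms(1) L2_scale[OF assms(2), of "-1"]] by simp

lemma L2_form_int:
  assumes "f \<in> LL" "g \<in> LL"
  shows "integrable M (\<lambda>t. cvec_ip (H t *v f t) (g t))"
proof (rule Bochner_Integration.integrable_bound)
  show "integrable M (\<lambda>t. (quad (H t) (f t) + quad (H t) (g t)) / 2)" using assms L2_quad by simp
  show "AE t in M. norm (cvec_ip (H t *v f t) (g t)) \<le> norm ((quad (H t) (f t) + quad (H t) (g t)) / 2)"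
    using H_psd
  proof eventually_elim
    case (elim t)
    show ?case unfolding real_norm_def by (rule order_trans[OF cmod_form_le[OF elim] abs_ge_self])
  qed
qed (intro form_meas L2_meas assms)

lemma L2_H_int:
  assumes "f \<in> LL"
  shows "integrable M (\<lambda>t. H t *v f t)"
proof (rule Bochner_Integration.integrable_bound)
  show "integrable M (\<lambda>t. (entry_norm (H t) + quad (H t) (f t)) / 2)" using assms L2_quad entry_norm_int by simp
  show "AE t in M. norm (H t *v f t) \<le> norm ((entry_norm (H t) + quad (H t) (f t)) / 2)"
    using H_psd
  proof eventually_elim
    case (elim t)
    have "norm (H t *v f t) \<le> (entry_norm (H t) + quad (H t) (f t)) / 2"
      using norm_psd_le_weighted[OF elim zero_less_one, of "f t"] by simp
    also have "\<dots> \<le> norm ((entry_norm (H t) + quad (H t) (f t)) / 2)" unfolding real_norm_def by (rule abs_ge_self)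
    finally show ?case .
  qed
qed (intro measurable_matrix_vector H_meas L2_meas assms)

lemma ip_add1: "f \<in> LL \<Longrightarrow> g \<in> LL \<Longrightarrow> h \<in> LL \<Longrightarrow> ip (\<lambda>t. f t + g t) h = ip f h + ip g h"
  unfolding L2_ip_def matrix_vector_right_distrib cvec_ip_add1
  by (intro Bochner_Integration.integral_add L2_form_int)

lemma ip_diff1: "f \<in> LL \<Longrightarrow> g \<in> LL \<Longrightarrow> h \<in> LL \<Longrightarrow> ip (\<lambda>t. f t - g t) h = ip f h - ip g h"
  unfolding L2_ip_def matrix_vector_mult_diff_distrib cvec_ip_diff1
  by (intro Bochner_Integration.integral_diff L2_form_int)

lemma ip_scale1: "ip (\<lambda>t. a *s f t) g = a * ip f g"
  unfolding L2_ip_def matrix_vector_smult cvec_ip_scale1 by simp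

lemma ip_swap: "f \<in> LL \<Longrightarrow> g \<in> LL \<Longrightarrow> ip g f = cnj (ip f g)"
proof -
  assume fg: "f \<in> LL" "g \<in> LL"
  have "ip g f = (LINT t|M. cnj (cvec_ip (H t *v f t) (g t)))"
    unfolding L2_ip_def
  proof (rule integral_cong_AE)
    show "(\<lambda>t. cnj (cvec_ip (H t *v f t) (g t))) \<in> borel_measurable M"
      by (rule borel_measurable_continuous_on[where f=cnj])
         (auto intro: continuous_intros form_meas L2_meas fg)
    show "AE t in M. cvec_ip (H t *v g t) (f t) = cnj (cvec_ip (H t *v f t) (g t))"
      using H_psd by eventually_elim (rule psd_swap)
  qed (intro form_meas L2_meas fg)
  also have "\<dots> = cnj (ip f g)" unfolding L2_ip_def by simp
  finally show ?thesis .
qed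

lemma ip_self: "f \<in> LL \<Longrightarrow> ip f f = of_real (LINT t|M. quad (H t) (f t))"
proof -
  assume f: "f \<in> LL"
  have "ip f f = (LINT t|M. complex_of_real (quad (H t) (f t)))"
    unfolding L2_ip_def
  proof (rule integral_cong_AE)
    show "(\<lambda>t. complex_of_real (quad (H t) (f t))) \<in> borel_measurable M"
      using quad_meas[OF L2_meas[OF f]] by simp
    show "AE t in M. cvec_ip (H t *v f t) (f t) = complex_of_real (quad (H t) (f t))"
      using H_psd by eventually_elim (rule quad_eq)
  qed (intro form_meas L2_meas f)
  then show ?thesis by simp
qed

lemma quad_integral_nonneg: "0 \<le> (LINT t|M. quad (H t) (f t))"
  by (rule integral_nonneg_AE) (use H_psd in eventually_elim, rule quad_nonneg)

text \<open>Functions of zero seminorm are those annihilated by H, not those vanishing almost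
  everywhere. From here on equality of classes is handled as equality of \<open>H f\<close> almost
  everywhere.\<close>

lemma ip_self_zero_iff: "f \<in> LL \<Longrightarrow> ip f f = 0 \<longleftrightarrow> (AE t in M. H t *v f t = 0)"
proof -
  assume f: "f \<in> LL"
  have "ip f f = 0 \<longleftrightarrow> (LINT t|M. quad (H t) (f t)) = 0" by (simp add: ip_self[OF f])
  also have "\<dots> \<longleftrightarrow> (AE t in M. quad (H t) (f t) = 0)"
    by (rule integral_nonneg_eq_0_iff_AE[OF L2_quad[OF f]]) (use H_psd in eventually_elim, rule quad_nonneg)
  also have "\<dots> \<longleftrightarrow> (AE t in M. H t *v f t = 0)"
    by (rule eventually_cong[OF H_psd]) (rule quad_zero_iff)
  finally show ?thesis .
qed

lemma ip_cong1:
  assumes "AE t in M. H t *v f t = H t *v f' t" "f \<in> LL" "f' \<in> LL" "g \<in> LL"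
  shows "ip f g = ip f' g"
  unfolding L2_ip_def
proof (rule integral_cong_AE)
  show "AE t in M. cvec_ip (H t *v f t) (g t) = cvec_ip (H t *v f' t) (g t)"
    using assms(1) by eventually_elim simp
qed (intro form_meas L2_meas assms)+

lemma rel_iff: "(f, g) \<in> L2_rel l H \<longleftrightarrow> f \<in> LL \<and> g \<in> LL \<and> (AE t in M. H t *v f t = H t *v g t)"
  unfolding L2_rel_def using ip_self_zero_iff[OF L2_diff]
  by (auto simp: matrix_vector_mult_diff_distrib)

lemma equiv_rel: "equiv LL (L2_rel l H)"
proof (rule equivI)
  show "L2_rel l H \<subseteq> LL \<times> LL" by (auto simp: rel_iff)
  show "refl_on LL (L2_rel l H)" by (auto simp: refl_on_def rel_iff)
  show "sym (L2_rel l H)" unfolding sym_def rel_iff by (auto elim: eventually_mono)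
  show "trans (L2_rel l H)"
    unfolding trans_def rel_iff
  proof (intro allI impI conjI, goal_cases)
    case (3 x y z)
    then have "AE t in M. H t *v x t = H t *v y t" "AE t in M. H t *v y t = H t *v z t" by auto
    then show ?case by eventually_elim simp
  qed auto
qed

lemma cls_eq_iff: "f \<in> LL \<Longrightarrow> g \<in> LL \<Longrightarrow> cls f = cls g \<longleftrightarrow> (AE t in M. H t *v f t = H t *v g t)"
  unfolding L2_class_def using eq_equiv_class_iff[OF equiv_rel, of f g] by (simp add: rel_iff)

lemma mem_cls: "g \<in> cls f \<longleftrightarrow> (f, g) \<in> L2_rel l H"
  by (simp add: L2_class_def)

lemma self_mem_cls: "f \<in> LL \<Longrightarrow> f \<in> cls f"
  by (simp add: mem_cls rel_iff)

lemma hset_L2H: "hset (L2H l H) = {cls f |f. f \<in> LL}"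
  by (auto simp: L2H_def quotient_def L2_class_def)

lemma cls_hset: "f \<in> LL \<Longrightarrow> cls f \<in> hset (L2H l H)"
  by (auto simp: hset_L2H)

lemma hset_mem:
  assumes "X \<in> hset (L2H l H)" "f \<in> X"
  shows "f \<in> LL" "X = cls f"
proof -
  obtain g where g: "g \<in> LL" "X = cls g" using assms(1) by (auto simp: hset_L2H)
  then have r: "(g, f) \<in> L2_rel l H" using assms(2) by (simp add: mem_cls)
  then show "f \<in> LL" by (simp add: rel_iff)
  then show "X = cls f" using g r cls_eq_iff[of g f] by (simp add: rel_iff)
qed

lemma rep_cls:
  assumes "f \<in> LL"
  shows "L2_rep (cls f) \<in> LL" "AE t in M. H t *v f t = H t *v L2_rep (cls f) t"
proof -
  have "L2_rep (cls f) \<in> cls f" unfolding L2_rep_def using self_mem_cls[OF assms]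
    by (rule someI[where P="\<lambda>g. g \<in> cls f"])
  then show "L2_rep (cls f) \<in> LL" "AE t in M. H t *v f t = H t *v L2_rep (cls f) t"
    by (auto simp: mem_cls rel_iff)
qed

lemma hzero_L2H: "hzero (L2H l H) = cls (\<lambda>t. 0)" by (simp add: L2H_def)

lemma hadd_L2H: "f \<in> LL \<Longrightarrow> g \<in> LL \<Longrightarrow> hadd (L2H l H) (cls f) (cls g) = cls (\<lambda>t. f t + g t)"
proof -
  assume fg: "f \<in> LL" "g \<in> LL"
  have "AE t in M. H t *v (L2_rep (cls f) t + L2_rep (cls g) t) = H t *v (f t + g t)"
    using rep_cls(2)[OF fg(1)] rep_cls(2)[OF fg(2)]
    by eventually_elim (simp add: matrix_vector_right_distrib)
  then show ?thesis unfolding L2H_def using fg by (simp add: cls_eq_iff L2_add rep_cls(1))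
qed

lemma hscale_L2H: "f \<in> LL \<Longrightarrow> hscale (L2H l H) a (cls f) = cls (\<lambda>t. a *s f t)"
proof -
  assume f: "f \<in> LL"
  have "AE t in M. H t *v (a *s L2_rep (cls f) t) = H t *v (a *s f t)"
    using rep_cls(2)[OF f] by eventually_elim (simp add: matrix_vector_smult)
  then show ?thesis unfolding L2H_def using f by (simp add: cls_eq_iff L2_scale rep_cls(1))
qed

lemma hdiff_L2H: "f \<in> LL \<Longrightarrow> g \<in> LL \<Longrightarrow> hdiff (L2H l H) (cls f) (cls g) = cls (\<lambda>t. f t - g t)"
  using L2_scale[of g "-1"] unfolding hdiff_def by (simp add: hscale_L2H hadd_L2H)

lemma hip_L2H: "f \<in> LL \<Longrightarrow> g \<in> LL \<Longrightarrow> hip (L2H l H) (cls f) (cls g) = ip f g"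
proof -
  assume fg: "f \<in> LL" "g \<in> LL"
  note r = rep_cls[OF fg(1)] rep_cls[OF fg(2)]
  have "hip (L2H l H) (cls f) (cls g) = ip (L2_rep (cls f)) (L2_rep (cls g))" by (simp add: L2H_def)
  also have "\<dots> = ip f (L2_rep (cls g))" by (rule ip_cong1[symmetric]) (use r fg in auto)
  also have "\<dots> = cnj (ip (L2_rep (cls g)) f)" by (rule ip_swap) (use r fg in auto)
  also have "ip (L2_rep (cls g)) f = ip g f" by (rule ip_cong1[symmetric]) (use r fg in auto)
  also have "cnj (ip g f) = ip f g" by (rule ip_swap[symmetric]) (use fg in auto)
  finally show ?thesis .
qed

lemma hnorm_L2H: "f \<in> LL \<Longrightarrow> hnorm (L2H l H) (cls f) = sqrt (LINT t|M. quad (H t) (f t))"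
  by (simp add: hnorm_def hip_L2H ip_self)

text \<open>The weight in \<open>norm_psd_le_weighted\<close> is the seminorm n itself, which turns
  both terms into multiples of n. The constant is not sharp; what matters is the linear dependence
  on n.\<close>

lemma L1_bound:
  assumes f: "f \<in> LL"
  shows "(LINT t|M. norm (H t *v f t)) \<le> ((LINT t|M. entry_norm (H t)) + 1) / 2 * sqrt (LINT t|M. quad (H t) (f t))"
proof -
  define C where "C = (LINT t|M. entry_norm (H t))"
  define n where "n = sqrt (LINT t|M. quad (H t) (f t))"
  have nn: "n \<ge> 0" "(LINT t|M. quad (H t) (f t)) = n\<^sup>2" using quad_integral_nonneg by (auto simp: n_def)
  show ?thesis
  proof (cases "n = 0")
    case True
    then have "ip f f = 0" using ip_self[OF f] nn by simp
    then have "AE t in M. norm (H t *v f t) = 0" using ip_self_zero_iff[OF f] by simp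
    then have "(LINT t|M. norm (H t *v f t)) = 0" by (rule integral_eq_zero_AE)
    then show ?thesis using True by (simp add: n_def)
  next
    case False
    with nn have n: "n > 0" by simp
    have "(LINT t|M. norm (H t *v f t)) \<le> (LINT t|M. (n * entry_norm (H t) + quad (H t) (f t) / n) / 2)"
    proof (rule integral_mono_AE)
      show "integrable M (\<lambda>t. norm (H t *v f t))" by (intro integrable_norm L2_H_int f)
      show "integrable M (\<lambda>t. (n * entry_norm (H t) + quad (H t) (f t) / n) / 2)"
        using entry_norm_int L2_quad[OF f] by simp
      show "AE t in M. norm (H t *v f t) \<le> (n * entry_norm (H t) + quad (H t) (f t) / n) / 2"
        using H_psd by eventually_elim (rule norm_psd_le_weighted[OF _ n])
    qed
    also have "\<dots> = (n * C + n\<^sup>2 / n) / 2"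
      using entry_norm_int L2_quad[OF f] nn by (simp add: C_def)
    also have "\<dots> = (C + 1) / 2 * n" using n by (simp add: power2_eq_square field_simps)
    finally show ?thesis by (simp add: C_def n_def)
  qed
qed

lemma L2_bounded:
  assumes "f \<in> borel_measurable M" "\<And>t. t \<in> {0<..<l} \<Longrightarrow> norm (f t) \<le> B"
  shows "f \<in> LL"
  unfolding L2_iff
proof
  show "integrable M (\<lambda>t. quad (H t) (f t))"
  proof (rule Bochner_Integration.integrable_bound)
    show "integrable M (\<lambda>t. entry_norm (H t) * B\<^sup>2)" using entry_norm_int by simp
    show "AE t in M. norm (quad (H t) (f t)) \<le> norm (entry_norm (H t) * B\<^sup>2)"
      using H_psd AE_space
    proof eventually_elim
      case (elim t)
      have "quad (H t) (f t) \<le> norm (H t *v f t) * norm (f t)" by (rule quad_le_norm)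
      also have "\<dots> \<le> (entry_norm (H t) * norm (f t)) * norm (f t)"
        by (intro mult_right_mono norm_matrix_vector_le) simp
      also have "\<dots> = entry_norm (H t) * (norm (f t))\<^sup>2" by (simp add: power2_eq_square)
      also have "\<dots> \<le> entry_norm (H t) * B\<^sup>2"
        using assms(2)[of t] elim by (intro mult_left_mono power_mono entry_norm_nonneg) auto
      finally show ?case using quad_nonneg[OF elim(1), of "f t"] by simp
    qed
  qed (rule quad_meas[OF assms(1)])
qed (rule assms(1))

lemma L2_continuous:
  assumes "continuous_on {0..l} f"
  shows "f \<in> LL"
proof -
  have "bounded (f ` {0..l})" using assms by (intro compact_imp_bounded compact_continuous_image) auto
  then obtain B where "\<forall>x\<in>f ` {0..l}. norm x \<le> B" unfolding bounded_iff by blast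
  then have B: "\<And>t. t \<in> {0..l} \<Longrightarrow> norm (f t) \<le> B" by blast
  show ?thesis
  proof (rule L2_bounded)
    show "f \<in> borel_measurable M"
      by (rule continuous_imp_measurable_on_sets_lebesgue) (auto intro: continuous_on_subset[OF assms])
    show "norm (f t) \<le> B" if "t \<in> {0<..<l}" for t using B that by auto
  qed
qed

text \<open>As H(t) may be singular, the given representatives need not converge pointwise, even
  along a subsequence. What does converge is \<open>H s\<close>: in mean by \<open>L1_bound\<close>,
  hence almost everywhere along a subsequence. Its limit y lies in the range of H(t), the
  regularized systems produce a measurable f with H f = y, and Fatou's lemma bounds the seminorm of
  the differences.\<close>

lemma L2_complete:
  assumes s: "\<And>n. s n \<in> LL"
    and cauchy: "\<And>e. e > 0 \<Longrightarrow> \<exists>N. \<forall>m\<ge>N. \<forall>n\<ge>N. (LINT t|M. quad (H t) (s m t - s n t)) < e"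
  shows "\<exists>f\<in>LL. (\<lambda>n. LINT t|M. quad (H t) (s n t - f t)) \<longlonglongrightarrow> 0"
proof -
  have "\<exists>N. \<forall>i\<ge>N. \<forall>j\<ge>N. (LINT t|M. norm (H t *v s i t - H t *v s j t)) < e" if "e > 0" for e
  proof -
    define C where "C = ((LINT t|M. entry_norm (H t)) + 1) / 2"
    have "0 \<le> (LINT t|M. entry_norm (H t))"
      by (rule Bochner_Integration.integral_nonneg) (rule entry_norm_nonneg)
    then have "C > 0" by (simp add: C_def)
    \<comment> \<open>The hypothesis controls the squared seminorm, while \<open>L1_bound\<close>
      has the constant C in front of its root.\<close>
    then have "(e / C)\<^sup>2 > 0" using that by simp
    then obtain N where N: "\<And>m n. m \<ge> N \<Longrightarrow> n \<ge> N \<Longrightarrow> (LINT t|M. quad (H t) (s m t - s n t)) < (e / C)\<^sup>2"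
      using cauchy by blast
    have "(LINT t|M. norm (H t *v s i t - H t *v s j t)) < e" if "i \<ge> N" "j \<ge> N" for i j
    proof -
      have "(LINT t|M. norm (H t *v s i t - H t *v s j t)) \<le> C * sqrt (LINT t|M. quad (H t) (s i t - s j t))"
        using L1_bound[OF L2_diff[OF s s, of i j]] by (simp add: C_def matrix_vector_mult_diff_distrib)
      also have "sqrt (LINT t|M. quad (H t) (s i t - s j t)) < e / C"
        using N[OF that] \<open>e > 0\<close> \<open>C > 0\<close> by (intro real_less_lsqrt) auto
      finally show ?thesis using \<open>C > 0\<close> by (simp add: mult.commute)
    qed
    then show ?thesis by blast
  qed
  then obtain r where r: "strict_mono r" "AE t in M. Cauchy (\<lambda>i. H t *v s (r i) t)"
    using cauchy_L1_AE_cauchy_subseq[of M "\<lambda>i t. H t *v s i t"] L2_H_int[OF s] by blast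
  define y where "y = (\<lambda>t. lim (\<lambda>i. H t *v s (r i) t))"
  have y_meas: "y \<in> borel_measurable M" unfolding y_def
    by (intro borel_measurable_lim_metric measurable_matrix_vector H_meas L2_meas s)
  have y_lim: "AE t in M. (\<lambda>i. H t *v s (r i) t) \<longlonglongrightarrow> y t"
    using r(2) by eventually_elim (simp add: y_def Cauchy_convergent_iff convergent_LIMSEQ_iff)
  define e where "e = (\<lambda>n. inverse (real (Suc n)))"
  \<comment> \<open>Cramer's formula for the system with matrix H(t) + e(n)I and right-hand side
    y(t): written with determinants, its solution is visibly measurable in t.\<close>
  define x where "x = (\<lambda>n t. \<chi> k. det (\<chi> i j. if j = k then y t $ i else (H t + mat (of_real (e n))) $ i $ j)
      / det (H t + mat (of_real (e n))))"
  define f where "f = (\<lambda>t. lim (\<lambda>n. x n t))"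
  have entry_meas: "(\<lambda>t. (H t + mat c) $ i $ j) \<in> borel_measurable M" for c i j
    using H_meas by simp
  have "x n \<in> borel_measurable M" for n
    unfolding measurable_vec_iff
  proof
    fix k
    have "(\<lambda>t. (\<chi> i j. if j = k then y t $ i else (H t + mat (of_real (e n))) $ i $ j) $ i $ j) \<in> borel_measurable M" for i j
      using y_meas[unfolded measurable_vec_iff] entry_meas by (cases "j = k") auto
    then show "(\<lambda>t. x n t $ k) \<in> borel_measurable M"
      unfolding x_def vec_lambda_beta
      by (intro borel_measurable_divide measurable_det entry_meas) auto
  qed
  then have f_meas: "f \<in> borel_measurable M" unfolding f_def by (rule borel_measurable_lim_metric)
  have Hf: "AE t in M. H t *v f t = y t"
    using H_psd y_lim
  proof eventually_elim
    case (elim t)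
    \<comment> \<open>A subspace of finite dimension is closed, so the pointwise limit of
      \<open>H s\<close> stays in the range.\<close>
    have "closed (range ((*v) (H t)))"
      by (intro closed_subspace linear_subspace_image subspace_UNIV) auto
    then have "y t \<in> range ((*v) (H t))"
      by (rule closed_sequentially[OF _ _ elim(2)]) auto
    moreover have "H t *v x n t + e n *\<^sub>R x n t = y t" for n
    proof -
      have "det (H t + mat (of_real (e n))) \<noteq> 0"
        by (rule psd_regularized_invertible[OF elim(1)]) (simp add: e_def)
      from cramer[OF this, of "x n t" "y t"] have "(H t + mat (of_real (e n))) *v x n t = y t"
        by (simp add: x_def)
      then show ?thesis by (simp add: matrix_vector_mult_add_rdistrib mat_mul vec_eq_iff scaleR_complex)
    qed
    ultimately show ?case unfolding f_def
      using psd_regularized_solution(2)[OF elim(1), of "y t" "\<lambda>n. x n t" e] LIMSEQ_inverse_real_of_nat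
      by (simp add: e_def)
  qed
  have key: "integrable M (\<lambda>t. quad (H t) (s n t - f t)) \<and> (LINT t|M. quad (H t) (s n t - f t)) \<le> b"
    if b: "b \<ge> 0" "\<And>m. m \<ge> m0 \<Longrightarrow> (LINT t|M. quad (H t) (s n t - s (r m) t)) \<le> b" for n b m0
  proof -
    \<comment> \<open>Cauchy-Schwarz lower bound for the integrand, to which Fatou applies; \<open>0 / 0 = 0\<close> is the right value.\<close>
    define v where "v = (\<lambda>m t. (cmod (cvec_ip (H t *v (s n t - s (r m) t)) (s n t - f t)))\<^sup>2 / quad (H t) (s n t - f t))"
    have d_meas: "(\<lambda>t. s n t - f t) \<in> borel_measurable M" using L2_meas[OF s] f_meas by (intro borel_measurable_diff)
    note q_meas = quad_meas[OF d_meas]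
    have v_meas: "v m \<in> borel_measurable M" for m
      unfolding v_def
      by (intro borel_measurable_divide borel_measurable_power q_meas
          measurable_compose[OF _ borel_measurable_norm] form_meas[OF L2_meas[OF L2_diff[OF s s]] d_meas])
    have "(\<integral>\<^sup>+t. ennreal (quad (H t) (s n t - f t)) \<partial>M) = (\<integral>\<^sup>+t. liminf (\<lambda>m. ennreal (v m t)) \<partial>M)"
    proof (rule nn_integral_cong_AE)
      show "AE t in M. ennreal (quad (H t) (s n t - f t)) = liminf (\<lambda>m. ennreal (v m t))"
        using H_psd y_lim Hf
      proof eventually_elim
        case (elim t)
        let ?d = "s n t - f t"
        have "(\<lambda>m. H t *v s n t - H t *v s (r m) t) \<longlonglongrightarrow> H t *v s n t - H t *v f t"
          using elim(2,3) by (intro tendsto_diff tendsto_const) auto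
        then have "(\<lambda>m. H t *v (s n t - s (r m) t)) \<longlonglongrightarrow> H t *v ?d"
          by (simp add: matrix_vector_mult_diff_distrib)
        then have "(\<lambda>m. cvec_ip (H t *v (s n t - s (r m) t)) ?d) \<longlonglongrightarrow> cvec_ip (H t *v ?d) ?d"
          by (rule bounded_bilinear.tendsto[OF bounded_bilinear_cvec_ip _ tendsto_const])
        then have "(\<lambda>m. (cmod (cvec_ip (H t *v (s n t - s (r m) t)) ?d))\<^sup>2) \<longlonglongrightarrow> (quad (H t) ?d)\<^sup>2"
          using tendsto_power[OF tendsto_norm, of _ _ _ 2] quad_eq[OF elim(1), of ?d] by fastforce
        then have "(\<lambda>m. v m t) \<longlonglongrightarrow> (quad (H t) ?d)\<^sup>2 / quad (H t) ?d"
          unfolding v_def by (cases "quad (H t) ?d = 0") (auto intro: tendsto_divide tendsto_const)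
        also have "(quad (H t) ?d)\<^sup>2 / quad (H t) ?d = quad (H t) ?d" by (simp add: power2_eq_square)
        finally have "(\<lambda>m. ennreal (v m t)) \<longlonglongrightarrow> ennreal (quad (H t) ?d)" by (rule tendsto_ennrealI)
        then show ?case by (simp add: lim_imp_Liminf)
      qed
    qed
    also have "\<dots> \<le> liminf (\<lambda>m. \<integral>\<^sup>+t. ennreal (v m t) \<partial>M)"
      by (rule nn_integral_liminf) (use v_meas in simp)
    also have "\<dots> \<le> liminf (\<lambda>m. ennreal b)"
    proof (rule Liminf_mono, rule eventually_sequentiallyI[of m0])
      fix m assume m: "m \<ge> m0"
      have "(\<integral>\<^sup>+t. ennreal (v m t) \<partial>M) \<le> (\<integral>\<^sup>+t. ennreal (quad (H t) (s n t - s (r m) t)) \<partial>M)"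
      proof (rule nn_integral_mono_AE)
        show "AE t in M. ennreal (v m t) \<le> ennreal (quad (H t) (s n t - s (r m) t))"
          using H_psd
        proof eventually_elim
          case (elim t)
          show ?case
            using psd_cauchy_schwarz[OF elim, of "s n t - s (r m) t" "s n t - f t"]
              quad_nonneg[OF elim, of "s n t - f t"] quad_nonneg[OF elim, of "s n t - s (r m) t"]
            unfolding v_def by (intro ennreal_leI) (auto simp: divide_le_eq)
        qed
      qed
      also have "\<dots> = ennreal (LINT t|M. quad (H t) (s n t - s (r m) t))"
        by (rule nn_integral_eq_integral[OF L2_quad[OF L2_diff[OF s s]]])
           (use H_psd in eventually_elim, rule quad_nonneg)
      also have "\<dots> \<le> ennreal b" by (rule ennreal_leI[OF b(2)[OF m]])
      finally show "(\<integral>\<^sup>+t. ennreal (v m t) \<partial>M) \<le> ennreal b" .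
    qed
    also have "\<dots> = ennreal b" by (simp add: Liminf_const)
    finally have le: "(\<integral>\<^sup>+t. ennreal (quad (H t) (s n t - f t)) \<partial>M) \<le> ennreal b" .
    have nn: "AE t in M. 0 \<le> quad (H t) (s n t - f t)" using H_psd by eventually_elim (rule quad_nonneg)
    have int: "integrable M (\<lambda>t. quad (H t) (s n t - f t))"
      by (rule integrableI_nonneg[OF q_meas nn]) (use le in \<open>auto intro: order_le_less_trans\<close>)
    then have "ennreal (LINT t|M. quad (H t) (s n t - f t)) \<le> ennreal b"
      using le nn_integral_eq_integral[OF int nn] by simp
    then show ?thesis using int b(1) by simp
  qed
  have tail: "\<exists>N. \<forall>n\<ge>N. integrable M (\<lambda>t. quad (H t) (s n t - f t)) \<and> (LINT t|M. quad (H t) (s n t - f t)) \<le> b" if "b > 0" for b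
  proof -
    obtain N where N: "\<And>m n. m \<ge> N \<Longrightarrow> n \<ge> N \<Longrightarrow> (LINT t|M. quad (H t) (s m t - s n t)) < b"
      using cauchy[OF \<open>b > 0\<close>] by blast
    have "(LINT t|M. quad (H t) (s n t - s (r m) t)) \<le> b" if "n \<ge> N" "m \<ge> N" for n m
      using N[of n "r m"] that seq_suble[OF r(1), of m] by (simp add: less_imp_le)
    then show ?thesis using key[of b N] \<open>b > 0\<close> by (meson less_imp_le)
  qed
  have "\<exists>n. integrable M (\<lambda>t. quad (H t) (s n t - f t))" using tail[of 1] by auto
  then obtain n where n: "integrable M (\<lambda>t. quad (H t) (s n t - f t))" ..
  \<comment> \<open>Finite seminorm is known only for the difference; f is recovered as
    \<open>s n - (s n - f)\<close>.\<close>
  have "(\<lambda>t. s n t - f t) \<in> LL" unfolding L2_iff using n L2_meas[OF s] f_meas by auto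
  from L2_diff[OF s[of n] this] have fL: "f \<in> LL" by simp
  have "(\<lambda>n. LINT t|M. quad (H t) (s n t - f t)) \<longlonglongrightarrow> 0"
  proof (rule LIMSEQ_I)
    fix b :: real assume "b > 0"
    then obtain N where "\<forall>n\<ge>N. (LINT t|M. quad (H t) (s n t - f t)) \<le> b / 2" using tail[of "b/2"] by auto
    then have "norm ((LINT t|M. quad (H t) (s n t - f t)) - 0) < b" if "n \<ge> N" for n
      using that \<open>b > 0\<close> quad_integral_nonneg[of "\<lambda>t. s n t - f t"] by fastforce
    then show "\<exists>N. \<forall>n\<ge>N. norm ((LINT t|M. quad (H t) (s n t - f t)) - 0) < b" by blast
  qed
  with fL show ?thesis by blast
qed

lemma hilbert: "complex_hilbert_space (L2H l H)"
proof
  let ?E = "L2H l H"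
  note S = hzero_L2H hadd_L2H hscale_L2H hdiff_L2H hip_L2H
  note C = L2_add L2_scale L2_zero L2_diff cls_hset
  show "hzero ?E \<in> hset ?E" by (simp add: S C)
  fix x assume "x \<in> hset ?E"
  then obtain f where f: "f \<in> LL" "x = cls f" by (auto simp: hset_L2H)
  show "hscale ?E a x \<in> hset ?E" for a using f by (simp add: S C)
  show "hadd ?E (hzero ?E) x = x" using f by (simp add: S C)
  show "hdiff ?E x x = hzero ?E" using f by (simp add: S C)
  show "hscale ?E (a + b) x = hadd ?E (hscale ?E a x) (hscale ?E b x)" for a b
    using f by (simp add: S C vector_sadd_rdistrib)
  show "hscale ?E a (hscale ?E b x) = hscale ?E (a * b) x" for a b
    using f by (simp add: S C vector_smult_assoc)
  show "hscale ?E 1 x = x" using f by (simp add: S C)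
  show "0 \<le> Re (hip ?E x x)" using f quad_integral_nonneg by (simp add: S ip_self)
  show "x = hzero ?E" if "hip ?E x x = 0" using that f by (simp add: S C ip_self_zero_iff cls_eq_iff)
  fix y assume "y \<in> hset ?E"
  then obtain g where g: "g \<in> LL" "y = cls g" by (auto simp: hset_L2H)
  show "hadd ?E x y \<in> hset ?E" using f g by (simp add: S C)
  show "hadd ?E x y = hadd ?E y x" using f g by (simp add: S C add.commute)
  show "hscale ?E a (hadd ?E x y) = hadd ?E (hscale ?E a x) (hscale ?E a y)" for a
    using f g by (simp add: S C vector_add_ldistrib)
  show "hip ?E (hscale ?E a x) y = a * hip ?E x y" for a using f g by (simp add: S C ip_scale1)
  show "hip ?E y x = cnj (hip ?E x y)" using f g by (simp add: S ip_swap[of f g])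
  fix z assume "z \<in> hset ?E"
  then obtain h where h: "h \<in> LL" "z = cls h" by (auto simp: hset_L2H)
  show "hadd ?E (hadd ?E x y) z = hadd ?E x (hadd ?E y z)" using f g h by (simp add: S C add.assoc)
  show "hip ?E (hadd ?E x y) z = hip ?E x z + hip ?E y z" using f g h by (simp add: S C ip_add1)
next
  let ?E = "L2H l H"
  fix s :: "nat \<Rightarrow> (real \<Rightarrow> complex^'p) set"
  assume s: "\<And>n. s n \<in> hset ?E" and c: "\<forall>e>0. \<exists>N::nat. \<forall>m\<ge>N. \<forall>n\<ge>N. hnorm ?E (hdiff ?E (s m) (s n)) < e"
  have "\<exists>g. g \<in> LL \<and> s n = cls g" for n using s[of n] by (auto simp: hset_L2H)
  then obtain g where g: "\<And>n. g n \<in> LL" "\<And>n. s n = cls (g n)" by metis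
  have "\<exists>N. \<forall>m\<ge>N. \<forall>n\<ge>N. (LINT t|M. quad (H t) (g m t - g n t)) < e" if "e > 0" for e
  proof -
    obtain N where "\<forall>m\<ge>N. \<forall>n\<ge>N. hnorm ?E (hdiff ?E (s m) (s n)) < sqrt e" using c \<open>e > 0\<close> by (meson real_sqrt_gt_zero)
    then show ?thesis by (simp add: g hdiff_L2H hnorm_L2H L2_diff) blast
  qed
  from L2_complete[OF g(1) this] obtain f where f: "f \<in> LL" "(\<lambda>n. LINT t|M. quad (H t) (g n t - f t)) \<longlonglongrightarrow> 0" by blast
  have "(\<lambda>n. sqrt (LINT t|M. quad (H t) (g n t - f t))) \<longlonglongrightarrow> sqrt 0" by (intro tendsto_real_sqrt f)
  then show "\<exists>x\<in>hset ?E. (\<lambda>n. hnorm ?E (hdiff ?E (s n) x)) \<longlonglongrightarrow> 0"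
    using f(1) by (intro bexI[of _ "cls f"]) (simp_all add: g hdiff_L2H hnorm_L2H L2_diff cls_hset)
qed

end

section \<open>Canonical systems and the adjoint of the minimal relation\<close>

text \<open>The data enter the equation only through \<open>H g\<close>, so g may be exchanged
  within its class, whereas f may not.\<close>

lemma canonical_eq_cong:
  assumes "canonical_eq l J F H f g" "AE t in lebesgue_on {0<..<l}. H t *v g t = H t *v g' t"
  shows "canonical_eq l J F H f g'"
  unfolding canonical_eq_def
proof
  show "abs_continuous_on 0 l f" using assms(1) by (simp add: canonical_eq_def)
  from assms have "AE t in lebesgue_on {0<..<l}. \<exists>d. (f has_vector_derivative d) (at t) \<and> J *v d + F t *v f t = H t *v g t"
    by (simp add: canonical_eq_def)
  with assms(2) show "AE t in lebesgue_on {0<..<l}. \<exists>d. (f has_vector_derivative d) (at t) \<and> J *v d + F t *v f t = H t *v g' t"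
    by eventually_elim simp
qed

lemma canonical_eq_add:
  assumes "canonical_eq l J F H f g" "canonical_eq l J F H f' g'"
  shows "canonical_eq l J F H (\<lambda>t. f t + f' t) (\<lambda>t. g t + g' t)"
  unfolding canonical_eq_def
proof
  show "abs_continuous_on 0 l (\<lambda>t. f t + f' t)" using assms by (simp add: canonical_eq_def AC_add)
  from assms have "AE t in lebesgue_on {0<..<l}. \<exists>d. (f has_vector_derivative d) (at t) \<and> J *v d + F t *v f t = H t *v g t"
    "AE t in lebesgue_on {0<..<l}. \<exists>d. (f' has_vector_derivative d) (at t) \<and> J *v d + F t *v f' t = H t *v g' t"
    by (simp_all add: canonical_eq_def)
  then show "AE t in lebesgue_on {0<..<l}. \<exists>d. ((\<lambda>t. f t + f' t) has_vector_derivative d) (at t) \<and>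
      J *v d + F t *v (f t + f' t) = H t *v (g t + g' t)"
  proof eventually_elim
    case (elim t)
    then obtain d d' where d: "(f has_vector_derivative d) (at t)" "J *v d + F t *v f t = H t *v g t"
      "(f' has_vector_derivative d') (at t)" "J *v d' + F t *v f' t = H t *v g' t" by blast
    show ?case
    proof (intro exI conjI)
      show "((\<lambda>t. f t + f' t) has_vector_derivative d + d') (at t)" by (intro has_vector_derivative_add d)
      show "J *v (d + d') + F t *v (f t + f' t) = H t *v (g t + g' t)"
        unfolding matrix_vector_right_distrib d(2)[symmetric] d(4)[symmetric] by (simp add: add_ac)
    qed
  qed
qed

lemma bounded_linear_smult: "bounded_linear (\<lambda>x::complex^'n. (a::complex) *s x)"
  by (rule linear_conv_bounded_linear[THEN iffD1]) (simp add: linear_iff vec_eq_iff scaleR_complex algebra_simps)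

lemma canonical_eq_scale:
  assumes "canonical_eq l J F H f g"
  shows "canonical_eq l J F H (\<lambda>t. a *s f t) (\<lambda>t. a *s g t)"
  unfolding canonical_eq_def
proof
  show "abs_continuous_on 0 l (\<lambda>t. a *s f t)" using assms
    by (intro AC_linear[OF bounded_linear_smult]) (simp add: canonical_eq_def)
  from assms have "AE t in lebesgue_on {0<..<l}. \<exists>d. (f has_vector_derivative d) (at t) \<and> J *v d + F t *v f t = H t *v g t"
    by (simp add: canonical_eq_def)
  then show "AE t in lebesgue_on {0<..<l}. \<exists>d. ((\<lambda>t. a *s f t) has_vector_derivative d) (at t) \<and>
      J *v d + F t *v (a *s f t) = H t *v (a *s g t)"
  proof eventually_elim
    case (elim t)
    then obtain d where d: "(f has_vector_derivative d) (at t)" "J *v d + F t *v f t = H t *v g t" by blast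
    show ?case
    proof (intro exI conjI)
      show "((\<lambda>t. a *s f t) has_vector_derivative a *s d) (at t)"
        by (rule bounded_linear.has_vector_derivative[OF bounded_linear_smult d(1)])
      show "J *v (a *s d) + F t *v (a *s f t) = H t *v (a *s g t)"
        unfolding matrix_vector_smult d(2)[symmetric] by simp
    qed
  qed
qed

lemma canonical_eq_diff:
  assumes "canonical_eq l J F H f g" "canonical_eq l J F H f' g'"
  shows "canonical_eq l J F H (\<lambda>t. f t - f' t) (\<lambda>t. g t - g' t)"
  using canonical_eq_add[OF assms(1) canonical_eq_scale[OF assms(2), of "-1"]] by simp

section \<open>Lagrange's identity and variation of constants\<close>

locale canonical_system = weight l H for l and H :: "real \<Rightarrow> complex^'p^'p" +
  fixes J :: "complex^'p^'p" and F :: "real \<Rightarrow> complex^'p^'p" and U :: "real \<Rightarrow> complex \<Rightarrow> complex^'p^'p"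
  assumes l_pos: "0 < l"
    and JJ: "J ** J = - mat 1"
    and hadj_J: "hadj J = - J"
    and F_herm: "AE t in lebesgue_on {0<..<l}. hadj (F t) = F t"
    and A2: "condition_A2 l J F H"
    and U: "fundamental_matrix l J F H U"
begin

abbreviation "ceq \<equiv> canonical_eq l J F H"
abbreviation "E \<equiv> L2H l H"

sublocale E: complex_hilbert_space E by (rule hilbert)

lemma JJv: "J *v (J *v x) = - x"
  by (simp add: matrix_vector_mul_assoc JJ matrix_vector_minus)

lemma cvec_ip_J: "cvec_ip (J *v x) y = - cvec_ip x (J *v y)"
  by (simp add: cvec_ip_hadj hadj_J matrix_vector_minus cvec_ip_minus2)

lemma U0: "U 0 z = mat 1" using U by (simp add: fundamental_matrix_def)
lemma U_AC: "abs_continuous_on 0 l (\<lambda>t. U t z)" using U by (simp add: fundamental_matrix_def)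

lemma U_cont: "continuous_on {0..l} (\<lambda>t. U t z)" by (rule AC_continuous[OF U_AC])

lemma ceq_U: "ceq (\<lambda>t. U t z *v u) (\<lambda>t. z *s (U t z *v u))"
  unfolding canonical_eq_def
proof
  show "abs_continuous_on 0 l (\<lambda>t. U t z *v u)"
    by (rule AC_bilinear[OF bounded_bilinear_matrix_vector U_AC AC_const])
  have "AE t in M. \<exists>D. ((\<lambda>s. U s z) has_vector_derivative D) (at t) \<and> J ** D + F t ** U t z = mat z ** H t ** U t z"
    using U by (simp add: fundamental_matrix_def)
  then show "AE t in M. \<exists>d. ((\<lambda>t. U t z *v u) has_vector_derivative d) (at t) \<and>
      J *v d + F t *v (U t z *v u) = H t *v (z *s (U t z *v u))"
  proof eventually_elim
    case (elim t)
    then obtain D where D: "((\<lambda>s. U s z) has_vector_derivative D) (at t)"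
      "J ** D + F t ** U t z = mat z ** H t ** U t z" by blast
    have "((\<lambda>t. U t z *v u) has_vector_derivative D *v u) (at t)"
      using bounded_bilinear.has_vector_derivative[OF bounded_bilinear_matrix_vector D(1) has_vector_derivative_const[of u]]
      by simp
    moreover have "J *v (D *v u) + F t *v (U t z *v u) = (J ** D + F t ** U t z) *v u"
      by (simp add: matrix_vector_mult_add_rdistrib matrix_vector_mul_assoc)
    moreover have "\<dots> = H t *v (z *s (U t z *v u))"
      unfolding D(2) by (simp add: matrix_vector_mul_assoc[symmetric] mat_mul(2) matrix_vector_smult)
    ultimately show ?case by auto
  qed
qed

lemma ceq_cont: "ceq f g \<Longrightarrow> continuous_on {0..l} f"
  by (auto simp: canonical_eq_def intro: AC_continuous)

lemma ceq_L2: "ceq f g \<Longrightarrow> f \<in> LL"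
  by (intro L2_continuous ceq_cont)

lemma U_L2: "(\<lambda>t. U t z *v u) \<in> LL" by (rule ceq_L2[OF ceq_U])

text \<open>In the derivative of <J f, k>, skewness of J moves it onto k', the F terms cancel
  because F is Hermitian, and only the data remain. Intermediate endpoints t are kept because
  variation of constants needs the identity on every [0,t].\<close>

lemma lagrange:
  assumes f: "ceq f g" and k: "ceq k m" and t: "0 \<le> t" "t \<le> l"
  shows "((\<lambda>s. cvec_ip (H s *v g s) (k s) - cvec_ip (H s *v f s) (m s)) has_integral
     (cvec_ip (J *v f t) (k t) - cvec_ip (J *v f 0) (k 0))) {0..t}"
proof -
  let ?q = "\<lambda>s. cvec_ip (H s *v g s) (k s) - cvec_ip (H s *v f s) (m s)"
  have fd: "AE s in M. \<exists>d. (f has_vector_derivative d) (at s) \<and> J *v d + F s *v f s = H s *v g s"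
    and kd: "AE s in M. \<exists>d. (k has_vector_derivative d) (at s) \<and> J *v d + F s *v k s = H s *v m s"
    using f k by (auto simp: canonical_eq_def)
  have AC: "abs_continuous_on 0 l (\<lambda>s. cvec_ip (J *v f s) (k s))"
    using f k unfolding canonical_eq_def
    by (intro AC_bilinear[OF bounded_bilinear_cvec_ip] AC_bilinear[OF bounded_bilinear_matrix_vector] AC_const) auto
  have "AE s in M. ((\<lambda>s. cvec_ip (J *v f s) (k s)) has_vector_derivative ?q s) (at s)"
    using fd kd F_herm H_psd
  proof eventually_elim
    case (elim s)
    then obtain d d' where d: "(f has_vector_derivative d) (at s)" "J *v d + F s *v f s = H s *v g s"
      "(k has_vector_derivative d') (at s)" "J *v d' + F s *v k s = H s *v m s" by blast
    have Jf: "((\<lambda>s. J *v f s) has_vector_derivative J *v d) (at s)"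
      using bounded_bilinear.has_vector_derivative[OF bounded_bilinear_matrix_vector has_vector_derivative_const[of J] d(1)]
      by simp
    have "cvec_ip (J *v f s) d' + cvec_ip (J *v d) (k s) = ?q s"
    proof -
      have 1: "J *v d = H s *v g s - F s *v f s" "J *v d' = H s *v m s - F s *v k s"
        using d(2,4) by (simp_all add: eq_diff_eq)
      have "cvec_ip (F s *v f s) (k s) = cvec_ip (f s) (F s *v k s)"
        using cvec_ip_hadj[of "F s" "f s" "k s"] elim(3) by simp
      then show ?thesis unfolding cvec_ip_J[of "f s"] 1
        using psd_herm[OF elim(4), of "f s" "m s"] by (simp add: cvec_ip_simps)
    qed
    then show ?case
      using bounded_bilinear.has_vector_derivative[OF bounded_bilinear_cvec_ip Jf d(3)] by simp
  qed
  then have "AE s in lebesgue_on {0<..<t}. ((\<lambda>s. cvec_ip (J *v f s) (k s)) has_vector_derivative ?q s) (at s)"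
    using t by (subst (asm) AE_lebesgue_on_negligible, simp, subst AE_lebesgue_on_negligible, simp)
      (auto elim: negligible_subset)
  then show ?thesis
    by (intro ftc_AC[OF AC_subinterval[OF AC order_refl t(2)] t(1)])
qed

lemma integral_M:
  fixes q :: "real \<Rightarrow> 'b::euclidean_space"
  assumes "integrable M q" shows "(LINT t|M. q t) = integral {0..l} q" "q integrable_on {0..l}"
proof -
  have "q integrable_on {0<..<l}" by (rule integrable_on_lebesgue_on[OF assms]) simp
  then show "q integrable_on {0..l}" by (simp add: integrable_on_open_interval_real)
  have "(LINT t|M. q t) = integral {0<..<l} q" by (rule lebesgue_integral_eq_integral[OF assms]) simp
  then show "(LINT t|M. q t) = integral {0..l} q" by (simp add: integral_open_interval_real)
qed

lemma lagrange_ip: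
  assumes f: "ceq f g" and k: "ceq k m" and g: "g \<in> LL" and m: "m \<in> LL"
  shows "ip g k - ip f m = cvec_ip (J *v f l) (k l) - cvec_ip (J *v f 0) (k 0)"
proof -
  note L = ceq_L2[OF f] ceq_L2[OF k]
  note i = L2_form_int[OF g L(2)] L2_form_int[OF L(1) m]
  have "ip g k - ip f m = (LINT s|M. cvec_ip (H s *v g s) (k s) - cvec_ip (H s *v f s) (m s))"
    unfolding L2_ip_def by (rule Bochner_Integration.integral_diff[symmetric, OF i])
  also have "\<dots> = integral {0..l} (\<lambda>s. cvec_ip (H s *v g s) (k s) - cvec_ip (H s *v f s) (m s))"
    by (intro integral_M Bochner_Integration.integrable_diff i)
  also have "\<dots> = cvec_ip (J *v f l) (k l) - cvec_ip (J *v f 0) (k 0)"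
    using lagrange[OF f k _ order_refl] l_pos by (intro integral_unique) auto
  finally show ?thesis .
qed

text \<open>The difference has zero data and zero seminorm, so (A2) applies. Equality of the first
  classes alone would not suffice when the relation is multivalued.\<close>

lemma ceq_unique:
  assumes f: "ceq f g" and f': "ceq f' g'"
    and eq: "AE t in M. H t *v f t = H t *v f' t" "AE t in M. H t *v g t = H t *v g' t" and t: "t \<in> {0..l}"
  shows "f t = f' t"
proof -
  have "ceq (\<lambda>t. f t - f' t) (\<lambda>t. g t - g' t)" by (rule canonical_eq_diff[OF f f'])
  then have "ceq (\<lambda>t. f t - f' t) (\<lambda>t. 0)"
    by (rule canonical_eq_cong) (use eq(2) in eventually_elim, simp add: matrix_vector_mult_diff_distrib)
  moreover have "AE t in M. H t *v (f t - f' t) = 0"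
    using eq(1) by eventually_elim (simp add: matrix_vector_mult_diff_distrib)
  ultimately have "f t - f' t = 0" using A2 t unfolding condition_A2_def by blast
  then show ?thesis by simp
qed

text \<open>The parameters z and \<open>cnj z\<close> cancel in Lagrange's identity, so <J f, k> is
  constant along the two solutions.\<close>

lemma U_symplectic:
  assumes t: "t \<in> {0..l}"
  shows "hadj (U t (cnj z)) ** J ** U t z = J"
proof -
  have "(hadj (U t (cnj z)) ** J ** U t z) *v u = J *v u" for u
  proof (rule cvec_ip_eqI)
    fix w
    let ?f = "\<lambda>t. U t z *v u" and ?k = "\<lambda>t. U t (cnj z) *v w"
    have "((\<lambda>s. 0) has_integral (cvec_ip (J *v ?f t) (?k t) - cvec_ip (J *v ?f 0) (?k 0))) {0..t}"
      using lagrange[OF ceq_U[of z u] ceq_U[of "cnj z" w], of t] t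
      by (simp add: matrix_vector_smult cvec_ip_simps)
    then have "cvec_ip (J *v ?f t) (?k t) = cvec_ip (J *v u) w"
      using has_integral_unique[OF has_integral_0] by (fastforce simp: U0)
    then show "cvec_ip ((hadj (U t (cnj z)) ** J ** U t z) *v u) w = cvec_ip (J *v u) w"
      by (simp add: matrix_vector_mul_assoc[symmetric] cvec_ip_hadj)
  qed
  then show ?thesis by (simp add: matrix_eq)
qed

lemma U_inverse:
  assumes t: "t \<in> {0..l}"
  shows "U t z ** (- (J ** hadj (U t (cnj z)) ** J)) = mat 1"
proof -
  have "J ** (hadj (U t (cnj z)) ** J ** U t z) = - mat 1" by (simp add: U_symplectic[OF t] JJ)
  then have "(- (J ** hadj (U t (cnj z)) ** J)) ** U t z = mat 1"
    by (simp add: matrix_mul_minus matrix_mul_assoc)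
  then show ?thesis by (rule matrix_left_right_inverse1)
qed

text \<open>In finite dimension the left inverse supplied by \<open>U_symplectic\<close> is also a
  right inverse, which permits the opposite order of the factors.\<close>

lemma U_symplectic2:
  assumes t: "t \<in> {0..l}"
  shows "U t z ** J ** hadj (U t (cnj z)) = J"
proof -
  have "U t z ** (- (J ** hadj (U t (cnj z)) ** J)) ** J = J" using U_inverse[OF t] by simp
  moreover have "U t z ** (- (J ** hadj (U t (cnj z)) ** J)) ** J = - (U t z ** J ** hadj (U t (cnj z)) ** (J ** J))"
    by (simp add: matrix_mul_minus matrix_mul_assoc)
  ultimately show ?thesis by (simp add: JJ matrix_mul_minus)
qed

text \<open>The inverse of U(s,z) is -J times the adjoint of U(s, cnj z) times J. Up to a factor -J
  this is therefore the integrand of variation of constants; paired with w it yields the form of g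
  with the solution U(., cnj z)w.\<close>

definition weighted :: "complex \<Rightarrow> (real \<Rightarrow> complex^'p) \<Rightarrow> real \<Rightarrow> complex^'p" where
  "weighted z g s = hadj (U s (cnj z)) *v (H s *v g s)"

definition sol :: "complex \<Rightarrow> (real \<Rightarrow> complex^'p) \<Rightarrow> complex^'p \<Rightarrow> real \<Rightarrow> complex^'p" where
  "sol z g c t = U t z *v (c - J *v integral {0..t} (weighted z g))"

lemma U_bound: "\<exists>B\<ge>0. \<forall>t\<in>{0..l}. \<forall>v. norm (U t z *v v) \<le> B * norm v \<and> norm (hadj (U t z) *v v) \<le> B * norm v"
proof -
  obtain K where K: "K > 0" "\<And>(X::complex^'p^'p) v. norm (X *v v) \<le> norm X * norm v * K"
    using bounded_bilinear.pos_bounded[OF bounded_bilinear_matrix_vector] by blast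
  obtain K' where K': "K' > 0" "\<And>X::complex^'p^'p. norm (hadj X) \<le> norm X * K'"
    using bounded_linear.pos_bounded[OF bounded_linear_hadj] by blast
  have "bounded ((\<lambda>t. U t z) ` {0..l})"
    by (intro compact_imp_bounded compact_continuous_image U_cont) auto
  then obtain B where "\<forall>x\<in>(\<lambda>t. U t z) ` {0..l}. norm x \<le> B" unfolding bounded_iff by blast
  then have B: "\<And>t. t \<in> {0..l} \<Longrightarrow> norm (U t z) \<le> B" by blast
  have B0: "B \<ge> 0" using order_trans[OF norm_ge_zero B[of 0]] l_pos by simp
  show ?thesis
  \<comment> \<open>The sum of a constant for U and one for its adjoint serves for both.\<close>
  proof (intro exI[of _ "B * K + B * K' * K"] conjI ballI allI)
    show "0 \<le> B * K + B * K' * K" using B0 K K' by simp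
    fix t v assume t: "t \<in> {0..l}"
    have "norm (U t z *v v) \<le> norm (U t z) * norm v * K" by (rule K)
    also have "\<dots> \<le> B * norm v * K" using B[OF t] K(1) by (intro mult_right_mono) auto
    also have "\<dots> \<le> (B * K + B * K' * K) * norm v" using B0 K K' by (simp add: algebra_simps)
    finally show "norm (U t z *v v) \<le> (B * K + B * K' * K) * norm v" .
    have "norm (hadj (U t z) *v v) \<le> norm (hadj (U t z)) * norm v * K" by (rule K)
    also have "\<dots> \<le> (norm (U t z) * K') * norm v * K" using K'(2) K(1) by (intro mult_right_mono) auto
    also have "\<dots> \<le> (B * K') * norm v * K" using B[OF t] K(1) K'(1) by (intro mult_right_mono) auto
    also have "\<dots> \<le> (B * K + B * K' * K) * norm v" using B0 K K' by (simp add: algebra_simps)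
    finally show "norm (hadj (U t z) *v v) \<le> (B * K + B * K' * K) * norm v" .
  qed
qed

lemma weighted_int:
  assumes g: "g \<in> LL"
  shows "integrable M (weighted z g)"
proof -
  obtain B where B: "B \<ge> 0" "\<And>t v. t \<in> {0..l} \<Longrightarrow> norm (hadj (U t (cnj z)) *v v) \<le> B * norm v"
    using U_bound[of "cnj z"] by blast
  have "continuous_on {0<..<l} (\<lambda>t. hadj (U t (cnj z)))"
    by (rule bounded_linear.continuous_on[OF bounded_linear_hadj continuous_on_subset[OF U_cont]]) auto
  then have m: "(\<lambda>t. hadj (U t (cnj z)) $ i $ j) \<in> borel_measurable M" for i j
    by (intro continuous_imp_measurable_on_sets_lebesgue continuous_on_vec_lambda continuous_intros) auto
  show ?thesis
  proof (rule Bochner_Integration.integrable_bound)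
    show "integrable M (\<lambda>s. B * norm (H s *v g s))" by (intro integrable_mult_right integrable_norm L2_H_int g)
    show "weighted z g \<in> borel_measurable M" unfolding weighted_def
      by (intro measurable_matrix_vector m H_meas L2_meas g)
    show "AE s in M. norm (weighted z g s) \<le> norm (B * norm (H s *v g s))"
      using AE_space by eventually_elim (use B in \<open>auto simp: weighted_def\<close>)
  qed
qed

lemma weighted_on: "g \<in> LL \<Longrightarrow> t \<le> l \<Longrightarrow> weighted z g integrable_on {0..t}"
  by (rule integrable_on_subinterval[OF integral_M(2)[OF weighted_int]]) auto

lemma cvec_ip_weighted: "cvec_ip (weighted z g s) w = cvec_ip (H s *v g s) (U s (cnj z) *v w)"
  by (simp add: weighted_def cvec_ip_hadj)

lemma integral_weighted:
  assumes g: "g \<in> LL"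
  shows "cvec_ip (integral {0..l} (weighted z g)) w = ip g (\<lambda>t. U t (cnj z) *v w)"
proof -
  have "cvec_ip (integral {0..l} (weighted z g)) w = integral {0..l} (\<lambda>s. cvec_ip (weighted z g s) w)"
    by (rule integral_linear[OF weighted_on[OF g order_refl]
          bounded_bilinear.bounded_linear_left[OF bounded_bilinear_cvec_ip], unfolded o_def, symmetric])
  also have "\<dots> = ip g (\<lambda>t. U t (cnj z) *v w)"
    unfolding cvec_ip_weighted L2_ip_def
    by (rule integral_M(1)[symmetric, OF L2_form_int[OF g U_L2]])
  finally show ?thesis .
qed

lemma sol_0: "sol z g c 0 = c" by (simp add: sol_def U0)

lemma ceq_sol:
  assumes g: "g \<in> LL"
  shows "ceq (sol z g c) (\<lambda>t. z *s sol z g c t + g t)"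
  unfolding canonical_eq_def
proof
  let ?W = "\<lambda>t. integral {0..t} (weighted z g)"
  have AC_W: "abs_continuous_on 0 l ?W" by (rule AC_indefinite_integral[OF weighted_int[OF g]])
  show "abs_continuous_on 0 l (sol z g c)" unfolding sol_def
    by (intro AC_bilinear[OF bounded_bilinear_matrix_vector] U_AC AC_diff AC_const AC_W)
  have 1: "AE t in M. \<exists>D. ((\<lambda>s. U s z) has_vector_derivative D) (at t) \<and> J ** D + F t ** U t z = mat z ** H t ** U t z"
    using U by (simp add: fundamental_matrix_def)
  have 2: "AE t in M. (?W has_vector_derivative weighted z g t) (at t)"
    by (rule has_vector_derivative_indefinite_integral_AE[OF weighted_on[OF g order_refl]])
  have 3: "AE t in M. t \<in> {0<..<l}" by (rule AE_I2) simp
  show "AE t in M. \<exists>d. (sol z g c has_vector_derivative d) (at t) \<and>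
      J *v d + F t *v sol z g c t = H t *v (z *s sol z g c t + g t)"
    using 1 2 3
  proof eventually_elim
    case (elim t)
    then obtain D where D: "((\<lambda>s. U s z) has_vector_derivative D) (at t)"
      "J ** D + F t ** U t z = mat z ** H t ** U t z" by blast
    let ?c = "c - J *v ?W t"
    have JW: "((\<lambda>s. c - J *v ?W s) has_vector_derivative 0 - J *v weighted z g t) (at t)"
      using bounded_bilinear.has_vector_derivative[OF bounded_bilinear_matrix_vector has_vector_derivative_const[of J] elim(2)]
      by (intro has_vector_derivative_diff has_vector_derivative_const) simp
    have "((\<lambda>s. U s z *v (c - J *v ?W s)) has_vector_derivative
        U t z *v (0 - J *v weighted z g t) + D *v ?c) (at t)"
      by (rule bounded_bilinear.has_vector_derivative[OF bounded_bilinear_matrix_vector D(1) JW])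
    then have "(sol z g c has_vector_derivative U t z *v (0 - J *v weighted z g t) + D *v ?c) (at t)"
      unfolding sol_def .
    moreover have "J *v (U t z *v (0 - J *v weighted z g t) + D *v ?c) + F t *v sol z g c t
        = H t *v (z *s sol z g c t + g t)"
    proof -
      have "U t z *v (J *v weighted z g t) = J *v (H t *v g t)"
        using U_symplectic2[of t z] elim(3)
        by (simp add: weighted_def matrix_vector_mul_assoc matrix_mul_assoc)
      then have A: "J *v (U t z *v (0 - J *v weighted z g t)) = H t *v g t"
        by (simp add: matrix_vector_minus JJv)
      have "J *v (D *v ?c) + F t *v sol z g c t = (J ** D + F t ** U t z) *v ?c"
        by (simp add: sol_def matrix_vector_mult_add_rdistrib matrix_vector_mul_assoc)
      also have "\<dots> = H t *v (z *s sol z g c t)"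
        unfolding D(2) sol_def by (simp add: matrix_vector_mul_assoc[symmetric] mat_mul(2) matrix_vector_smult)
      finally have B: "J *v (D *v ?c) + F t *v sol z g c t = H t *v (z *s sol z g c t)" .
      show ?thesis unfolding matrix_vector_right_distrib add.assoc A B by (rule add.commute)
    qed
    ultimately show ?case by blast
  qed
qed

text \<open>Rather than differentiating the inverse of U, Lagrange's identity is applied to f and
  the solutions U(., cnj z)w; the symplectic identity then solves for f.\<close>

lemma sol_unique:
  assumes f: "ceq f m" and g: "g \<in> LL" and m: "AE t in M. H t *v m t = H t *v (z *s f t + g t)"
    and t: "t \<in> {0..l}"
  shows "f t = sol z g (f 0) t"
proof -
  have f': "ceq f (\<lambda>t. z *s f t + g t)" by (rule canonical_eq_cong[OF f m])
  have "hadj (U t (cnj z)) *v (J *v f t) = J *v f 0 + integral {0..t} (weighted z g)"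
  proof (rule cvec_ip_eqI)
    fix w
    let ?k = "\<lambda>t. U t (cnj z) *v w"
    have "((\<lambda>s. cvec_ip (H s *v g s) (?k s)) has_integral (cvec_ip (J *v f t) (?k t) - cvec_ip (J *v f 0) w)) {0..t}"
      using lagrange[OF f' ceq_U[of "cnj z" w], of t] t
      by (simp add: matrix_vector_smult matrix_vector_right_distrib cvec_ip_simps U0)
    then have "cvec_ip (J *v f t) (?k t) - cvec_ip (J *v f 0) w = integral {0..t} (\<lambda>s. cvec_ip (weighted z g s) w)"
      unfolding cvec_ip_weighted by (rule integral_unique[symmetric])
    also have "\<dots> = cvec_ip (integral {0..t} (weighted z g)) w"
      by (rule integral_linear[OF weighted_on[OF g]
          bounded_bilinear.bounded_linear_left[OF bounded_bilinear_cvec_ip], unfolded o_def]) (use t in simp)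
    finally show "cvec_ip (hadj (U t (cnj z)) *v (J *v f t)) w = cvec_ip (J *v f 0 + integral {0..t} (weighted z g)) w"
      by (simp add: cvec_ip_simps cvec_ip_hadj algebra_simps)
  qed
  then have "U t z *v (J *v (hadj (U t (cnj z)) *v (J *v f t))) = U t z *v (J *v (J *v f 0 + integral {0..t} (weighted z g)))"
    by simp
  moreover have "U t z *v (J *v (hadj (U t (cnj z)) *v (J *v f t))) = - f t"
    using U_symplectic2[OF t, of z] JJv[of "f t"] by (simp add: matrix_vector_mul_assoc matrix_mul_assoc)
  ultimately have "- f t = U t z *v (J *v (J *v f 0 + integral {0..t} (weighted z g)))" by (simp only:)
  then have "- (- f t) = - (U t z *v (J *v (J *v f 0 + integral {0..t} (weighted z g))))" by (rule arg_cong)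
  then have "f t = - (U t z *v (J *v (J *v f 0 + integral {0..t} (weighted z g))))" by (simp only: minus_minus)
  also have "\<dots> = U t z *v (- (J *v (J *v f 0 + integral {0..t} (weighted z g))))" by (simp add: matrix_vector_minus)
  also have "- (J *v (J *v f 0 + integral {0..t} (weighted z g))) = f 0 - J *v integral {0..t} (weighted z g)"
    by (simp add: matrix_vector_right_distrib JJv)
  finally show ?thesis by (simp add: sol_def)
qed

lemma sol_hom: "sol z (\<lambda>t. 0) c t = U t z *v c"
proof -
  have "weighted z (\<lambda>t. 0) = (\<lambda>s. 0)" by (simp add: weighted_def fun_eq_iff)
  then show ?thesis by (simp add: sol_def)
qed

lemma kernel_unique:
  assumes f: "ceq f m" and m: "AE t in M. H t *v m t = H t *v (z *s f t)" and t: "t \<in> {0..l}"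
  shows "f t = U t z *v f 0"
proof -
  have "AE t in M. H t *v m t = H t *v (z *s f t + 0)" using m by simp
  then show ?thesis using sol_unique[OF f L2_zero _ t] unfolding sol_hom by blast
qed

text \<open>\<open>L1_bound\<close> controls the integral of \<open>weighted\<close>, hence the
  solution uniformly in t, and a uniform bound controls the seminorm. No restriction on z arises,
  unlike for a resolvent.\<close>

lemma sol_bound: "\<exists>C\<ge>0. \<forall>g\<in>LL. sqrt (LINT t|M. quad (H t) (sol z g 0 t)) \<le> C * sqrt (LINT t|M. quad (H t) (g t))"
proof -
  obtain B1 where B1: "B1 \<ge> 0" "\<And>t v. t \<in> {0..l} \<Longrightarrow> norm (U t z *v v) \<le> B1 * norm v"
    using U_bound[of z] by blast
  obtain B2 where B2: "B2 \<ge> 0" "\<And>t v. t \<in> {0..l} \<Longrightarrow> norm (hadj (U t (cnj z)) *v v) \<le> B2 * norm v"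
    using U_bound[of "cnj z"] by blast
  define N where "N = (LINT t|M. entry_norm (H t))"
  have N: "N \<ge> 0" unfolding N_def by (rule Bochner_Integration.integral_nonneg) (rule entry_norm_nonneg)
  define C1 where "C1 = B1 * (entry_norm J * (B2 * ((N + 1) / 2)))"
  have C1: "C1 \<ge> 0" unfolding C1_def using B1 B2 N entry_norm_nonneg[of J] by simp
  have "sqrt (LINT t|M. quad (H t) (sol z g 0 t)) \<le> sqrt (N * C1\<^sup>2) * sqrt (LINT t|M. quad (H t) (g t))" if g: "g \<in> LL" for g
  proof -
    define n where "n = sqrt (LINT t|M. quad (H t) (g t))"
    have n: "n \<ge> 0" using quad_integral_nonneg by (simp add: n_def)
    have W: "norm (integral {0..t} (weighted z g)) \<le> B2 * ((N + 1) / 2 * n)" if t: "t \<in> {0..l}" for t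
    proof -
      have "integrable M (\<lambda>s. norm (H s *v g s))" by (rule integrable_norm[OF L2_H_int[OF g]])
      then have int: "integrable M (\<lambda>s. B2 * norm (H s *v g s))" by (rule integrable_mult_right)
      have on: "(\<lambda>s. B2 * norm (H s *v g s)) integrable_on {0..t}"
        by (rule integrable_on_subinterval[OF integral_M(2)[OF int]]) (use t in auto)
      have "norm (integral {0..t} (weighted z g)) \<le> integral {0..t} (\<lambda>s. B2 * norm (H s *v g s))"
        by (rule integral_norm_bound_integral[OF weighted_on[OF g] on]) (use t B2 in \<open>auto simp: weighted_def\<close>)
      also have "\<dots> \<le> integral {0..l} (\<lambda>s. B2 * norm (H s *v g s))"
        by (rule integral_subset_le[OF _ on integral_M(2)[OF int]]) (use B2(1) t in auto)
      also have "\<dots> = (LINT s|M. B2 * norm (H s *v g s))" by (rule integral_M(1)[OF int, symmetric])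
      also have "\<dots> = B2 * (LINT s|M. norm (H s *v g s))" by (rule integral_mult_right_zero)
      also have "\<dots> \<le> B2 * ((N + 1) / 2 * n)"
        unfolding n_def N_def by (intro mult_left_mono L1_bound[OF g] B2(1))
      finally show ?thesis .
    qed
    have S: "norm (sol z g 0 t) \<le> C1 * n" if t: "t \<in> {0..l}" for t
    proof -
      have "norm (sol z g 0 t) \<le> B1 * norm (0 - J *v integral {0..t} (weighted z g))"
        unfolding sol_def by (rule B1(2)[OF t])
      also have "\<dots> \<le> B1 * (entry_norm J * norm (integral {0..t} (weighted z g)))"
        using norm_matrix_vector_le[of J] B1(1) by (intro mult_left_mono) auto
      also have "\<dots> \<le> B1 * (entry_norm J * (B2 * ((N + 1) / 2 * n)))"
        by (intro mult_left_mono W t B1(1) entry_norm_nonneg)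
      finally show ?thesis by (simp add: C1_def mult.assoc)
    qed
    have "(LINT t|M. quad (H t) (sol z g 0 t)) \<le> (LINT t|M. entry_norm (H t) * (C1 * n)\<^sup>2)"
    proof (rule integral_mono_AE[OF L2_quad[OF ceq_L2[OF ceq_sol[OF g]]]])
      show "integrable M (\<lambda>t. entry_norm (H t) * (C1 * n)\<^sup>2)" using entry_norm_int by simp
      show "AE t in M. quad (H t) (sol z g 0 t) \<le> entry_norm (H t) * (C1 * n)\<^sup>2"
        using AE_space
      proof eventually_elim
        case (elim t)
        let ?v = "sol z g 0 t"
        have "quad (H t) ?v \<le> norm (H t *v ?v) * norm ?v" by (rule quad_le_norm)
        also have "\<dots> \<le> (entry_norm (H t) * norm ?v) * norm ?v"
          by (intro mult_right_mono norm_matrix_vector_le) simp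
        also have "\<dots> = entry_norm (H t) * (norm ?v)\<^sup>2" by (simp add: power2_eq_square)
        also have "\<dots> \<le> entry_norm (H t) * (C1 * n)\<^sup>2"
          using S[of t] elim by (intro mult_left_mono power_mono entry_norm_nonneg) auto
        finally show ?case .
      qed
    qed
    also have "\<dots> = N * C1\<^sup>2 * n\<^sup>2" by (simp add: N_def power_mult_distrib)
    finally have "sqrt (LINT t|M. quad (H t) (sol z g 0 t)) \<le> sqrt (N * C1\<^sup>2 * n\<^sup>2)" by simp
    also have "\<dots> = sqrt (N * C1\<^sup>2) * n" using n by (simp add: real_sqrt_mult)
    finally show ?thesis by (simp add: n_def)
  qed
  moreover have "0 \<le> sqrt (N * C1\<^sup>2)" using N by simp
  ultimately show ?thesis by blast
qed

section \<open>The adjoint of the minimal relation\<close>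

abbreviation "Amax \<equiv> A_max l J F H"
abbreviation "Amin \<equiv> A_min l J F H"

lemma A_max_iff: "(X, Y) \<in> Amax \<longleftrightarrow> (\<exists>f g. ceq f g \<and> g \<in> LL \<and> X = cls f \<and> Y = cls g)"
proof
  assume "(X, Y) \<in> Amax"
  then obtain f g where fg: "X \<in> hset E" "Y \<in> hset E" "f \<in> X" "g \<in> Y" "ceq f g" unfolding A_max_def by blast
  then show "\<exists>f g. ceq f g \<and> g \<in> LL \<and> X = cls f \<and> Y = cls g"
    using hset_mem[OF fg(1,3)] hset_mem[OF fg(2,4)] by blast
next
  assume "\<exists>f g. ceq f g \<and> g \<in> LL \<and> X = cls f \<and> Y = cls g"
  then obtain f g where fg: "ceq f g" "g \<in> LL" "X = cls f" "Y = cls g" by blast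
  have "X \<in> hset E" "Y \<in> hset E" "f \<in> X" "g \<in> Y"
    using fg ceq_L2[OF fg(1)] by (simp_all add: cls_hset self_mem_cls)
  then show "(X, Y) \<in> Amax" unfolding A_max_def using fg(1) by blast
qed

lemma A_max_cls_iff:
  assumes "f0 \<in> LL" "g0 \<in> LL"
  shows "(cls f0, cls g0) \<in> Amax \<longleftrightarrow> (\<exists>f. ceq f g0 \<and> (AE t in M. H t *v f0 t = H t *v f t))"
proof
  assume "(cls f0, cls g0) \<in> Amax"
  then obtain f g where fg: "ceq f g" "g \<in> LL" "cls f0 = cls f" "cls g0 = cls g" by (auto simp: A_max_iff)
  then have "AE t in M. H t *v g0 t = H t *v g t" "AE t in M. H t *v f0 t = H t *v f t"
    using assms ceq_L2[OF fg(1)] cls_eq_iff by blast+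
  moreover from this(1) have "AE t in M. H t *v g t = H t *v g0 t" by eventually_elim simp
  ultimately show "\<exists>f. ceq f g0 \<and> (AE t in M. H t *v f0 t = H t *v f t)"
    using canonical_eq_cong[OF fg(1)] by blast
next
  assume "\<exists>f. ceq f g0 \<and> (AE t in M. H t *v f0 t = H t *v f t)"
  then obtain f where f: "ceq f g0" "AE t in M. H t *v f0 t = H t *v f t" by blast
  then have "cls f0 = cls f" using cls_eq_iff assms(1) ceq_L2 by blast
  then show "(cls f0, cls g0) \<in> Amax" unfolding A_max_iff using f(1) assms(2) by blast
qed

definition core where
  "core = {(X, Y) \<in> Amax. \<exists>f\<in>X. \<exists>g\<in>Y. ceq f g \<and>
        (\<exists>a b. 0 < a \<and> a \<le> b \<and> b < l \<and> (\<forall>t\<in>{0..l}. t \<notin> {a..b} \<longrightarrow> f t = 0))}"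

lemma A_min_core: "Amin = rel_closure E core"
  by (simp add: A_min_def core_def)

lemma A_max_sub: "(X, Y) \<in> Amax \<Longrightarrow> X \<in> hset E \<and> Y \<in> hset E"
  by (simp add: A_max_def)

text \<open>Compact support removes both boundary terms from Lagrange's identity.\<close>

lemma A_max_sub_adjoint: "Amax \<subseteq> rel_adjoint E core"
proof clarify
  fix X Y assume XY: "(X, Y) \<in> Amax"
  then obtain h h' where h: "ceq h h'" "h' \<in> LL" "X = cls h" "Y = cls h'" by (auto simp: A_max_iff)
  note hL = ceq_L2[OF h(1)]
  show "(X, Y) \<in> rel_adjoint E core"
    unfolding rel_adjoint_def
  proof (clarsimp simp: A_max_sub[OF XY])
    fix X' Y' assume "(X', Y') \<in> core"
    then obtain f g a b where c: "(X', Y') \<in> Amax" "f \<in> X'" "g \<in> Y'" "ceq f g" "0 < a" "b < l"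
      "\<And>t. t \<in> {0..l} \<Longrightarrow> t \<notin> {a..b} \<Longrightarrow> f t = 0" unfolding core_def by blast
    have g: "g \<in> LL" "Y' = cls g" "f \<in> LL" "X' = cls f"
      using hset_mem A_max_sub[OF c(1)] c(2,3) by blast+
    have "f 0 = 0" "f l = 0" using c(5-7) l_pos by auto
    then have "ip g h - ip f h' = 0" using lagrange_ip[OF c(4) h(1) g(1) h(2)] by simp
    then show "hip E Y' X = hip E X' Y" using g h hL by (simp add: hip_L2H)
  qed
qed

text \<open>The shift by 3 keeps the truncation intervals nondegenerate from n = 0 on; they exhaust
  (0,l).\<close>

definition cut_lo where "cut_lo n = l / (real n + 3)"
definition cut :: "nat \<Rightarrow> (real \<Rightarrow> complex^'p) \<Rightarrow> real \<Rightarrow> complex^'p" where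
  "cut n v t = (if t \<in> {cut_lo n..l - cut_lo n} then v t else 0)"

lemma cut_lo: "0 < cut_lo n" "cut_lo n \<le> l - cut_lo n" "l - cut_lo n < l"
  using l_pos by (auto simp: cut_lo_def field_simps)

lemma cut_lo_tendsto: "cut_lo \<longlonglongrightarrow> 0"
proof -
  have "(\<lambda>n. l * inverse (real (Suc (n + 2)))) \<longlonglongrightarrow> l * 0"
    by (intro tendsto_mult tendsto_const LIMSEQ_ignore_initial_segment[OF LIMSEQ_inverse_real_of_nat])
  moreover have "l * inverse (real (Suc (n + 2))) = cut_lo n" for n
    by (simp add: cut_lo_def divide_inverse add.commute)
  ultimately show ?thesis by simp
qed

lemma cut_lo_mono: "n \<le> m \<Longrightarrow> cut_lo m \<le> cut_lo n"
  using l_pos by (auto simp: cut_lo_def intro!: divide_left_mono mult_pos_pos)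

lemma cut_L2:
  assumes v: "v \<in> LL" shows "cut n v \<in> LL"
  unfolding L2_iff
proof
  have "cut n v = (\<lambda>t. indicator {cut_lo n..l - cut_lo n} t *\<^sub>R v t)"
    by (auto simp: cut_def fun_eq_iff indicator_def)
  moreover have "(indicator {cut_lo n..l - cut_lo n} :: real \<Rightarrow> real) \<in> borel_measurable M"
    by (rule measurable_restrict_space1, rule borel_measurable_indicator) simp
  ultimately show m: "cut n v \<in> borel_measurable M" using L2_meas[OF v]
    by (simp add: borel_measurable_scaleR)
  show "integrable M (\<lambda>t. quad (H t) (cut n v t))"
  proof (rule Bochner_Integration.integrable_bound[OF L2_quad[OF v] quad_meas[OF m]])
    show "AE t in M. norm (quad (H t) (cut n v t)) \<le> norm (quad (H t) (v t))"
      by (rule AE_I2) (auto simp: cut_def quad_def)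
  qed
qed

lemma ip_cut: "ip (cut n v) w = ip v (cut n w)" "ip (cut n v) (cut n w) = ip (cut n v) w"
  unfolding L2_ip_def by (auto intro!: arg_cong[where f="integral\<^sup>L M"] simp: cut_def fun_eq_iff)

lemma ip_scale_right: "f \<in> LL \<Longrightarrow> h \<in> LL \<Longrightarrow> ip h (\<lambda>t. a *s f t) = cnj a * ip h f"
  using ip_swap[of "\<lambda>t. a *s f t" h] ip_swap[of f h] by (simp add: ip_scale1 L2_scale)

lemma ip_diff_right: "f \<in> LL \<Longrightarrow> g \<in> LL \<Longrightarrow> h \<in> LL \<Longrightarrow> ip h (\<lambda>t. f t - g t) = ip h f - ip h g"
  using ip_swap[of "\<lambda>t. f t - g t" h] ip_swap[of f h] ip_swap[of g h] by (simp add: ip_diff1 L2_diff)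

text \<open>The adjoint of the map w -> U(., z)w from vectors to L2. It vanishes exactly on the data
  orthogonal to all solutions with parameter z.\<close>

definition moment where "moment z g = integral {0..l} (weighted (cnj z) g)"

lemma cvec_ip_moment: "g \<in> LL \<Longrightarrow> cvec_ip (moment z g) w = ip g (\<lambda>t. U t z *v w)"
  unfolding moment_def using integral_weighted[of g "cnj z" w] by simp

text \<open>The Gram matrix of the columns of U(., 0) over an interior interval. Parameter 0 is
  taken because these columns solve the equation with zero data.\<close>

definition gram :: "nat \<Rightarrow> complex^'p^'p" where
  "gram n = (\<chi> i j. ip (cut n (\<lambda>t. U t 0 *v axis j 1)) (\<lambda>t. U t 0 *v axis i 1))"

definition gram_lim :: "complex^'p^'p" where
  "gram_lim = (\<chi> i j. ip (\<lambda>t. U t 0 *v axis j 1) (\<lambda>t. U t 0 *v axis i 1))"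

text \<open>The operator T lets one computation cover both truncation and the identity.\<close>

lemma gram_eq:
  assumes T: "\<And>v. v \<in> LL \<Longrightarrow> T v \<in> LL" "\<And>f g. T (\<lambda>t. f t + g t) = (\<lambda>t. T f t + T g t)"
     "\<And>a f. T (\<lambda>t. a *s f t) = (\<lambda>t. a *s T f t)"
  shows "(\<chi> i j. ip (T (\<lambda>t. U t z *v axis j 1)) (\<lambda>t. U t z *v axis i 1)) *v c = moment z (T (\<lambda>t. U t z *v c))"
    (is "?G *v c = _")
proof -
  have sum: "ip (T (\<lambda>t. U t z *v (\<Sum>j\<in>S. c $ j *s axis j 1))) w = (\<Sum>j\<in>S. c $ j * ip (T (\<lambda>t. U t z *v axis j 1)) w)"
    if "finite S" "w \<in> LL" for S w
    using that(1)
  proof (induction S rule: finite_induct)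
    case empty
    have "T (\<lambda>t. 0) = (\<lambda>t. 0)" using T(3)[of 0 "\<lambda>t. 0"] by simp
    then show ?case by (simp add: L2_ip_def)
  next
    case (insert j S)
    have "(\<lambda>t. U t z *v (\<Sum>j\<in>insert j S. c $ j *s axis j 1))
      = (\<lambda>t. c $ j *s (U t z *v axis j 1) + U t z *v (\<Sum>j\<in>S. c $ j *s axis j 1))"
      using insert by (simp add: matrix_vector_right_distrib matrix_vector_smult)
    then show ?case using insert that(2)
      by (simp add: T(2) T(3) ip_add1 ip_scale1 L2_scale T(1) U_L2)
  qed
  have c: "(\<Sum>j\<in>UNIV. c $ j *s axis j 1) = c"
    by (simp add: vec_eq_iff axis_def if_distrib cong: if_cong)
  have "(?G *v c) $ i = moment z (T (\<lambda>t. U t z *v c)) $ i" for i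
  proof -
    have "(?G *v c) $ i = (\<Sum>j\<in>UNIV. c $ j * ip (T (\<lambda>t. U t z *v axis j 1)) (\<lambda>t. U t z *v axis i 1))"
      by (simp add: matrix_vector_mult_def mult.commute)
    also have "\<dots> = ip (T (\<lambda>t. U t z *v c)) (\<lambda>t. U t z *v axis i 1)"
      using sum[of UNIV "\<lambda>t. U t z *v axis i 1"] unfolding c by (simp add: U_L2)
    also have "\<dots> = cvec_ip (moment z (T (\<lambda>t. U t z *v c))) (axis i 1)"
      by (rule cvec_ip_moment[symmetric]) (intro T U_L2)
    finally show ?thesis by (simp add: cvec_ip_axis)
  qed
  then show ?thesis by (simp add: vec_eq_iff)
qed

lemma gram_cut: "gram n *v c = moment 0 (cut n (\<lambda>t. U t 0 *v c))"
  unfolding gram_def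
  by (rule gram_eq) (simp_all add: cut_L2, simp_all add: cut_def fun_eq_iff)

lemma gram_lim: "gram_lim *v c = moment 0 (\<lambda>t. U t 0 *v c)"
  unfolding gram_lim_def by (rule gram_eq[where T="\<lambda>v. v"]) auto

text \<open>If H annihilates the solution, its right-hand side z H f vanishes too, so (A2) applies
  whatever z is.\<close>

lemma U_null:
  assumes "AE t in M. H t *v (U t z *v c) = 0"
  shows "c = 0"
proof -
  have "ceq (\<lambda>t. U t z *v c) (\<lambda>t. 0)"
    by (rule canonical_eq_cong[OF ceq_U[of z c]]) (use assms in eventually_elim, simp add: matrix_vector_smult)
  then have "U 0 z *v c = 0" using A2 assms l_pos unfolding condition_A2_def by auto
  then show ?thesis by (simp add: U0)
qed

lemma det_gram_lim: "det gram_lim \<noteq> 0"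
proof -
  have "c = 0" if "gram_lim *v c = 0" for c
  proof -
    have "ip (\<lambda>t. U t 0 *v c) (\<lambda>t. U t 0 *v c) = 0"
      using that cvec_ip_moment[OF U_L2, of 0 0 c c] by (simp add: gram_lim)
    then have "AE t in M. H t *v (U t 0 *v c) = 0" using ip_self_zero_iff[OF U_L2] by blast
    then show "c = 0" by (rule U_null)
  qed
  then show ?thesis using invertible_iff_kernel invertible_det_nz by blast
qed

text \<open>(A2) concerns the whole interval, so a truncated Gram matrix may be singular for small
  n. Its entries converge by dominated convergence, and continuity of the determinant gives
  invertibility for large n.\<close>

lemma eventually_det_gram: "\<forall>\<^sub>F n in sequentially. det (gram n) \<noteq> 0"
proof -
  have ent: "(\<lambda>n. gram n $ i $ j) \<longlonglongrightarrow> gram_lim $ i $ j" for i j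
  proof -
    let ?f = "\<lambda>t. U t 0 *v axis j 1" and ?g = "\<lambda>t. U t 0 *v axis i 1"
    have "(\<lambda>n. LINT t|M. cvec_ip (H t *v cut n ?f t) (?g t)) \<longlonglongrightarrow> (LINT t|M. cvec_ip (H t *v ?f t) (?g t))"
    proof (rule Bochner_Integration.integral_dominated_convergence)
      show "(\<lambda>t. cvec_ip (H t *v ?f t) (?g t)) \<in> borel_measurable M"
        by (intro borel_measurable_integrable L2_form_int U_L2)
      show "(\<lambda>t. cvec_ip (H t *v cut n ?f t) (?g t)) \<in> borel_measurable M" for n
        by (intro borel_measurable_integrable L2_form_int U_L2 cut_L2)
      show "integrable M (\<lambda>t. norm (cvec_ip (H t *v ?f t) (?g t)))"
        by (intro integrable_norm L2_form_int U_L2)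
      show "AE t in M. norm (cvec_ip (H t *v cut n ?f t) (?g t)) \<le> norm (cvec_ip (H t *v ?f t) (?g t))" for n
        by (rule AE_I2) (simp add: cut_def)
      show "AE t in M. (\<lambda>n. cvec_ip (H t *v cut n ?f t) (?g t)) \<longlonglongrightarrow> cvec_ip (H t *v ?f t) (?g t)"
      proof (rule AE_I2)
        fix t assume "t \<in> space M"
        then have t: "0 < t" "0 < l - t" by auto
        have "\<forall>\<^sub>F n in sequentially. cut_lo n < t" "\<forall>\<^sub>F n in sequentially. cut_lo n < l - t"
          using order_tendstoD(2)[OF cut_lo_tendsto] t by blast+
        then have "\<forall>\<^sub>F n in sequentially. cvec_ip (H t *v cut n ?f t) (?g t) = cvec_ip (H t *v ?f t) (?g t)"
          by eventually_elim (simp add: cut_def)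
        then show "(\<lambda>n. cvec_ip (H t *v cut n ?f t) (?g t)) \<longlonglongrightarrow> cvec_ip (H t *v ?f t) (?g t)"
          by (rule tendsto_eventually)
      qed
    qed
    then show ?thesis by (simp add: gram_def gram_lim_def L2_ip_def)
  qed
  have "(\<lambda>n. det (gram n)) \<longlonglongrightarrow> det gram_lim"
    unfolding det_def by (intro tendsto_sum tendsto_mult tendsto_const tendsto_prod ent)
  then show ?thesis using det_gram_lim by (rule tendsto_imp_eventually_ne)
qed

text \<open>The solution \<open>sol 0 g 0\<close> is zero to the left of the truncation interval
  because g is, and zero to the right of it because g is orthogonal to the homogeneous solutions. It
  is thus an admissible test element; comparing the adjoint identity for h with Lagrange's identity
  for the solution with data h' leaves the stated orthogonality.\<close>

lemma core_adjoint_orthogonal: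
  assumes h: "h \<in> LL" "h' \<in> LL" "(cls h, cls h') \<in> rel_adjoint E core"
    and g: "g \<in> LL" "cut n g = g" "\<And>w. ip g (\<lambda>t. U t 0 *v w) = 0"
  shows "ip g (\<lambda>t. h t - sol 0 h' 0 t) = 0"
proof -
  let ?k = "sol 0 h' 0" and ?f = "sol 0 g 0"
  have k: "ceq ?k h'" using ceq_sol[OF h(2), of 0 0] by simp
  have f: "ceq ?f g" using ceq_sol[OF g(1), of 0 0] by simp
  have kL: "?k \<in> LL" and fL: "?f \<in> LL" using ceq_L2 k f by auto
  have Wl: "integral {0..l} (weighted 0 g) = 0"
    by (rule cvec_ip_eqI) (use integral_weighted[OF g(1), of 0] g(3) in simp)
  have w0: "weighted 0 g s = 0" if "s \<notin> {cut_lo n..l - cut_lo n}" for s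
  proof -
    have "g s = 0" using that fun_cong[OF g(2), of s] by (simp add: cut_def split: if_splits)
    then show ?thesis by (simp add: weighted_def)
  qed
  have f0: "?f t = 0" if t: "t \<in> {0..l}" "t \<notin> {cut_lo n..l - cut_lo n}" for t
  proof -
    have "integral {0..t} (weighted 0 g) = 0"
    proof (cases "t < cut_lo n")
      case True
      have "integral {0..t} (weighted 0 g) = integral {0..t} (\<lambda>s. 0)"
        by (rule integral_cong) (use True w0 in auto)
      then show ?thesis by simp
    next
      case False
      with t have t': "l - cut_lo n < t" by auto
      have "integral {t..l} (weighted 0 g) = integral {t..l} (\<lambda>s. 0)"
        by (rule integral_cong) (use t' w0 in auto)
      moreover have "integral {0..t} (weighted 0 g) + integral {t..l} (weighted 0 g) = integral {0..l} (weighted 0 g)"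
        using t by (intro Henstock_Kurzweil_Integration.integral_combine weighted_on g) auto
      ultimately show ?thesis using Wl by simp
    qed
    then show ?thesis by (simp add: sol_def)
  qed
  have "(cls ?f, cls g) \<in> Amax" unfolding A_max_iff using f g(1) by blast
  then have "(cls ?f, cls g) \<in> core"
    unfolding core_def using f0 f self_mem_cls[OF fL] self_mem_cls[OF g(1)] cut_lo[of n] by blast
  then have "hip E (cls g) (cls h) = hip E (cls ?f) (cls h')" using h(3) unfolding rel_adjoint_def by auto
  then have 1: "ip g h = ip ?f h'" using h g fL by (simp add: hip_L2H)
  have "?f 0 = 0" "?f l = 0" using f0[of 0] f0[of l] l_pos cut_lo[of n] by auto
  then have "ip g ?k = ip ?f h'" using lagrange_ip[OF f k g(1) h(2)] by simp
  then show ?thesis using 1 ip_diff_right[OF h(1) kL g(1)] by simp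
qed

text \<open>If \<open>(h, h')\<close> is in the adjoint of the core and \<open>k\<close> solves the equation with data \<open>h'\<close>, then on
  every interior interval \<open>h - k\<close> is orthogonal to the orthogonal complement of the solutions of the
  homogeneous equation, hence is such a solution; its initial value does not depend on the interval.\<close>

lemma core_adjoint_sub_A_max: "rel_adjoint E core \<subseteq> Amax"
proof clarify
  fix X Y assume XY: "(X, Y) \<in> rel_adjoint E core"
  then have "X \<in> hset E" "Y \<in> hset E" by (auto simp: rel_adjoint_def)
  then obtain h h' where h: "h \<in> LL" "h' \<in> LL" and X: "X = cls h" and Y: "Y = cls h'"
    by (auto simp: hset_L2H)
  have adj: "(cls h, cls h') \<in> rel_adjoint E core" using XY X Y by simp
  define k where "k = sol 0 h' 0"
  have k: "ceq k h'" using ceq_sol[OF h(2), of 0 0] by (simp add: k_def)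
  have kL: "k \<in> LL" by (rule ceq_L2[OF k])
  define d where "d = (\<lambda>t. h t - k t)"
  have dL: "d \<in> LL" unfolding d_def by (rule L2_diff[OF h(1) kL])
  obtain N where N: "\<And>n. n \<ge> N \<Longrightarrow> det (gram n) \<noteq> 0"
    using eventually_det_gram by (auto simp: eventually_sequentially)
  have ex: "\<exists>c. AE t in M. H t *v cut n (\<lambda>t. d t - U t 0 *v c) t = 0" if n: "n \<ge> N" for n
  proof -
    have inv: "invertible (gram n)" using N[OF n] invertible_det_nz by blast
    \<comment> \<open>The normal equations: subtracting \<open>U t 0 *v c\<close> makes the
      truncated difference orthogonal to all homogeneous solutions.\<close>
    define c where "c = matrix_inv (gram n) *v moment 0 (cut n d)"
    have c: "gram n *v c = moment 0 (cut n d)"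
      by (simp add: c_def matrix_vector_mul_assoc matrix_inv_mult[OF inv])
    define g where "g = cut n (\<lambda>t. d t - U t 0 *v c)"
    have dc: "(\<lambda>t. d t - U t 0 *v c) \<in> LL" by (intro L2_diff dL U_L2)
    have gL: "g \<in> LL" unfolding g_def by (rule cut_L2[OF dc])
    have g_diff: "g = (\<lambda>t. cut n d t - cut n (\<lambda>t. U t 0 *v c) t)" by (auto simp: g_def cut_def fun_eq_iff)
    have g0: "ip g (\<lambda>t. U t 0 *v w) = 0" for w
    proof -
      have "ip g (\<lambda>t. U t 0 *v w) = cvec_ip (moment 0 (cut n d)) w - cvec_ip (moment 0 (cut n (\<lambda>t. U t 0 *v c))) w"
        unfolding g_diff by (simp add: ip_diff1 cut_L2 dL U_L2 cvec_ip_moment)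
      then show ?thesis unfolding gram_cut[symmetric] c by simp
    qed
    have "cut n g = g" by (auto simp: g_def cut_def fun_eq_iff)
    then have gd: "ip g d = 0"
      unfolding d_def k_def by (rule core_adjoint_orthogonal[OF h adj gL _ g0])
    \<comment> \<open>Truncation is a symmetric idempotent, so g may be paired with the untruncated
      difference, and g is orthogonal to both of its terms.\<close>
    have "ip g g = ip g (\<lambda>t. d t - U t 0 *v c)" unfolding g_def by (rule ip_cut(2))
    also have "\<dots> = 0" using gd g0 by (simp add: ip_diff_right dL U_L2 gL)
    finally have "AE t in M. H t *v g t = 0" using ip_self_zero_iff[OF gL] by blast
    then show ?thesis unfolding g_def by blast
  qed
  then have "\<forall>n\<in>{N..}. \<exists>c. AE t in M. H t *v cut n (\<lambda>t. d t - U t 0 *v c) t = 0" by simp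
  from bchoice[OF this] obtain c where
    c: "\<And>n. n \<ge> N \<Longrightarrow> AE t in M. H t *v cut n (\<lambda>t. d t - U t 0 *v c n) t = 0" by auto
  \<comment> \<open>On the smaller interval both approximations hold, and \<open>gram N\<close> is
    invertible, so the initial value cannot change with n.\<close>
  have cN: "c n = c N" if n: "n \<ge> N" for n
  proof -
    let ?e = "c n - c N"
    have "AE t in M. H t *v cut N (\<lambda>t. U t 0 *v ?e) t = 0"
      using c[OF n] c[OF order_refl]
    proof eventually_elim
      case (elim t)
      show ?case
      proof (cases "t \<in> {cut_lo N..l - cut_lo N}")
        case True
        then have "t \<in> {cut_lo n..l - cut_lo n}" using cut_lo_mono[OF n] by auto
        with True elim have "H t *v (d t - U t 0 *v c n) = 0" "H t *v (d t - U t 0 *v c N) = 0"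
          by (simp_all add: cut_def)
        then have "H t *v (U t 0 *v c n) = H t *v (U t 0 *v c N)" by (simp add: matrix_vector_mult_diff_distrib)
        then show ?thesis using True by (simp add: cut_def matrix_vector_mult_diff_distrib)
      next
        case False
        then have "cut N (\<lambda>t. U t 0 *v ?e) t = 0" unfolding cut_def by (rule if_not_P)
        then show ?thesis by simp
      qed
    qed
    then have "cvec_ip (moment 0 (cut N (\<lambda>t. U t 0 *v ?e))) w = cvec_ip 0 w" for w
      using ip_cong1[of "cut N (\<lambda>t. U t 0 *v ?e)" "\<lambda>t. 0" "\<lambda>t. U t 0 *v w"]
      by (simp add: cvec_ip_moment cut_L2 U_L2 L2_zero) (simp add: L2_ip_def)
    then have "gram N *v ?e = 0" unfolding gram_cut by (rule cvec_ip_eqI)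
    then have "?e = 0" using N[OF order_refl] invertible_det_nz invertible_iff_kernel by blast
    then show ?thesis by simp
  qed
  \<comment> \<open>Countably many null sets combine into one, and every interior point lies in some
    truncation interval.\<close>
  have "AE t in M. \<forall>n\<ge>N. H t *v cut n (\<lambda>t. d t - U t 0 *v c N) t = 0"
    unfolding AE_all_countable AE_impI
  proof (intro allI)
    fix n show "AE t in M. n \<ge> N \<longrightarrow> H t *v cut n (\<lambda>t. d t - U t 0 *v c N) t = 0"
      using c[of n] cN[of n] by (cases "n \<ge> N") auto
  qed
  then have H0: "AE t in M. H t *v h t = H t *v (k t + U t 0 *v c N)"
    using AE_space
  proof eventually_elim
    case (elim t)
    then have "0 < t" "0 < l - t" by auto
    then have "\<forall>\<^sub>F n in sequentially. cut_lo n < t" "\<forall>\<^sub>F n in sequentially. cut_lo n < l - t"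
      using order_tendstoD(2)[OF cut_lo_tendsto] by blast+
    then have "\<forall>\<^sub>F n in sequentially. n \<ge> N \<and> cut_lo n < t \<and> cut_lo n < l - t"
      using eventually_ge_at_top[of N] by eventually_elim blast
    then obtain n where n: "n \<ge> N" "cut_lo n < t" "cut_lo n < l - t"
      using eventually_happens'[OF sequentially_bot] by blast
    then have "t \<in> {cut_lo n..l - cut_lo n}" by simp
    then have "cut n (\<lambda>t. d t - U t 0 *v c N) t = d t - U t 0 *v c N" unfolding cut_def by (rule if_P)
    then have "H t *v (d t - U t 0 *v c N) = 0" using elim(1) n(1) by fastforce
    then show ?case by (simp add: d_def matrix_vector_mult_diff_distrib matrix_vector_right_distrib algebra_simps)
  qed
  have "ceq (\<lambda>t. k t + U t 0 *v c N) h'"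
    using canonical_eq_add[OF k ceq_U[of 0 "c N"]] by simp
  then show "(X, Y) \<in> Amax" unfolding X Y A_max_cls_iff[OF h] using H0 by blast
qed

lemma core_sub: "core \<subseteq> hset E \<times> hset E"
  using A_max_sub by (auto simp: core_def)

text \<open>From here on the notions built on the abstract adjoint (plus space, minus space,
  extended relation) are statements about explicit solutions.\<close>

theorem adjoint_A_min: "rel_adjoint E Amin = Amax"
  unfolding A_min_core E.rel_adjoint_closure[OF core_sub]
  using A_max_sub_adjoint core_adjoint_sub_A_max by blast

text \<open>Makes the closure of the domain a closed subspace, so that the projection in the plus
  norm exists.\<close>

lemma core_lin:
  "(cls (\<lambda>t. 0), cls (\<lambda>t. 0)) \<in> core"
  "(X, Y) \<in> core \<Longrightarrow> (X', Y') \<in> core \<Longrightarrow> (hadd E X X', hadd E Y Y') \<in> core"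
  "(X, Y) \<in> core \<Longrightarrow> (hscale E a X, hscale E a Y) \<in> core"
proof -
  have coreI: "(cls f, cls g) \<in> core"
    if "ceq f g" "g \<in> LL" "0 < a" "a \<le> b" "b < l" "\<And>t. t \<in> {0..l} \<Longrightarrow> t \<notin> {a..b} \<Longrightarrow> f t = 0" for f g a b
  proof -
    have "(cls f, cls g) \<in> Amax" unfolding A_max_iff using that(1,2) by blast
    then show ?thesis unfolding core_def
      using that self_mem_cls[OF ceq_L2[OF that(1)]] self_mem_cls[OF that(2)] by blast
  qed
  have coreE: "\<exists>f g a b. ceq f g \<and> g \<in> LL \<and> X = cls f \<and> Y = cls g \<and> 0 < a \<and> a \<le> b \<and> b < l \<and>
      (\<forall>t\<in>{0..l}. t \<notin> {a..b} \<longrightarrow> f t = 0)" if xy: "(X, Y) \<in> core" for X Y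
  proof -
    obtain f g a b where c: "(X, Y) \<in> Amax" "f \<in> X" "g \<in> Y" "ceq f g" "0 < a" "a \<le> b" "b < l"
      "\<forall>t\<in>{0..l}. t \<notin> {a..b} \<longrightarrow> f t = 0" using xy unfolding core_def by blast
    then show ?thesis using hset_mem[OF _ c(2)] hset_mem[OF _ c(3)] A_max_sub[OF c(1)] by blast
  qed
  have "ceq (\<lambda>t. 0) (\<lambda>t. 0)" using ceq_U[of 0 0] by simp
  then show "(cls (\<lambda>t. 0), cls (\<lambda>t. 0)) \<in> core"
    using l_pos by (intro coreI[of _ _ "l/3" "l/2"] L2_zero) auto
  show "(hscale E a X, hscale E a Y) \<in> core" if xy: "(X, Y) \<in> core"
  proof -
    obtain f g p q where c: "ceq f g" "g \<in> LL" "X = cls f" "Y = cls g" "0 < p" "p \<le> q" "q < l"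
      "\<forall>t\<in>{0..l}. t \<notin> {p..q} \<longrightarrow> f t = 0" using coreE[OF xy] by blast
    then show ?thesis
      using coreI[OF canonical_eq_scale[OF c(1), of a] L2_scale[OF c(2), of a] c(5-7)]
      by (simp add: hscale_L2H ceq_L2[OF c(1)])
  qed
  show "(hadd E X X', hadd E Y Y') \<in> core" if xy: "(X, Y) \<in> core" "(X', Y') \<in> core"
  proof -
    obtain f g p q where c: "ceq f g" "g \<in> LL" "X = cls f" "Y = cls g" "0 < p" "p \<le> q" "q < l"
      "\<forall>t\<in>{0..l}. t \<notin> {p..q} \<longrightarrow> f t = 0" using coreE[OF xy(1)] by blast
    obtain f' g' p' q' where c': "ceq f' g'" "g' \<in> LL" "X' = cls f'" "Y' = cls g'" "0 < p'" "p' \<le> q'" "q' < l"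
      "\<forall>t\<in>{0..l}. t \<notin> {p'..q'} \<longrightarrow> f' t = 0" using coreE[OF xy(2)] by blast
    have "(cls (\<lambda>t. f t + f' t), cls (\<lambda>t. g t + g' t)) \<in> core"
      by (rule coreI[OF canonical_eq_add[OF c(1) c'(1)] L2_add[OF c(2) c'(2)], of "min p p'" "max q q'"])
         (use c(5-7) c'(5-7) c(8) c'(8) in \<open>auto simp: min_le_iff_disj le_max_iff_disj\<close>)
    then show ?thesis using c c' by (simp add: hadd_L2H ceq_L2[OF c(1)] ceq_L2[OF c'(1)])
  qed
qed

end

section \<open>Boundary values and the gauge\<close>

locale canonical_gauge = canonical_system l H J F U
  for l and H :: "real \<Rightarrow> complex^'p^'p" and J F U +
  assumes standing: "delta_standing l J F H"
begin

abbreviation "L \<equiv> gauge_map l J F H"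
abbreviation "A0 \<equiv> ker_ext E Amin (Gamma0 l J F H)"
abbreviation "Hm \<equiv> minus_space E Amin"
abbreviation "Hp \<equiv> plus_space E Amin"
abbreviation "Ul \<equiv> U l"

definition ker :: "complex \<Rightarrow> complex^'p \<Rightarrow> (real \<Rightarrow> complex^'p) set" where
  "ker z w = cls (\<lambda>t. U t z *v w)"

lemma plus_iff: "X \<in> Hp \<longleftrightarrow> (\<exists>Y. (X, Y) \<in> Amax)"
  by (auto simp: plus_space_def adjoint_A_min)

lemma plus_hset: "X \<in> Hp \<Longrightarrow> X \<in> hset E"
  using A_max_sub by (auto simp: plus_iff)

lemma ceq_plus: "ceq f g \<Longrightarrow> g \<in> LL \<Longrightarrow> cls f \<in> Hp"
  unfolding plus_iff A_max_iff by blast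

lemma cls_cong: "f \<in> LL \<Longrightarrow> g \<in> LL \<Longrightarrow> (\<And>t. t \<in> {0..l} \<Longrightarrow> f t = g t) \<Longrightarrow> cls f = cls g"
  unfolding cls_eq_iff by (rule AE_I2) auto

lemma ker_hset: "ker z w \<in> hset E" unfolding ker_def by (rule cls_hset[OF U_L2])

lemma ker_scale: "hscale E a (ker z w) = ker z (a *s w)"
  by (simp add: ker_def hscale_L2H U_L2 matrix_vector_smult)

lemma ker_add: "hadd E (ker z w) (ker z w') = ker z (w + w')"
  by (simp add: ker_def hadd_L2H U_L2 matrix_vector_right_distrib)

lemma ker_A_max: "(ker z w, hscale E z (ker z w)) \<in> Amax"
proof -
  have "hscale E z (ker z w) = cls (\<lambda>t. z *s (U t z *v w))" by (simp add: ker_def hscale_L2H U_L2)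
  then show ?thesis unfolding A_max_iff ker_def using ceq_U L2_scale[OF U_L2] by blast
qed

lemma ker_plus: "ker z w \<in> Hp" using ker_A_max plus_iff by blast

lemma A_max_ker: "(X, hscale E z X) \<in> Amax \<Longrightarrow> \<exists>w. X = ker z w"
proof -
  assume "(X, hscale E z X) \<in> Amax"
  then obtain f g where fg: "ceq f g" "g \<in> LL" "X = cls f" "hscale E z X = cls g" unfolding A_max_iff by blast
  note fL = ceq_L2[OF fg(1)]
  have "cls g = cls (\<lambda>t. z *s f t)" using fg(3,4) fL by (simp add: hscale_L2H)
  then have "AE t in M. H t *v g t = H t *v (z *s f t)"
    using cls_eq_iff[OF fg(2) L2_scale[OF fL]] by blast
  then have "f t = U t z *v f 0" if "t \<in> {0..l}" for t by (rule kernel_unique[OF fg(1) _ that])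
  then have "cls f = ker z (f 0)" unfolding ker_def by (rule cls_cong[OF fL U_L2])
  then show ?thesis using fg(3) by blast
qed

lemma A_max_add: "(X, Y) \<in> Amax \<Longrightarrow> (X', Y') \<in> Amax \<Longrightarrow> (hadd E X X', hadd E Y Y') \<in> Amax"
proof -
  assume "(X, Y) \<in> Amax" "(X', Y') \<in> Amax"
  then obtain f g f' g' where *: "ceq f g" "g \<in> LL" "X = cls f" "Y = cls g"
    "ceq f' g'" "g' \<in> LL" "X' = cls f'" "Y' = cls g'" unfolding A_max_iff by blast
  then have "hadd E X X' = cls (\<lambda>t. f t + f' t)" "hadd E Y Y' = cls (\<lambda>t. g t + g' t)"
    using ceq_L2 by (simp_all add: hadd_L2H)
  then show ?thesis unfolding A_max_iff using canonical_eq_add[OF *(1,5)] L2_add[OF *(2,6)] by blast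
qed

lemma A_max_scale: "(X, Y) \<in> Amax \<Longrightarrow> (hscale E a X, hscale E a Y) \<in> Amax"
proof -
  assume "(X, Y) \<in> Amax"
  then obtain f g where *: "ceq f g" "g \<in> LL" "X = cls f" "Y = cls g" unfolding A_max_iff by blast
  then have "hscale E a X = cls (\<lambda>t. a *s f t)" "hscale E a Y = cls (\<lambda>t. a *s g t)"
    using ceq_L2 by (simp_all add: hscale_L2H)
  then show ?thesis unfolding A_max_iff using canonical_eq_scale[OF *(1)] L2_scale[OF *(2)] by blast
qed

lemma plus_add: "X \<in> Hp \<Longrightarrow> Y \<in> Hp \<Longrightarrow> hadd E X Y \<in> Hp"
  unfolding plus_iff using A_max_add by blast
lemma plus_scale: "X \<in> Hp \<Longrightarrow> hscale E a X \<in> Hp"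
  unfolding plus_iff using A_max_scale by blast

text \<open>\<open>delta\<close> selects an absolutely continuous representative by choice; the
  first half of \<open>delta_standing\<close> makes its value at 0 independent of that
  choice.\<close>

lemma delta_cls:
  assumes f: "ceq f g" "g \<in> LL"
  shows "delta l J F H u (cls f) = cvec_ip u (f 0)"
proof -
  let ?P = "\<lambda>f'. f' \<in> cls f \<and> (\<exists>g\<in>LL. ceq f' g)"
  have "?P (SOME f'. ?P f')" by (rule someI[of ?P f]) (use f self_mem_cls[OF ceq_L2[OF f(1)]] in blast)
  then have "(f, SOME f'. ?P f') \<in> L2_rel l H" "\<exists>g\<in>LL. ceq (SOME f'. ?P f') g" by (auto simp: mem_cls)
  then have "f 0 = (SOME f'. ?P f') 0" using standing f unfolding delta_standing_def by blast
  then show ?thesis using ceq_plus[OF f] by (simp add: delta_def)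
qed

lemma L_cls: "ceq f g \<Longrightarrow> g \<in> LL \<Longrightarrow> L u (cls f) = complex_of_real (sqrt 2) * cvec_ip u (f 0)"
  by (simp add: gauge_map_def delta_cls)

lemma L_ker: "L u (ker z w) = complex_of_real (sqrt 2) * cvec_ip u w"
  unfolding ker_def using L_cls[OF ceq_U[of z w] L2_scale[OF U_L2]] by (simp add: U0)

lemma minusD:
  assumes "\<phi> \<in> Hm"
  shows "h \<in> Hp \<Longrightarrow> k \<in> Hp \<Longrightarrow> \<phi> (hadd E h k) = \<phi> h + \<phi> k"
    "h \<in> Hp \<Longrightarrow> \<phi> (hscale E a h) = cnj a * \<phi> h"
    "\<exists>C. \<forall>h\<in>Hp. cmod (\<phi> h) \<le> C * plus_norm E Amin h"
    "h \<notin> Hp \<Longrightarrow> \<phi> h = 0"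
  using assms unfolding minus_space_def by blast+

lemma plus_norm_ge: "X \<in> Hp \<Longrightarrow> hnorm E X \<le> plus_norm E Amin X"
  unfolding plus_norm_def by (rule real_le_rsqrt) simp

lemma minus_lin:
  assumes "\<phi> \<in> Hm" "\<psi> \<in> Hm"
  shows "(\<lambda>h. a * \<phi> h + b * \<psi> h) \<in> Hm"
proof -
  obtain C D where C: "\<And>h. h \<in> Hp \<Longrightarrow> cmod (\<phi> h) \<le> C * plus_norm E Amin h"
    and D: "\<And>h. h \<in> Hp \<Longrightarrow> cmod (\<psi> h) \<le> D * plus_norm E Amin h"
    using minusD(3)[OF assms(1)] minusD(3)[OF assms(2)] by blast
  have "cmod (a * \<phi> h + b * \<psi> h) \<le> (cmod a * C + cmod b * D) * plus_norm E Amin h" if h: "h \<in> Hp" for h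
  proof -
    have "cmod (a * \<phi> h + b * \<psi> h) \<le> cmod a * cmod (\<phi> h) + cmod b * cmod (\<psi> h)"
      by (metis norm_mult norm_triangle_ineq)
    also have "\<dots> \<le> cmod a * (C * plus_norm E Amin h) + cmod b * (D * plus_norm E Amin h)"
      by (intro add_mono mult_left_mono C D h) auto
    finally show ?thesis by (simp add: algebra_simps)
  qed
  then show ?thesis unfolding minus_space_def
  proof (intro CollectI conjI ballI allI impI, goal_cases)
    case (3) then show ?case by blast
  qed (use minusD(1,2,4)[OF assms(1)] minusD(1,2,4)[OF assms(2)] in \<open>simp_all add: algebra_simps\<close>)
qed

lemma minus_embed_in: "f \<in> hset E \<Longrightarrow> minus_embed E Amin f \<in> Hm"
proof -
  assume f: "f \<in> hset E"
  have "cmod (hip E f h) \<le> hnorm E f * plus_norm E Amin h" if h: "h \<in> Hp" for h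
  proof -
    have "cmod (hip E f h) \<le> hnorm E f * hnorm E h" by (rule E.cauchy_schwarz[OF f plus_hset[OF h]])
    also have "\<dots> \<le> hnorm E f * plus_norm E Amin h"
      by (intro mult_left_mono plus_norm_ge h E.norm_nonneg f)
    finally show ?thesis .
  qed
  then show ?thesis unfolding minus_space_def minus_embed_def
    using plus_add plus_scale plus_hset f by (auto simp: E.ips)
qed

lemma L_minus: "L u \<in> Hm"
proof -
  have "delta l J F H u \<in> Hm" using standing by (simp add: delta_standing_def)
  from minus_lin[OF this this, of "complex_of_real (sqrt 2)" 0] show ?thesis
    by (simp add: gauge_map_def[abs_def])
qed

text \<open>Defect elements have arbitrary initial values and so separate the gauge
  functionals.\<close>

lemma L_inj: "inj L"
proof (rule injI)
  fix u v assume "L u = L v"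
  then have "L u (ker 0 w) = L v (ker 0 w)" for w by simp
  then show "u = v" unfolding L_ker by (intro cvec_ip_eqI) simp
qed

lemma gauge_adj_cls:
  assumes f: "ceq f g" "g \<in> LL"
  shows "gauge_adj E Amin L (cls f) = sqrt 2 *\<^sub>R f 0"
  unfolding gauge_adj_def dual_adjoint_def minus_plus_def L_cls[OF f]
proof (rule the_equality)
  show "sqrt 2 *\<^sub>R f 0 \<in> UNIV \<and> (\<forall>x\<in>UNIV. complex_of_real (sqrt 2) * cvec_ip x (f 0) = cvec_ip x (sqrt 2 *\<^sub>R f 0))"
    by (simp add: cvec_ip_simps)
  fix x' assume "x' \<in> UNIV \<and> (\<forall>x\<in>UNIV. complex_of_real (sqrt 2) * cvec_ip x (f 0) = cvec_ip x x')"
  then show "x' = sqrt 2 *\<^sub>R f 0" by (intro cvec_ip_eqI2) (simp add: cvec_ip_simps)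
qed

lemma gauge_adj_ker: "gauge_adj E Amin L (ker z w) = sqrt 2 *\<^sub>R w"
  unfolding ker_def using gauge_adj_cls[OF ceq_U[of z w] L2_scale[OF U_L2]] by (simp add: U0)

lemma core_sub_Amin: "core \<subseteq> Amin"
  unfolding A_min_core by (rule E.rel_closure_superset[OF core_sub])

text \<open>The projection is defined through the domain of the closed relation, while linearity is
  at hand for the core. Nothing is lost, because first components of \<open>A_min\<close> are limits
  of first components of the core.\<close>

lemma closure_dom: "hclosure E (Domain Amin) = hclosure E (Domain core)"
proof (intro equalityI subsetI)
  fix x assume "x \<in> hclosure E (Domain core)"
  then show "x \<in> hclosure E (Domain Amin)" unfolding hclosure_def using core_sub_Amin by blast
next
  fix x assume x: "x \<in> hclosure E (Domain Amin)"
  then have xE: "x \<in> hset E" by (simp add: hclosure_def)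
  have "\<exists>y\<in>Domain core. hnorm E (hdiff E x y) < e" if "e > 0" for e
  proof -
    have e2: "e / 2 > 0" using that by simp
    obtain y where y: "y \<in> Domain Amin" "hnorm E (hdiff E x y) < e / 2"
      using x e2 unfolding hclosure_def by blast
    then obtain y' where "(y, y') \<in> rel_closure E core" unfolding A_min_core by blast
    then obtain u v where u: "y \<in> hset E" "(u, v) \<in> core" "hnorm E (hdiff E y u) < e / 2"
      using e2 unfolding rel_closure_def by blast
    have "hnorm E (hdiff E x u) \<le> hnorm E (hdiff E x y) + hnorm E (hdiff E y u)"
      using xE u core_sub by (intro E.norm_diff_triangle) auto
    then show ?thesis using y u by (intro bexI[of _ u]) auto
  qed
  then show "x \<in> hclosure E (Domain core)" unfolding hclosure_def using xE by simp
qed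

lemma closed_subspace_dom: "E.closed_subspace (hclosure E (Domain Amin))"
  unfolding closure_dom
proof (rule E.closed_subspace_closure)
  show "Domain core \<subseteq> hset E" using core_sub by auto
  show "hzero E \<in> Domain core" using core_lin(1) by (auto simp: hzero_L2H)
  show "x \<in> Domain core \<Longrightarrow> y \<in> Domain core \<Longrightarrow> hadd E x y \<in> Domain core" for x y
    using core_lin(2) by (meson Domain.simps)
  show "x \<in> Domain core \<Longrightarrow> hscale E a x \<in> Domain core" for x a
    using core_lin(3) by (meson Domain.simps)
qed

text \<open>\<open>plus_norm\<close> uses an arbitrary second component h0. As h0 - h' is orthogonal
  to the domain of \<open>A_min\<close>, the projection p of h0 satisfies |p|^2 = <h', p> and so is
  dominated by h'. Functionals of the minus space are thereby bounded by the graph norm.\<close>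

lemma plus_norm_le:
  assumes h: "(h, h') \<in> Amax"
  shows "plus_norm E Amin h \<le> hnorm E h + hnorm E h'"
proof -
  let ?S = "hclosure E (Domain Amin)"
  define h0 where "h0 = (SOME f'. (h, f') \<in> Amax)"
  have h0: "(h, h0) \<in> Amax" unfolding h0_def by (rule someI[of "\<lambda>f'. (h, f') \<in> Amax", OF h])
  have m: "h \<in> hset E" "h' \<in> hset E" "h0 \<in> hset E" using A_max_sub h h0 by blast+
  define p where "p = hproj E ?S h0"
  note proj = E.projection[OF closed_subspace_dom m(3)]
  have p: "p \<in> ?S" "p \<in> hset E" using proj(1) by (auto simp: p_def hclosure_def)
  have orth: "hip E (hdiff E h0 h') y = 0" if "y \<in> ?S" for y
  proof (rule E.closure_orthogonal[OF _ _ _ that[unfolded closure_dom]])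
    show "hdiff E h0 h' \<in> hset E" by (rule E.diff_closed[OF m(3,2)])
    show "Domain core \<subseteq> hset E" using core_sub by auto
    fix y assume "y \<in> Domain core"
    then obtain y' where y: "(y, y') \<in> core" by blast
    have yE: "y \<in> hset E" using y core_sub by blast
    have "hip E y' h = hip E y h'" "hip E y' h = hip E y h0"
      using A_max_sub_adjoint h h0 y unfolding rel_adjoint_def by blast+
    then have "hip E y (hdiff E h0 h') = 0" using m yE by (simp add: E.ip_diff2)
    then show "hip E (hdiff E h0 h') y = 0"
      using E.ip_cnj[OF yE E.diff_closed[OF m(3,2)]] by simp
  qed
  have "hip E (hdiff E h0 p) p = 0" using proj(2)[OF proj(1)] by (simp add: p_def)
  then have "hip E p p = hip E h0 p" using m p by (simp add: E.ip_diff)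
  also have "\<dots> = hip E h' p" using orth[OF p(1)] m p by (simp add: E.ip_diff)
  finally have "complex_of_real ((hnorm E p)\<^sup>2) = hip E h' p" using E.ip_self[OF p(2)] by simp
  then have "(hnorm E p)\<^sup>2 = cmod (hip E h' p)" by (metis abs_of_nonneg norm_of_real zero_le_power2)
  also have "\<dots> \<le> hnorm E h' * hnorm E p" by (rule E.cauchy_schwarz[OF m(2) p(2)])
  finally have "hnorm E p \<le> hnorm E h'"
    using E.norm_nonneg[OF p(2)] E.norm_nonneg[OF m(2)] by (cases "hnorm E p = 0") (auto simp: power2_eq_square)
  then have "(hnorm E h)\<^sup>2 + (hnorm E p)\<^sup>2 \<le> (hnorm E h)\<^sup>2 + (hnorm E h')\<^sup>2"
    using E.norm_nonneg[OF p(2)] by (simp add: power_mono)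
  also have "\<dots> \<le> (hnorm E h + hnorm E h')\<^sup>2"
    using E.norm_nonneg[OF m(1)] E.norm_nonneg[OF m(2)] by (simp add: power2_sum)
  finally show ?thesis
    unfolding plus_norm_def adjoint_A_min h0_def[symmetric] p_def[symmetric]
    using E.norm_nonneg[OF m(1)] E.norm_nonneg[OF m(2)] by (intro real_le_lsqrt) auto
qed

section \<open>The projection onto the gauge and \<open>calP\<close>\<close>

definition volterra :: "complex \<Rightarrow> (real \<Rightarrow> complex^'p) set \<Rightarrow> (real \<Rightarrow> complex^'p) set" where
  "volterra z X = cls (sol z (L2_rep X) 0)"

lemma hset_rep: "X \<in> hset E \<Longrightarrow> L2_rep X \<in> LL \<and> cls (L2_rep X) = X"
proof -
  assume "X \<in> hset E"
  then obtain f where f: "f \<in> LL" "X = cls f" by (auto simp: hset_L2H)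
  then show ?thesis using rep_cls[OF f(1)] cls_eq_iff[OF f(1), of "L2_rep X"] by simp
qed

lemma volterra_A_max:
  assumes X: "X \<in> hset E"
  shows "(volterra z X, hadd E X (hscale E z (volterra z X))) \<in> Amax"
proof -
  let ?g = "L2_rep X"
  have g: "?g \<in> LL" "cls ?g = X" using hset_rep[OF X] by auto
  note s = ceq_sol[OF g(1), of z 0]
  note sL = ceq_L2[OF s]
  have "hadd E X (hscale E z (volterra z X)) = cls (\<lambda>t. ?g t + z *s sol z ?g 0 t)"
    unfolding volterra_def by (subst g(2)[symmetric]) (simp add: hscale_L2H hadd_L2H sL g(1) L2_scale)
  moreover have "ceq (sol z ?g 0) (\<lambda>t. ?g t + z *s sol z ?g 0 t)" using s by (simp add: add.commute)
  ultimately show ?thesis unfolding A_max_iff volterra_def using L2_add[OF g(1) L2_scale[OF sL]] by blast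
qed

lemma volterra_bound: "\<exists>C\<ge>0. \<forall>X\<in>hset E. hnorm E (volterra z X) \<le> C * hnorm E X"
proof -
  obtain C where C: "C \<ge> 0" "\<And>g. g \<in> LL \<Longrightarrow> sqrt (LINT t|M. quad (H t) (sol z g 0 t)) \<le> C * sqrt (LINT t|M. quad (H t) (g t))"
    using sol_bound[of z] by blast
  have "hnorm E (volterra z X) \<le> C * hnorm E X" if X: "X \<in> hset E" for X
  proof -
    have g: "L2_rep X \<in> LL" "cls (L2_rep X) = X" using hset_rep[OF X] by auto
    have "hnorm E X = hnorm E (cls (L2_rep X))" by (simp only: g(2))
    then show ?thesis using C(2)[OF g(1)] ceq_L2[OF ceq_sol[OF g(1)]]
      by (simp add: volterra_def hnorm_L2H g(1))
  qed
  then show ?thesis using C(1) by blast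
qed

text \<open>The value of \<open>\<psi>\<close> on a solution depends only on the data: two solutions
  with the same data differ by a defect element, where \<open>\<psi>\<close> vanishes.
  \<open>volterra\<close> selects one solution for each datum and, being bounded for every z, takes
  the place of a resolvent.\<close>

lemma vanishing_in_range:
  assumes \<psi>: "\<psi> \<in> Hm" and vanish: "\<And>w. \<psi> (ker (cnj z) w) = 0"
  shows "\<psi> \<in> extended_ran E Amin z"
proof -
  let ?V = "volterra (cnj z)"
  define \<theta> where "\<theta> = (\<lambda>X. \<psi> (?V X))"
  have V_plus: "?V X \<in> Hp" if "X \<in> hset E" for X using volterra_A_max[OF that] plus_iff by blast
  have key: "\<psi> h = \<theta> g" if h: "(h, hadd E g (hscale E (cnj z) h)) \<in> Amax" and g: "g \<in> hset E" for h g
  proof -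
    note v = volterra_A_max[OF g, of "cnj z"]
    have m: "h \<in> hset E" "?V g \<in> hset E" using A_max_sub h v by blast+
    let ?d = "hadd E h (hscale E (-1) (?V g))"
    have "(?d, hadd E (hadd E g (hscale E (cnj z) h)) (hscale E (-1) (hadd E g (hscale E (cnj z) (?V g))))) \<in> Amax"
      by (intro A_max_add A_max_scale h v)
    moreover have "hadd E (hadd E g (hscale E (cnj z) h)) (hscale E (-1) (hadd E g (hscale E (cnj z) (?V g))))
        = hscale E (cnj z) ?d"
      using m g by (intro E.ip_ext) (simp_all add: E.ips algebra_simps)
    ultimately obtain w where w: "?d = ker (cnj z) w" using A_max_ker by metis
    have "\<psi> ?d = \<psi> h - \<psi> (?V g)"
      using minusD(1)[OF \<psi>, of h "hscale E (-1) (?V g)"] minusD(2)[OF \<psi>, of "?V g" "-1"]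
        plus_scale[of "?V g"] V_plus[OF g] h plus_iff by auto
    then show ?thesis using vanish[of w] unfolding w \<theta>_def by simp
  qed
  obtain C where C: "\<And>h. h \<in> Hp \<Longrightarrow> cmod (\<psi> h) \<le> C * plus_norm E Amin h" using minusD(3)[OF \<psi>] by blast
  obtain D where D: "D \<ge> 0" "\<And>X. X \<in> hset E \<Longrightarrow> hnorm E (?V X) \<le> D * hnorm E X"
    using volterra_bound[of "cnj z"] by blast
  obtain f where f: "f \<in> hset E" "\<And>X. X \<in> hset E \<Longrightarrow> \<theta> X = hip E f X"
  \<comment> \<open>\<open>D + (1 + cmod z * D)\<close> bounds the sum of the norms of the two
    components of the pair with first entry \<open>?V X\<close>. The modulus of C is taken because C
    is not known to be nonnegative.\<close>
  proof (rule E.riesz[OF E.closed_subspace_whole, of \<theta> "\<bar>C\<bar> * (D + (1 + cmod z * D))"])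
    fix X Y assume XY: "X \<in> hset E" "Y \<in> hset E"
    note v = volterra_A_max[OF XY(1), of "cnj z"] volterra_A_max[OF XY(2), of "cnj z"]
    have m: "?V X \<in> hset E" "?V Y \<in> hset E" using A_max_sub v by blast+
    have "hadd E (hadd E X (hscale E (cnj z) (?V X))) (hadd E Y (hscale E (cnj z) (?V Y)))
        = hadd E (hadd E X Y) (hscale E (cnj z) (hadd E (?V X) (?V Y)))"
      using m XY by (intro E.ip_ext) (simp_all add: E.ips algebra_simps)
    with A_max_add[OF v] have "\<psi> (hadd E (?V X) (?V Y)) = \<theta> (hadd E X Y)"
      using XY by (intro key) (simp_all add: E.closed)
    then show "\<theta> (hadd E X Y) = \<theta> X + \<theta> Y"
      using minusD(1)[OF \<psi> V_plus[OF XY(1)] V_plus[OF XY(2)]] by (simp add: \<theta>_def)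
  next
    fix a X assume X: "X \<in> hset E"
    note v = volterra_A_max[OF X, of "cnj z"]
    have m: "?V X \<in> hset E" using A_max_sub v by blast
    have "hscale E a (hadd E X (hscale E (cnj z) (?V X)))
        = hadd E (hscale E a X) (hscale E (cnj z) (hscale E a (?V X)))"
      using m X by (intro E.ip_ext) (simp_all add: E.ips algebra_simps)
    with A_max_scale[OF v, of a] have "\<psi> (hscale E a (?V X)) = \<theta> (hscale E a X)"
      using X by (intro key) (simp_all add: E.closed)
    then show "\<theta> (hscale E a X) = cnj a * \<theta> X"
      using minusD(2)[OF \<psi> V_plus[OF X], of a] by (simp add: \<theta>_def)
  next
    fix X assume X: "X \<in> hset E"
    note v = volterra_A_max[OF X, of "cnj z"]
    have m: "?V X \<in> hset E" using A_max_sub v by blast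
    have "plus_norm E Amin (?V X) \<le> hnorm E (?V X) + hnorm E (hadd E X (hscale E (cnj z) (?V X)))"
      by (rule plus_norm_le[OF v])
    also have "\<dots> \<le> hnorm E (?V X) + (hnorm E X + cmod z * hnorm E (?V X))"
      using E.norm_add_le[OF X E.scale_closed[OF m, of "cnj z"]] E.norm_scale[OF m, of "cnj z"] by simp
    also have "\<dots> \<le> D * hnorm E X + (hnorm E X + cmod z * (D * hnorm E X))"
      by (intro add_mono mult_left_mono D X) auto
    finally have le: "plus_norm E Amin (?V X) \<le> (D + (1 + cmod z * D)) * hnorm E X" by (simp add: algebra_simps)
    have "cmod (\<theta> X) \<le> C * plus_norm E Amin (?V X)" unfolding \<theta>_def by (rule C[OF V_plus[OF X]])
    also have "\<dots> \<le> \<bar>C\<bar> * plus_norm E Amin (?V X)"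
      using order_trans[OF E.norm_nonneg[OF m] plus_norm_ge[OF V_plus[OF X]]] by (intro mult_right_mono) auto
    also have "\<dots> \<le> \<bar>C\<bar> * ((D + (1 + cmod z * D)) * hnorm E X)" by (intro mult_left_mono le) auto
    finally show "cmod (\<theta> X) \<le> \<bar>C\<bar> * (D + (1 + cmod z * D)) * hnorm E X" by (simp add: mult.assoc)
  qed blast
  \<comment> \<open>Chosen so that \<open>\<psi>\<close> is \<open>\<eta>\<close> minus z times f,
    the form of an element of the range.\<close>
  define \<eta> where "\<eta> = (\<lambda>h. \<psi> h + z * minus_embed E Amin f h)"
  have \<eta>: "\<eta> \<in> Hm" using minus_lin[OF \<psi> minus_embed_in[OF f(1)], of 1 z] by (simp add: \<eta>_def)
  have "(f, \<eta>) \<in> extended_rel E Amin"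
    unfolding extended_rel_def adjoint_A_min
  proof (clarsimp simp: f(1) \<eta> minus_plus_def)
    fix h h' assume h: "(h, h') \<in> Amax"
    have m: "h \<in> hset E" "h' \<in> hset E" using A_max_sub[OF h] by auto
    let ?g = "hdiff E h' (hscale E (cnj z) h)"
    have g: "?g \<in> hset E" using m by (simp add: E.closed)
    have "hadd E ?g (hscale E (cnj z) h) = h'" using m by (intro E.ip_ext) (simp_all add: E.ips)
    then have "\<psi> h = hip E f ?g" using key[of h ?g] h g f(2)[OF g] by simp
    then have "\<psi> h = hip E f h' - z * hip E f h" using m f(1) by (simp add: E.ips)
    moreover have "h \<in> Hp" using h plus_iff by blast
    ultimately show "\<eta> h = hip E f h'" by (simp add: \<eta>_def minus_embed_def)
  qed
  moreover have "\<psi> = (\<lambda>h. \<eta> h - z * minus_embed E Amin f h)" by (simp add: \<eta>_def)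
  ultimately show ?thesis unfolding extended_ran_def by blast
qed

text \<open>On a defect element k the second component is \<open>cnj z\<close> times k, so the two
  terms of an element of the range cancel. With \<open>vanishing_in_range\<close> this yields the
  direct decomposition of the minus space into range and gauge.\<close>

lemma range_vanishes:
  assumes "\<psi> \<in> extended_ran E Amin z"
  shows "\<psi> (ker (cnj z) w) = 0"
proof -
  obtain f \<eta> where f: "(f, \<eta>) \<in> extended_rel E Amin" "\<psi> = (\<lambda>h. \<eta> h - z * minus_embed E Amin f h)"
    using assms unfolding extended_ran_def by blast
  have fE: "f \<in> hset E" using f(1) by (simp add: extended_rel_def)
  have "\<eta> (ker (cnj z) w) = hip E f (hscale E (cnj z) (ker (cnj z) w))"
    using f(1) ker_A_max[of "cnj z" w] unfolding extended_rel_def adjoint_A_min minus_plus_def by blast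
  also have "\<dots> = z * hip E f (ker (cnj z) w)" using fE by (simp add: E.ip_scale2 ker_hset)
  finally show ?thesis using ker_plus by (simp add: f(2) minus_embed_def)
qed

text \<open>The coordinate of \<open>\<Pi>\<^sup>z\<phi>\<close> in \<open>\<LL>\<close>, read off by testing \<open>\<phi>\<close> on the defect subspace.\<close>

definition coord :: "complex \<Rightarrow> ((real \<Rightarrow> complex^'p) set \<Rightarrow> complex) \<Rightarrow> complex^'p" where
  "coord z \<phi> = (\<chi> i. \<phi> (ker (cnj z) (axis i 1)) / complex_of_real (sqrt 2))"

text \<open>Conjugate linearity extends the values on unit vectors to all w; the factor is the one
  that L carries on defect elements.\<close>

lemma cvec_ip_coord:
  assumes \<phi>: "\<phi> \<in> Hm"
  shows "complex_of_real (sqrt 2) * cvec_ip (coord z \<phi>) w = \<phi> (ker (cnj z) w)"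
proof -
  have "\<phi> (ker (cnj z) (\<Sum>i\<in>S. w $ i *s axis i 1)) = (\<Sum>i\<in>S. cnj (w $ i) * \<phi> (ker (cnj z) (axis i 1)))"
    if "finite S" for S
    using that
  proof (induction S rule: finite_induct)
    case empty
    have "\<phi> (ker (cnj z) 0) = 0"
      using minusD(2)[OF \<phi> ker_plus, of 0 "cnj z" 0] by (simp add: ker_scale)
    then show ?case by simp
  next
    case (insert i S)
    have "\<phi> (ker (cnj z) (w $ i *s axis i 1 + (\<Sum>i\<in>S. w $ i *s axis i 1)))
      = \<phi> (ker (cnj z) (w $ i *s axis i 1)) + \<phi> (ker (cnj z) (\<Sum>i\<in>S. w $ i *s axis i 1))"
      unfolding ker_add[symmetric] by (rule minusD(1)[OF \<phi> ker_plus ker_plus])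
    also have "\<phi> (ker (cnj z) (w $ i *s axis i 1)) = cnj (w $ i) * \<phi> (ker (cnj z) (axis i 1))"
      unfolding ker_scale[symmetric] by (rule minusD(2)[OF \<phi> ker_plus])
    finally show ?case using insert by simp
  qed
  from this[of UNIV] have "\<phi> (ker (cnj z) w) = (\<Sum>i\<in>UNIV. cnj (w $ i) * \<phi> (ker (cnj z) (axis i 1)))"
    by (simp add: basis_expansion)
  then show ?thesis by (simp add: cvec_ip_def coord_def sum_distrib_left mult.commute)
qed

lemma gauge_proj_eq:
  assumes \<phi>: "\<phi> \<in> Hm"
  shows "gauge_proj E Amin (range L) z \<phi> = L (coord z \<phi>)"
  unfolding gauge_proj_def
proof (rule the_equality)
  have "(\<lambda>h. \<phi> h - L (coord z \<phi>) h) \<in> Hm" using minus_lin[OF \<phi> L_minus, of 1 "-1"] by simp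
  then have "(\<lambda>h. \<phi> h - L (coord z \<phi>) h) \<in> extended_ran E Amin z"
    by (rule vanishing_in_range) (simp add: L_ker cvec_ip_coord[OF \<phi>])
  then show "L (coord z \<phi>) \<in> range L \<and> (\<lambda>h. \<phi> h - L (coord z \<phi>) h) \<in> extended_ran E Amin z" by blast
  fix \<psi> assume "\<psi> \<in> range L \<and> (\<lambda>h. \<phi> h - \<psi> h) \<in> extended_ran E Amin z"
  then obtain v where v: "\<psi> = L v" "(\<lambda>h. \<phi> h - L v h) \<in> extended_ran E Amin z" by blast
  have "cvec_ip v w = cvec_ip (coord z \<phi>) w" for w
    using range_vanishes[OF v(2), of w] cvec_ip_coord[OF \<phi>, of z w] by (simp add: L_ker)
  then show "\<psi> = L (coord z \<phi>)" unfolding v(1) by (metis cvec_ip_eqI)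
qed

lemma calP_eq: "\<phi> \<in> Hm \<Longrightarrow> calP E Amin L z \<phi> = coord z \<phi>"
  unfolding calP_def by (simp add: gauge_proj_eq the_inv_into_f_f[OF L_inj])

lemma calP_adj_eq: "calP_adj E Amin L z u = ker (cnj z) ((1 / sqrt 2) *\<^sub>R u)"
  unfolding calP_adj_def dual_adjoint_def minus_plus_def
proof (rule the_equality)
  have "cvec_ip (calP E Amin L z \<phi>) u = \<phi> (ker (cnj z) ((1 / sqrt 2) *\<^sub>R u))" if \<phi>: "\<phi> \<in> Hm" for \<phi>
    using cvec_ip_coord[OF \<phi>, of z "(1 / sqrt 2) *\<^sub>R u"] by (simp add: calP_eq[OF \<phi>] cvec_ip_simps)
  then show "ker (cnj z) ((1 / sqrt 2) *\<^sub>R u) \<in> Hp \<and>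
      (\<forall>\<phi>\<in>Hm. cvec_ip (calP E Amin L z \<phi>) u = \<phi> (ker (cnj z) ((1 / sqrt 2) *\<^sub>R u)))"
    using ker_plus by blast
  fix x' assume x': "x' \<in> Hp \<and> (\<forall>\<phi>\<in>Hm. cvec_ip (calP E Amin L z \<phi>) u = \<phi> x')"
  let ?k = "ker (cnj z) ((1 / sqrt 2) *\<^sub>R u)"
  show "x' = ?k"
  \<comment> \<open>For uniqueness the functionals embedded from E are enough, since they already
    separate its points.\<close>
  proof (rule E.ip_ext2)
    show "x' \<in> hset E" using x' plus_hset by blast
    fix f assume f: "f \<in> hset E"
    have "minus_embed E Amin f x' = minus_embed E Amin f ?k"
      using x' cvec_ip_coord[OF minus_embed_in[OF f], of z "(1 / sqrt 2) *\<^sub>R u"] minus_embed_in[OF f]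
      by (auto simp: calP_eq cvec_ip_simps)
    then show "hip E f x' = hip E f ?k" using x' ker_plus by (simp add: minus_embed_def)
  qed (rule ker_hset)
qed

section \<open>Boundary values and the resolvents of the extension with f(0) + f(l) = 0\<close>

lemma ac_rep_eq:
  assumes f: "ceq f g" "g \<in> LL" and t: "t \<in> {0..l}"
  shows "ac_rep l J F H (cls f, cls g) t = f t"
proof -
  let ?P = "\<lambda>f'. f' \<in> cls f \<and> (\<exists>g'\<in>cls g. ceq f' g')"
  define f' where "f' = (SOME f'. ?P f')"
  have "?P f'" unfolding f'_def
    by (rule someI[of ?P f]) (use f self_mem_cls[OF ceq_L2[OF f(1)]] self_mem_cls[OF f(2)] in blast)
  then obtain g' where g': "f' \<in> cls f" "g' \<in> cls g" "ceq f' g'" by blast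
  then have "AE t in M. H t *v f t = H t *v f' t" "AE t in M. H t *v g t = H t *v g' t"
    by (auto simp: mem_cls rel_iff)
  from ceq_unique[OF f(1) g'(3) this t] show ?thesis by (simp add: ac_rep_def f'_def)
qed

lemma Gamma_eq:
  assumes f: "ceq f g" "g \<in> LL"
  shows "Gamma0 l J F H (cls f, cls g) = (1 / sqrt 2) *\<^sub>R (f 0 + f l)"
    "Gamma1 l J F H (cls f, cls g) = - ((1 / sqrt 2) *\<^sub>R (J *v (f 0 - f l)))"
  using ac_rep_eq[OF f, of 0] ac_rep_eq[OF f, of l] l_pos by (simp_all add: Gamma0_def Gamma1_def)

lemma Gamma_ker:
  "Gamma0 l J F H (ker z w, hscale E z (ker z w)) = (1 / sqrt 2) *\<^sub>R ((mat 1 + Ul z) *v w)"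
  "Gamma1 l J F H (ker z w, hscale E z (ker z w)) = - ((1 / sqrt 2) *\<^sub>R (J *v ((mat 1 - Ul z) *v w)))"
  unfolding ker_def hscale_L2H[OF U_L2] Gamma_eq[OF ceq_U L2_scale[OF U_L2]]
  by (simp_all add: U0 matrix_vector_mult_add_rdistrib matrix_vector_mult_diff_rdistrib)

abbreviation "regular z \<equiv> invertible (mat 1 + Ul z)"
definition "P z = matrix_inv (mat 1 + Ul z)"

lemma P_inverse: "regular z \<Longrightarrow> P z ** (mat 1 + Ul z) = mat 1" "regular z \<Longrightarrow> (mat 1 + Ul z) ** P z = mat 1"
  unfolding P_def by (rule matrix_inv_mult; assumption)+

lemma l_in: "l \<in> {0..l}" using l_pos by simp

text \<open>If U(l, cnj z)x = -x, the symplectic identity makes J x an eigenvector of the adjoint of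
  U(l,z) for -1. Then J x is orthogonal to the range of I + U(l,z), which is the whole
  space.\<close>

lemma regular_cnj:
  assumes "regular z" shows "regular (cnj z)"
  unfolding invertible_iff_kernel
proof (intro allI impI)
  fix x assume "(mat 1 + Ul (cnj z)) *v x = 0"
  then have x: "Ul (cnj z) *v x = - x"
    by (simp add: matrix_vector_mult_add_rdistrib eq_neg_iff_add_eq_0 add.commute)
  have "hadj (Ul z) *v (J *v (Ul (cnj z) *v x)) = J *v x"
    using U_symplectic[OF l_in, of "cnj z"] by (simp add: matrix_vector_mul_assoc matrix_mul_assoc)
  then have *: "hadj (Ul z) *v (J *v x) = - (J *v x)" unfolding x
    by (simp add: matrix_vector_minus) (metis minus_minus)
  have "cvec_ip ((mat 1 + Ul z) *v y) (J *v x) = 0" for y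
    by (simp add: matrix_vector_mult_add_rdistrib cvec_ip_simps cvec_ip_hadj *)
  from this[of "P z *v (J *v x)"] have "cvec_ip (J *v x) (J *v x) = 0"
    by (simp add: matrix_vector_mul_assoc matrix_mul_assoc P_inverse(2)[OF assms])
  then have "J *v x = 0" by (simp add: cvec_ip_self)
  then have "J *v (J *v x) = 0" by simp
  then show "x = 0" unfolding JJv by simp
qed

lemma kernel_A0:
  assumes "(mat 1 + Ul z) *v w = 0"
  shows "(ker z w, hscale E z (ker z w)) \<in> A0"
  unfolding ker_ext_def adjoint_A_min using ker_A_max Gamma_ker(1) assms by simp

lemma ker_eq_zero: "ker z w = hzero E \<Longrightarrow> w = 0"
proof -
  assume "ker z w = hzero E"
  then have "AE t in M. H t *v (U t z *v w) = H t *v 0"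
    unfolding ker_def hzero_L2H using cls_eq_iff[OF U_L2 L2_zero] by blast
  then show "w = 0" by (intro U_null) simp
qed

text \<open>A kernel vector gives a solution with f(l) = -f(0). The boundary terms of Lagrange's
  identity then cancel, so z - cnj z times the squared seminorm is 0.\<close>

lemma regular_nonreal:
  assumes "Im z \<noteq> 0" shows "regular z"
  unfolding invertible_iff_kernel
proof (intro allI impI)
  fix w assume w: "(mat 1 + Ul z) *v w = 0"
  then have Uw: "Ul z *v w = - w" by (simp add: matrix_vector_mult_add_rdistrib eq_neg_iff_add_eq_0 add.commute)
  let ?f = "\<lambda>t. U t z *v w"
  have "ip (\<lambda>t. z *s ?f t) ?f - ip ?f (\<lambda>t. z *s ?f t) = 0"
    using lagrange_ip[OF ceq_U ceq_U L2_scale[OF U_L2] L2_scale[OF U_L2], of z w z w]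
    by (simp add: Uw U0 matrix_vector_minus cvec_ip_minus1 cvec_ip_minus2)
  then have "(z - cnj z) * ip ?f ?f = 0"
    by (simp add: ip_scale1 ip_scale_right U_L2 algebra_simps)
  moreover have "z - cnj z \<noteq> 0" using assms by (simp add: complex_eq_iff)
  ultimately have "ip ?f ?f = 0" by simp
  then have "AE t in M. H t *v ?f t = 0" using ip_self_zero_iff[OF U_L2] by blast
  then show "w = 0" by (rule U_null)
qed

text \<open>A kernel vector gives a homogeneous solution in \<open>A0\<close>, which uniqueness in
  the resolvent equation for zero data excludes.\<close>

lemma regular_resolvent:
  assumes "z \<in> resolvent_set E A0" shows "regular z"
  unfolding invertible_iff_kernel
proof (intro allI impI)
  fix w assume w: "(mat 1 + Ul z) *v w = 0"
  have *: "ker z v = resolvent E A0 z (hzero E)" if "(mat 1 + Ul z) *v v = 0" for v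
  proof (rule E.resolvent_spec(3)[OF assms E.zero_closed ker_hset])
    have "hadd E (hzero E) (hscale E z (ker z v)) = hscale E z (ker z v)"
      by (intro E.ip_ext) (simp_all add: E.ips ker_hset)
    then show "(ker z v, hadd E (hzero E) (hscale E z (ker z v))) \<in> A0" using kernel_A0[OF that] by simp
  qed
  have "ker z w = ker z 0" using *[OF w] *[of 0] by simp
  also have "ker z 0 = hzero E" by (simp add: ker_def hzero_L2H)
  finally show "w = 0" by (rule ker_eq_zero)
qed

text \<open>Both identities transport the relation between U(l,z) and U(l, cnj z) to the inverses of
  I + U; the first also uses P U = I - P.\<close>

lemma P_symplectic:
  assumes r: "regular z"
  shows "hadj (P (cnj z)) = mat 1 + J ** P z ** J" "P z ** Ul z ** J = J ** hadj (P (cnj z))"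
proof -
  note Q = P_inverse[OF regular_cnj[OF r]]
  have hQ: "(mat 1 + hadj (Ul (cnj z))) ** hadj (P (cnj z)) = mat 1"
    using arg_cong[OF Q(1), of hadj] by (simp add: hadj_mul hadj_add)
  have PU: "P z ** Ul z = mat 1 - P z"
    using P_inverse(1)[OF r] by (simp add: matrix_mul_add eq_diff_eq add.commute)
  have "Ul z ** J ** (mat 1 + hadj (Ul (cnj z))) = (mat 1 + Ul z) ** J"
    using U_symplectic2[OF l_in, of z] by (simp add: matrix_mul_add add.commute)
  then have "P z ** (Ul z ** J ** (mat 1 + hadj (Ul (cnj z)))) ** hadj (P (cnj z))
     = P z ** ((mat 1 + Ul z) ** J) ** hadj (P (cnj z))" by simp
  moreover have "P z ** (Ul z ** J ** (mat 1 + hadj (Ul (cnj z)))) ** hadj (P (cnj z))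
     = P z ** Ul z ** J ** ((mat 1 + hadj (Ul (cnj z))) ** hadj (P (cnj z)))"
    by (simp only: matrix_mul_assoc)
  moreover have "P z ** ((mat 1 + Ul z) ** J) ** hadj (P (cnj z)) = J ** hadj (P (cnj z))"
    using P_inverse(1)[OF r] by (simp add: matrix_mul_assoc)
  ultimately show 1: "P z ** Ul z ** J = J ** hadj (P (cnj z))" unfolding hQ by simp
  have "J ** ((mat 1 - P z) ** J) = J ** (J ** hadj (P (cnj z)))" using 1 by (simp add: PU)
  also have "\<dots> = - hadj (P (cnj z))" by (simp add: matrix_mul_assoc JJ matrix_mul_minus)
  finally have "- hadj (P (cnj z)) = - (mat 1 + J ** P z ** J)"
    by (simp add: matrix_mul_diff matrix_mul_assoc JJ)
  then show "hadj (P (cnj z)) = mat 1 + J ** P z ** J" by (metis minus_minus)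
qed

text \<open>With m the moment of g, the initial value c solves c + U(l,z)(c - J m) = 0, which is the
  boundary condition f(0) + f(l) = 0.\<close>

definition res0 :: "complex \<Rightarrow> (real \<Rightarrow> complex^'p) \<Rightarrow> real \<Rightarrow> complex^'p" where
  "res0 z g = sol z g (P z *v (Ul z *v (J *v moment (cnj z) g)))"

lemma sol_l: "sol z g c l = Ul z *v (c - J *v moment (cnj z) g)"
  by (simp add: sol_def moment_def)

text \<open>Invertibility of I + U(l,z) suffices to evaluate the definite description, so the
  formula can be used at i and -i without placing these points in the resolvent set first.\<close>

lemma resolvent_A0:
  assumes r: "regular z" and g: "g \<in> LL"
  shows "resolvent E A0 z (cls g) = cls (res0 z g)"
  unfolding resolvent_def
proof (rule the_equality)
  let ?f = "res0 z g"
  have f: "ceq ?f (\<lambda>t. z *s ?f t + g t)" unfolding res0_def by (rule ceq_sol[OF g])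
  note fL = ceq_L2[OF f]
  have gL: "(\<lambda>t. z *s ?f t + g t) \<in> LL" by (intro L2_add L2_scale fL g)
  have eq: "hadd E (cls g) (hscale E z (cls ?f)) = cls (\<lambda>t. z *s ?f t + g t)"
    by (simp add: hscale_L2H hadd_L2H fL g L2_scale add.commute)
  let ?m = "Ul z *v (J *v moment (cnj z) g)"
  have "?f 0 + ?f l = (mat 1 + Ul z) *v (P z *v ?m) - ?m"
    unfolding res0_def sol_l sol_0
    by (simp add: matrix_vector_mult_add_rdistrib matrix_vector_mult_diff_distrib)
  also have "\<dots> = 0" using P_inverse(2)[OF r] by (simp add: matrix_vector_mul_assoc matrix_mul_assoc)
  finally have "Gamma0 l J F H (cls ?f, cls (\<lambda>t. z *s ?f t + g t)) = 0"
    unfolding Gamma_eq(1)[OF f gL] by simp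
  moreover have "(cls ?f, cls (\<lambda>t. z *s ?f t + g t)) \<in> Amax" unfolding A_max_iff using f gL by blast
  ultimately show "cls ?f \<in> hset E \<and> (cls ?f, hadd E (cls g) (hscale E z (cls ?f))) \<in> A0"
    unfolding eq ker_ext_def adjoint_A_min using cls_hset[OF fL] by blast
  fix X assume X: "X \<in> hset E \<and> (X, hadd E (cls g) (hscale E z X)) \<in> A0"
  then have XA: "(X, hadd E (cls g) (hscale E z X)) \<in> Amax"
    and X0: "Gamma0 l J F H (X, hadd E (cls g) (hscale E z X)) = 0"
    unfolding ker_ext_def adjoint_A_min by auto
  obtain f' g' where f': "ceq f' g'" "g' \<in> LL" "X = cls f'" "hadd E (cls g) (hscale E z X) = cls g'"
    using XA unfolding A_max_iff by blast
  note f'L = ceq_L2[OF f'(1)]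
  have "cls g' = cls (\<lambda>t. z *s f' t + g t)"
    using f'(3,4) f'L g by (simp add: hscale_L2H hadd_L2H L2_scale add.commute)
  then have ae: "AE t in M. H t *v g' t = H t *v (z *s f' t + g t)"
    using cls_eq_iff[OF f'(2) L2_add[OF L2_scale[OF f'L] g]] by blast
  have s: "f' t = sol z g (f' 0) t" if "t \<in> {0..l}" for t by (rule sol_unique[OF f'(1) g ae that])
  have "(1 / sqrt 2) *\<^sub>R (f' 0 + f' l) = 0" using X0 unfolding f'(3) f'(4)[unfolded f'(3)] Gamma_eq(1)[OF f'(1,2)] .
  then have "f' 0 + Ul z *v (f' 0 - J *v moment (cnj z) g) = 0" using s[OF l_in] unfolding sol_l by simp
  then have "(mat 1 + Ul z) *v f' 0 = ?m"
    by (simp add: matrix_vector_mult_add_rdistrib matrix_vector_mult_diff_distrib algebra_simps)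
  then have "P z *v ((mat 1 + Ul z) *v f' 0) = P z *v ?m" by simp
  then have "f' 0 = P z *v ?m" by (simp only: matrix_vector_mul_assoc P_inverse(1)[OF r] matrix_vector_mul_lid)
  then show "X = cls ?f" unfolding f'(3) using s by (intro cls_cong f'L fL) (simp add: res0_def)
qed

text \<open>\<open>P_symplectic\<close> moves the matrices onto v, which exhibits the functional as
  an inner product with a defect element; the adjoints of the resolvents on the gauge are read off
  from this.\<close>

lemma L_res0:
  assumes r: "regular z" and g: "g \<in> LL"
  shows "L v (cls (res0 z g)) = - complex_of_real (sqrt 2) * cvec_ip (P (cnj z) *v (J *v v)) (moment (cnj z) g)"
proof -
  have f: "ceq (res0 z g) (\<lambda>t. z *s res0 z g t + g t)" unfolding res0_def by (rule ceq_sol[OF g])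
  have gL: "(\<lambda>t. z *s res0 z g t + g t) \<in> LL" by (intro L2_add L2_scale ceq_L2[OF f] g)
  have "cvec_ip v (res0 z g 0) = cvec_ip v ((P z ** Ul z ** J) *v moment (cnj z) g)"
    by (simp add: res0_def sol_0 matrix_vector_mul_assoc matrix_mul_assoc)
  also have "\<dots> = cvec_ip v (J *v (hadj (P (cnj z)) *v moment (cnj z) g))"
    by (simp add: P_symplectic(2)[OF r] matrix_vector_mul_assoc)
  also have "\<dots> = - cvec_ip (P (cnj z) *v (J *v v)) (moment (cnj z) g)"
    unfolding cvec_ip_hadj[of "P (cnj z)"] cvec_ip_J by simp
  finally show ?thesis unfolding L_cls[OF f gL] by simp
qed

lemma cvec_ip_moment_ker: "g \<in> LL \<Longrightarrow> cvec_ip (moment z g) w = hip E (cls g) (ker z w)"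
  by (simp add: cvec_ip_moment ker_def hip_L2H U_L2)

lemma res_adjI:
  assumes "y \<in> hset E" "\<And>x. x \<in> hset E \<Longrightarrow> \<phi> (R x) = hip E y x"
  shows "res_adj E R \<phi> = y"
  unfolding res_adj_def dual_adjoint_def plus_minus_def minus_plus_def
proof (rule the_equality)
  show "y \<in> hset E \<and> (\<forall>x\<in>hset E. cnj (\<phi> (R x)) = hip E x y)"
    using assms E.ip_cnj[OF assms(1)] by auto
  fix y' assume y': "y' \<in> hset E \<and> (\<forall>x\<in>hset E. cnj (\<phi> (R x)) = hip E x y')"
  then show "y' = y" using assms E.ip_cnj[OF assms(1)] by (intro E.ip_ext2) auto
qed

lemma ip_ker_moment:
  assumes g: "g \<in> LL"
  shows "hip E (ker z w) (cls g) = cvec_ip w (moment z g)"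
  using cvec_ip_moment_ker[OF g, of z w] cvec_ip_cnj[of "moment z g" w] E.ip_cnj[OF cls_hset[OF g] ker_hset[of z w]] by simp

lemma res_adj_A0:
  assumes r: "regular z"
  shows "res_adj E (resolvent E A0 (cnj z)) (L v) = ker z (- (sqrt 2 *\<^sub>R (P z *v (J *v v))))"
proof (rule res_adjI[OF ker_hset])
  fix x assume "x \<in> hset E"
  then obtain g where g: "g \<in> LL" "x = cls g" by (auto simp: hset_L2H)
  show "L v (resolvent E A0 (cnj z) x) = hip E (ker z (- (sqrt 2 *\<^sub>R (P z *v (J *v v))))) x"
    unfolding g(2) resolvent_A0[OF regular_cnj[OF r] g(1)] L_res0[OF regular_cnj[OF r] g(1)] ip_ker_moment[OF g(1)]
    by (simp add: cvec_ip_simps)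
qed

lemma regular_i: "regular \<i>" "regular (- \<i>)"
  by (rule regular_nonreal; simp)+

text \<open>A function rather than a class, because its value at 0 is needed. The coefficient is
  half of the sqrt 2 in L, the half coming from the mean.\<close>

definition mean_rep :: "complex^'p \<Rightarrow> real \<Rightarrow> complex^'p" where
  "mean_rep v t = U t \<i> *v (- ((1 / sqrt 2) *\<^sub>R (P \<i> *v (J *v v)))) + U t (- \<i>) *v (- ((1 / sqrt 2) *\<^sub>R (P (- \<i>) *v (J *v v))))"

lemma mean_rep_eq: "cls (mean_rep v) = hadd E (ker \<i> (- ((1 / sqrt 2) *\<^sub>R (P \<i> *v (J *v v)))))
     (ker (- \<i>) (- ((1 / sqrt 2) *\<^sub>R (P (- \<i>) *v (J *v v)))))"
  by (simp add: ker_def hadd_L2H U_L2 mean_rep_def[abs_def])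

lemma mean_rep_ceq: "\<exists>g\<in>LL. ceq (mean_rep v) g"
  unfolding mean_rep_def using canonical_eq_add[OF ceq_U ceq_U] L2_add[OF L2_scale[OF U_L2] L2_scale[OF U_L2]] by blast

lemma mean_res_adj: "res_adj E (mean_resolvent E A0) (L v) = cls (mean_rep v)"
proof (rule res_adjI)
  show "cls (mean_rep v) \<in> hset E" unfolding mean_rep_eq by (intro E.closed ker_hset)
  fix x assume "x \<in> hset E"
  then obtain g where g: "g \<in> LL" "x = cls g" by (auto simp: hset_L2H)
  let ?a = "cls (res0 \<i> g)" and ?b = "cls (res0 (- \<i>) g)"
  have pl: "?a \<in> Hp" "?b \<in> Hp"
    unfolding res0_def by (rule ceq_plus[OF ceq_sol[OF g(1)] L2_add[OF L2_scale[OF ceq_L2[OF ceq_sol[OF g(1)]]] g(1)]])+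
  have "mean_resolvent E A0 x = hscale E (1/2) (hadd E ?a ?b)"
    unfolding mean_resolvent_def g(2) resolvent_A0[OF regular_i(1) g(1)] resolvent_A0[OF regular_i(2) g(1)] ..
  then have "L v (mean_resolvent E A0 x) = (L v ?a + L v ?b) / 2"
    using minusD(1)[OF L_minus pl] minusD(2)[OF L_minus plus_add[OF pl], of v "1/2"] by simp
  also have "\<dots> = hip E (cls (mean_rep v)) x"
  proof -
    have s: "1 / complex_of_real (sqrt 2) = complex_of_real (sqrt 2) / 2"
    proof -
      have "1 / sqrt 2 = sqrt 2 / 2" using real_div_sqrt[of 2] by (simp add: field_simps)
      then have "complex_of_real (1 / sqrt 2) = complex_of_real (sqrt 2 / 2)" by (rule arg_cong)
      then show ?thesis by simp
    qed
    have "hip E (cls (mean_rep v)) x = - (1 / complex_of_real (sqrt 2)) * cvec_ip (P \<i> *v (J *v v)) (moment \<i> g)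
        - (1 / complex_of_real (sqrt 2)) * cvec_ip (P (- \<i>) *v (J *v v)) (moment (- \<i>) g)"
      unfolding mean_rep_eq g(2) using ip_ker_moment[OF g(1)] cls_hset[OF g(1)]
      by (simp add: E.ip_add ker_hset cvec_ip_simps)
    then show ?thesis using L_res0[OF regular_i(1) g(1), of v] L_res0[OF regular_i(2) g(1), of v]
      unfolding s by (simp add: field_simps)
  qed
  finally show "L v (mean_resolvent E A0 x) = hip E (cls (mean_rep v)) x" .
qed

section \<open>The Weyl function and the origin of K\<close>

definition "weyl z = - J ** (mat 1 - Ul z) ** P z"
definition "KK = J ** re_part (weyl \<i>) ** J"

text \<open>Writing I - U as 2I - (I + U) leaves an expression affine in P.\<close>

lemma J_weyl:
  assumes r: "regular z" shows "J ** weyl z = 2 *\<^sub>R P z - mat 1"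
proof -
  have "J ** weyl z = - (J ** J ** (mat 1 - Ul z) ** P z)"
    by (simp add: weyl_def matrix_mul_minus matrix_mul_assoc)
  also have "\<dots> = (mat 1 - Ul z) ** P z" by (simp add: JJ matrix_mul_minus matrix_mul_diff)
  also have "\<dots> = (2 *\<^sub>R mat 1 - (mat 1 + Ul z)) ** P z" by (simp add: scaleR_2)
  also have "\<dots> = 2 *\<^sub>R P z - mat 1" unfolding matrix_mul_diff(2) P_inverse(2)[OF r] scaleR_matrix_mul by simp
  finally show ?thesis .
qed

lemma weyl_eq: assumes r: "regular z" shows "weyl z = J - 2 *\<^sub>R (J ** P z)"
proof -
  have "J ** (J ** weyl z) = J ** (2 *\<^sub>R P z - mat 1)" by (simp add: J_weyl[OF r])
  then have "- weyl z = 2 *\<^sub>R (J ** P z) - J"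
    by (simp add: matrix_mul_assoc JJ matrix_mul_minus matrix_mul_diff matrix_mul_scaleR)
  then have "- (- weyl z) = - (2 *\<^sub>R (J ** P z) - J)" by (rule arg_cong)
  then show ?thesis by simp
qed

text \<open>The first identity of \<open>P_symplectic\<close> in terms of the Weyl function; it
  turns Re M(i) into the mean of M(i) and M(-i).\<close>

lemma hadj_weyl: assumes r: "regular z" shows "hadj (weyl z) = weyl (cnj z)"
proof -
  have hP: "hadj (P z) = mat 1 + J ** P (cnj z) ** J"
    using P_symplectic(1)[OF regular_cnj[OF r]] by simp
  have "hadj (weyl z) = - J + 2 *\<^sub>R (hadj (P z) ** J)"
    by (simp add: weyl_eq[OF r] hadj_diff hadj_scaleR hadj_mul hadj_J matrix_mul_minus)
  also have "hadj (P z) ** J = J - J ** P (cnj z)"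
    unfolding hP matrix_mul_add(2) by (simp add: matrix_mul_assoc[symmetric] JJ matrix_mul_minus)
  also have "- J + 2 *\<^sub>R (J - J ** P (cnj z)) = J - 2 *\<^sub>R (J ** P (cnj z))" by (simp add: scaleR_2 algebra_simps)
  finally show ?thesis by (simp add: weyl_eq[OF regular_cnj[OF r]])
qed

text \<open>The regularization at i and -i contributes P(i) and P(-i); \<open>J_weyl\<close>
  expresses their sum through Re M(i), and this is where K enters.\<close>

lemma P_sum: "(P \<i> + P (- \<i>)) ** J = J + KK"
proof -
  have "J ** re_part (weyl \<i>) = (1/2) *\<^sub>R (J ** weyl \<i> + J ** weyl (- \<i>))"
    using hadj_weyl[OF regular_i(1)] by (simp add: re_part_def matrix_mul_scaleR matrix_mul_add)
  also have "\<dots> = P \<i> + P (- \<i>) - mat 1"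
  proof -
    have "J ** weyl \<i> + J ** weyl (- \<i>) = 2 *\<^sub>R (P \<i> + P (- \<i>) - mat 1)"
      unfolding J_weyl[OF regular_i(1)] J_weyl[OF regular_i(2)] by (simp add: scaleR_2 algebra_simps)
    then show ?thesis by simp
  qed
  finally have "P \<i> + P (- \<i>) = mat 1 + J ** re_part (weyl \<i>)" by simp
  then show ?thesis by (simp add: KK_def matrix_mul_add)
qed

lemma hadj_KK: "hadj KK = KK"
proof -
  have "hadj (re_part X) = re_part X" for X :: "complex^'p^'p"
    by (simp add: re_part_def hadj_scaleR hadj_add add.commute)
  then show ?thesis by (simp add: KK_def hadj_mul hadj_J matrix_mul_minus matrix_mul_assoc)
qed

lemma mean_rep_0: "sqrt 2 *\<^sub>R mean_rep v 0 = - ((J + KK) *v v)"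
proof -
  have "sqrt 2 *\<^sub>R mean_rep v 0 = - ((P \<i> + P (- \<i>)) *v (J *v v))"
    by (simp add: mean_rep_def U0 scaleR_add_right scaleR_diff_right matrix_vector_mult_add_rdistrib)
  then show ?thesis by (simp add: matrix_vector_mul_assoc P_sum)
qed

section \<open>Evaluation of \<open>calQ\<close> and of the left resolvent matrix\<close>

lemma coord_embed:
  assumes f: "f \<in> LL"
  shows "sqrt 2 *\<^sub>R coord z (minus_embed E Amin (cls f)) = moment (cnj z) f"
proof (rule cvec_ip_eqI)
  fix w
  show "cvec_ip (sqrt 2 *\<^sub>R coord z (minus_embed E Amin (cls f))) w = cvec_ip (moment (cnj z) f) w"
    using cvec_ip_coord[OF minus_embed_in[OF cls_hset[OF f]], of z w] ker_plus
    by (simp add: cvec_ip_simps cvec_ip_moment_ker[OF f] minus_embed_def)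
qed

text \<open>The class of the solution vanishing at \<open>l\<close> equals \<open>R\<^sub>z f - R\<^sub>z L v\<close> with \<open>v = \<P>(z) f\<close>; this
  evaluates \<open>\<Q>(z)\<close> without a resolvent formula for the extension.\<close>

lemma calQ_eq:
  fixes K :: "'k hspace"
  assumes ext: "selfadjoint_extension E Amin K \<iota> At" and z: "z \<in> resolvent_set K At" and f: "f \<in> LL"
  shows "calQ E Amin A0 L (generalized_resolvent E K \<iota> At) z (cls f)
     = (J - KK) *v coord z (minus_embed E Amin (cls f))"
proof -
  define R where "R = generalized_resolvent E K \<iota> At"
  have sub: "Amin \<subseteq> hset E \<times> hset E" unfolding A_min_def rel_closure_def by blast
  note GR = E.generalized_resolvent_spec[OF ext sub z, folded R_def, unfolded adjoint_A_min]
  define v where "v = coord z (minus_embed E Amin (cls f))"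
  have v: "moment (cnj z) f = sqrt 2 *\<^sub>R v" using coord_embed[OF f, of z] by (simp add: v_def)
  \<comment> \<open>At l the bracket in \<open>sol\<close> is sqrt 2 J v - J m with m = sqrt 2 v, so
    this initial value makes h vanish there.\<close>
  define h where "h = sol z f (sqrt 2 *\<^sub>R (J *v v))"
  have h: "ceq h (\<lambda>t. z *s h t + f t)" unfolding h_def by (rule ceq_sol[OF f])
  note hL = ceq_L2[OF h]
  have gL: "(\<lambda>t. z *s h t + f t) \<in> LL" by (intro L2_add L2_scale hL f)
  have h0: "h 0 = sqrt 2 *\<^sub>R (J *v v)" by (simp add: h_def sol_0)
  have hl: "h l = 0" by (simp add: h_def sol_l v matrix_vector_scaleR)
  have fE: "cls f \<in> hset E" by (rule cls_hset[OF f])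
  note RfE = GR(1)[OF fE]
  \<comment> \<open>The extension need not be known: in Lagrange's identity for h and an arbitrary
    resolvent pair (k, g) at \<open>cnj z\<close>, only the boundary term at 0 survives, and it is
    the value of \<open>L v\<close> on k.\<close>
  have x1: "res_adj E (R (cnj z)) (L v) = hdiff E (R z (cls f)) (cls h)"
  proof (rule res_adjI)
    show "hdiff E (R z (cls f)) (cls h) \<in> hset E" by (rule E.diff_closed[OF RfE cls_hset[OF hL]])
    fix x assume x: "x \<in> hset E"
    then obtain x0 where x0: "x0 \<in> LL" "x = cls x0" by (auto simp: hset_L2H)
    obtain k g where k: "ceq k g" "g \<in> LL" "R (cnj z) x = cls k" "hadd E x (hscale E (cnj z) (R (cnj z) x)) = cls g"
      using GR(4)[OF x] unfolding A_max_iff by blast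
    note kL = ceq_L2[OF k(1)]
    have "ip (\<lambda>t. z *s h t + f t) k - ip h g = complex_of_real (sqrt 2) * cvec_ip v (k 0)"
      using lagrange_ip[OF h k(1) gL k(2)] by (simp add: hl h0 matrix_vector_scaleR JJv cvec_ip_simps)
    moreover have "ip (\<lambda>t. z *s h t + f t) k = z * ip h k + ip f k"
      by (simp add: ip_add1 ip_scale1 hL f kL L2_scale)
    moreover have "ip h g = ip h x0 + z * ip h k"
    proof -
      have "ip h g = hip E (cls h) (hadd E x (hscale E (cnj z) (R (cnj z) x)))"
        by (simp add: k(4) hip_L2H hL k(2))
      also have "\<dots> = hip E (cls h) x + z * hip E (cls h) (R (cnj z) x)"
        using x GR(3)[OF x] cls_hset[OF hL] by (simp add: E.ips)
      finally show ?thesis unfolding k(3) by (simp add: x0 hip_L2H hL kL)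
    qed
    ultimately have "complex_of_real (sqrt 2) * cvec_ip v (k 0) = ip f k - ip h x0" by simp
    also have "ip f k = hip E (R z (cls f)) x"
      using GR(5)[OF fE x] by (simp add: k(3) hip_L2H f kL)
    also have "ip h x0 = hip E (cls h) x" by (simp add: x0 hip_L2H hL)
    finally show "L v (R (cnj z) x) = hip E (hdiff E (R z (cls f)) (cls h)) x"
      unfolding k(3) L_cls[OF k(1,2)] using x RfE cls_hset[OF hL] by (simp add: E.ip_diff)
  qed
  obtain g2 where g2: "ceq (mean_rep v) g2" "g2 \<in> LL" using mean_rep_ceq by blast
  note mL = ceq_L2[OF g2(1)]
  \<comment> \<open>The resolvent of the extension cancels here, so the result no longer depends on
    the extension.\<close>
  have "hdiff E (R z (cls f)) (hdiff E (hdiff E (R z (cls f)) (cls h)) (cls (mean_rep v)))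
      = hadd E (cls h) (cls (mean_rep v))"
    using RfE cls_hset[OF hL] cls_hset[OF mL] by (intro E.ip_ext) (simp_all add: E.ips)
  also have "\<dots> = cls (\<lambda>t. h t + mean_rep v t)" by (simp add: hadd_L2H hL mL)
  finally have "calQ E Amin A0 L R z (cls f) = gauge_adj E Amin L (cls (\<lambda>t. h t + mean_rep v t))"
    unfolding calQ_def gauge_proj_eq[OF minus_embed_in[OF fE]] v_def[symmetric]
      regularized_resolvent_def x1 mean_res_adj by simp
  also have "\<dots> = sqrt 2 *\<^sub>R (h 0 + mean_rep v 0)"
    by (rule gauge_adj_cls[OF canonical_eq_add[OF h g2(1)] L2_add[OF gL g2(2)]])
  also have "\<dots> = 2 *\<^sub>R (J *v v) - (J + KK) *v v"
    unfolding scaleR_add_right mean_rep_0 h0 by simp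
  also have "\<dots> = (J - KK) *v v"
    by (simp add: matrix_vector_mult_add_rdistrib matrix_vector_mult_diff_rdistrib scaleR_2)
  finally show ?thesis by (simp add: R_def v_def)
qed

text \<open>Since \<open>coord\<close> on embedded elements is a moment, the adjoint is found by
  moving J - K across the product: J is skew and K Hermitian, which gives -(J + K).\<close>

lemma calQ_adj_eq:
  fixes K :: "'k hspace"
  assumes ext: "selfadjoint_extension E Amin K \<iota> At" and z: "z \<in> resolvent_set K At"
  shows "calQ_adj E Amin A0 L (generalized_resolvent E K \<iota> At) z u
     = ker (cnj z) (- ((1 / sqrt 2) *\<^sub>R ((J + KK) *v u)))" (is "_ = ?k")
  unfolding calQ_adj_def dual_adjoint_def
proof (rule the_equality)
  have val: "cvec_ip (calQ E Amin A0 L (generalized_resolvent E K \<iota> At) z X) u = hip E X ?k" if X: "X \<in> hset E" for X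
  proof -
    obtain f where f: "f \<in> LL" "X = cls f" using X by (auto simp: hset_L2H)
    define v where "v = coord z (minus_embed E Amin (cls f))"
    have "hip E X ?k = cvec_ip (sqrt 2 *\<^sub>R v) (- ((1 / sqrt 2) *\<^sub>R ((J + KK) *v u)))"
      unfolding f(2) cvec_ip_moment_ker[OF f(1), symmetric] coord_embed[OF f(1), symmetric] v_def ..
    also have "\<dots> = - cvec_ip v ((J + KK) *v u)" by (simp add: cvec_ip_simps)
    also have "\<dots> = - cvec_ip (hadj (J + KK) *v v) u" by (simp add: cvec_ip_hadj)
    also have "\<dots> = cvec_ip ((J - KK) *v v) u"
      by (simp add: hadj_add hadj_J hadj_KK matrix_vector_mult_add_rdistrib matrix_vector_mult_diff_rdistrib
          matrix_vector_minus cvec_ip_simps)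
    finally show ?thesis unfolding f(2) calQ_eq[OF ext z f(1)] v_def by simp
  qed
  then show "?k \<in> hset E \<and> (\<forall>x\<in>hset E. cvec_ip (calQ E Amin A0 L (generalized_resolvent E K \<iota> At) z x) u = hip E x ?k)"
    using ker_hset by blast
  fix x' assume "x' \<in> hset E \<and> (\<forall>x\<in>hset E. cvec_ip (calQ E Amin A0 L (generalized_resolvent E K \<iota> At) z x) u = hip E x x')"
  then show "x' = ?k" using val ker_hset by (intro E.ip_ext2) auto
qed

lemma gamma_field_eq:
  assumes r: "regular z"
  shows "gamma_field E Amin (Gamma0 l J F H) z u = ker z (sqrt 2 *\<^sub>R (P z *v u))"
  unfolding gamma_field_def adjoint_A_min
proof (rule the_equality)
  show "(ker z (sqrt 2 *\<^sub>R (P z *v u)), hscale E z (ker z (sqrt 2 *\<^sub>R (P z *v u)))) \<in> Amax \<and>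
     Gamma0 l J F H (ker z (sqrt 2 *\<^sub>R (P z *v u)), hscale E z (ker z (sqrt 2 *\<^sub>R (P z *v u)))) = u"
    using ker_A_max P_inverse(2)[OF r] by (simp add: Gamma_ker matrix_vector_scaleR matrix_vector_mul_assoc)
  fix X assume X: "(X, hscale E z X) \<in> Amax \<and> Gamma0 l J F H (X, hscale E z X) = u"
  then obtain w where w: "X = ker z w" using A_max_ker by blast
  have "(1 / sqrt 2) *\<^sub>R ((mat 1 + Ul z) *v w) = u" using X unfolding w Gamma_ker by simp
  then have "sqrt 2 *\<^sub>R (P z *v u) = P z *v ((mat 1 + Ul z) *v w)" by (auto simp: matrix_vector_scaleR)
  also have "\<dots> = w" using P_inverse(1)[OF r] by (simp add: matrix_vector_mul_assoc)
  finally show "X = ker z (sqrt 2 *\<^sub>R (P z *v u))" by (simp add: w)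
qed

lemma matrix_eqI: "(\<And>u. f u = (X :: complex^'p^'p) *v u) \<Longrightarrow> matrix f = X"
  using matrix_of_matrix_vector_mul[of X] by (metis ext)

text \<open>All four coefficients are affine in P(z) or in the adjoint of P(cnj z). As
  \<open>a21\<close> is 2P, its inverse is half of I + U, and the products collapse by (I + U)P = I
  and \<open>P_symplectic\<close>.\<close>

lemma left_resolvent_matrix_eq:
  assumes z: "z \<in> resolvent_set E A0"
  shows "left_resolvent_matrix E Amin (Gamma0 l J F H) (Gamma1 l J F H) L z
    = (1 / 2) *\<^sub>R block_matrix
        ((Ul z - mat 1) ** J + (Ul z + mat 1) ** KK)   (Ul z + mat 1)
        (J ** (Ul z + mat 1) ** J + J ** (Ul z - mat 1) ** KK)   (J ** (Ul z - mat 1))"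
proof -
  have r: "regular z" by (rule regular_resolvent[OF z])
  note r' = regular_cnj[OF r]
  have a11: "matrix (weyl_function E Amin (Gamma0 l J F H) (Gamma1 l J F H) z) = weyl z"
  proof (rule matrix_eqI)
    fix u
    show "weyl_function E Amin (Gamma0 l J F H) (Gamma1 l J F H) z u = weyl z *v u"
      unfolding weyl_function_def gamma_field_eq[OF r] Gamma_ker weyl_def
      by (simp add: matrix_vector_scaleR matrix_vector_mul_assoc matrix_mul_minus matrix_vector_minus matrix_mul_assoc)
  qed
  have a12: "matrix (\<lambda>u. dual_adjoint UNIV UNIV cvec_ip plus_minus
      (gamma_field E Amin (Gamma0 l J F H) (cnj z)) (L u)) = 2 *\<^sub>R hadj (P (cnj z))"
  proof (rule matrix_eqI)
    fix u
    have val: "plus_minus (gamma_field E Amin (Gamma0 l J F H) (cnj z) x) (L u)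
        = cvec_ip x ((2 *\<^sub>R hadj (P (cnj z))) *v u)" for x
    proof -
      have "plus_minus (gamma_field E Amin (Gamma0 l J F H) (cnj z) x) (L u) = 2 * cvec_ip (P (cnj z) *v x) u"
        unfolding plus_minus_def minus_plus_def gamma_field_eq[OF r'] L_ker
        by (simp add: cvec_ip_simps cvec_ip_cnj mult.assoc[symmetric] of_real_mult[symmetric] del: of_real_mult)
      then show ?thesis by (simp add: cvec_ip_hadj scaleR_matrix_vector cvec_ip_simps)
    qed
    show "dual_adjoint UNIV UNIV cvec_ip plus_minus (gamma_field E Amin (Gamma0 l J F H) (cnj z)) (L u)
       = (2 *\<^sub>R hadj (P (cnj z))) *v u"
      unfolding dual_adjoint_def val by (rule the_equality) (auto intro: cvec_ip_eqI2)
  qed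
  have a21: "matrix (\<lambda>u. gauge_adj E Amin L (gamma_field E Amin (Gamma0 l J F H) z u)) = 2 *\<^sub>R P z"
    by (rule matrix_eqI) (simp add: gamma_field_eq[OF r] gauge_adj_ker scaleR_matrix_vector)
  have a22: "matrix (\<lambda>u. gauge_adj E Amin L (regularized_resolvent E A0 (resolvent E A0) z (L u)))
      = J + KK - 2 *\<^sub>R (P z ** J)"
  proof (rule matrix_eqI)
    fix u
    obtain g2 where g2: "ceq (mean_rep u) g2" "g2 \<in> LL" using mean_rep_ceq by blast
    let ?w = "- (sqrt 2 *\<^sub>R (P z *v (J *v u)))"
    have "regularized_resolvent E A0 (resolvent E A0) z (L u) = cls (\<lambda>t. U t z *v ?w - mean_rep u t)"
      unfolding regularized_resolvent_def res_adj_A0[OF r] mean_res_adj ker_def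
      by (rule hdiff_L2H[OF U_L2 ceq_L2[OF g2(1)]])
    then have "gauge_adj E Amin L (regularized_resolvent E A0 (resolvent E A0) z (L u))
        = sqrt 2 *\<^sub>R (U 0 z *v ?w - mean_rep u 0)"
      using gauge_adj_cls[OF canonical_eq_diff[OF ceq_U g2(1)] L2_diff[OF L2_scale[OF U_L2] g2(2)]] by simp
    also have "\<dots> = - (2 *\<^sub>R (P z *v (J *v u))) + (J + KK) *v u"
      unfolding scaleR_diff_right mean_rep_0 by (simp add: U0)
    also have "\<dots> = (J + KK - 2 *\<^sub>R (P z ** J)) *v u"
      by (simp add: matrix_vector_mult_diff_rdistrib scaleR_matrix_vector matrix_vector_mul_assoc)
    finally show "gauge_adj E Amin L (regularized_resolvent E A0 (resolvent E A0) z (L u))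
        = (J + KK - 2 *\<^sub>R (P z ** J)) *v u" .
  qed
  define X where "X = Ul z"
  have XP: "(mat 1 + X) ** P z = mat 1" "P z ** (mat 1 + X) = mat 1" using P_inverse[OF r] by (simp_all add: X_def)
  have inv: "matrix_inv (2 *\<^sub>R P z) = (1/2) *\<^sub>R (mat 1 + X)"
    by (rule matrix_inv_unique(1)) (simp add: scaleR_matrix_mul matrix_mul_scaleR XP)
  have W11: "(1/2) *\<^sub>R (mat 1 + X) ** (J + KK - 2 *\<^sub>R (P z ** J)) = (1/2) *\<^sub>R ((X - mat 1) ** J + (X + mat 1) ** KK)"
  proof -
    have "(mat 1 + X) ** (J + KK - 2 *\<^sub>R (P z ** J)) = (mat 1 + X) ** (J + KK) - 2 *\<^sub>R ((mat 1 + X) ** P z ** J)"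
      by (simp add: matrix_mul_diff matrix_mul_scaleR matrix_mul_assoc)
    also have "\<dots> = (X - mat 1) ** J + (X + mat 1) ** KK"
      unfolding XP by (simp add: matrix_mul_add matrix_mul_diff scaleR_2 algebra_simps)
    finally show ?thesis by (simp add: scaleR_matrix_mul)
  qed
  have W22: "weyl z ** ((1/2) *\<^sub>R (mat 1 + X)) = (1/2) *\<^sub>R (J ** (X - mat 1))"
  proof -
    have "weyl z ** (mat 1 + X) = - (J ** (mat 1 - X) ** (P z ** (mat 1 + X)))"
      by (simp add: weyl_def X_def matrix_mul_assoc matrix_mul_minus)
    also have "\<dots> = J ** (X - mat 1)" unfolding XP by (simp add: matrix_mul_diff)
    finally show ?thesis by (simp add: matrix_mul_scaleR)
  qed
  \<comment> \<open>The correction by \<open>a12\<close> is what removes P: both contributions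
    contain J P J, with opposite signs. The remaining multiple of the identity changes X - I into X
    + I in the first term, because J J = -I.\<close>
  have W21: "(1/2) *\<^sub>R (J ** (X - mat 1)) ** (J + KK - 2 *\<^sub>R (P z ** J)) - 2 *\<^sub>R hadj (P (cnj z))
     = (1/2) *\<^sub>R (J ** (X + mat 1) ** J + J ** (X - mat 1) ** KK)"
  proof -
    have XP': "(X - mat 1) ** P z = mat 1 - 2 *\<^sub>R P z"
    proof -
      have "X - mat 1 = (mat 1 + X) - 2 *\<^sub>R mat 1" by (simp add: scaleR_2)
      then show ?thesis by (simp only: matrix_mul_diff XP scaleR_matrix_mul matrix_mul_lid)
    qed
    have "J ** (X - mat 1) ** (J + KK - 2 *\<^sub>R (P z ** J))
       = J ** (X - mat 1) ** J + J ** (X - mat 1) ** KK - 2 *\<^sub>R (J ** ((X - mat 1) ** P z) ** J)"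
      by (simp add: matrix_mul_diff(1) matrix_mul_add(1) matrix_mul_scaleR matrix_mul_assoc)
    also have "J ** ((X - mat 1) ** P z) ** J = - mat 1 - 2 *\<^sub>R (J ** P z ** J)"
      unfolding XP' by (simp add: matrix_mul_diff matrix_mul_scaleR scaleR_matrix_mul JJ)
    finally have "J ** (X - mat 1) ** (J + KK - 2 *\<^sub>R (P z ** J)) - 4 *\<^sub>R (mat 1 + J ** P z ** J)
       = J ** (X - mat 1) ** J + J ** (X - mat 1) ** KK - 2 *\<^sub>R mat 1"
      by (simp add: scaleR_diff_right scaleR_add_right)
    also have "J ** (X - mat 1) ** J = J ** (X + mat 1) ** J + 2 *\<^sub>R mat 1"
      by (simp add: matrix_mul_diff matrix_mul_add JJ scaleR_2)
    finally have "J ** (X - mat 1) ** (J + KK - 2 *\<^sub>R (P z ** J)) - 4 *\<^sub>R (mat 1 + J ** P z ** J)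
       = J ** (X + mat 1) ** J + J ** (X - mat 1) ** KK" by simp
    then have "(1/2) *\<^sub>R (J ** (X - mat 1) ** (J + KK - 2 *\<^sub>R (P z ** J)) - 4 *\<^sub>R (mat 1 + J ** P z ** J))
       = (1/2) *\<^sub>R (J ** (X + mat 1) ** J + J ** (X - mat 1) ** KK)" by (rule arg_cong)
    then show ?thesis unfolding P_symplectic(1)[OF r] by (simp add: scaleR_diff_right scaleR_matrix_mul)
  qed
  show ?thesis
    unfolding left_resolvent_matrix_def Let_def a11 a12 a21 a22 inv W22 W21 W11 scaleR_block_matrix X_def[symmetric]
    by (simp add: add.commute)
qed

end

theorem proposition5p4:
  fixes l :: real
    and J :: "complex^'p^'p"
    and F H :: "real \<Rightarrow> complex^'p^'p"
    and U :: "real \<Rightarrow> complex \<Rightarrow> complex^'p^'p"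
    and M :: "complex \<Rightarrow> complex^'p^'p"
    and K :: "complex^'p^'p"
    and E :: "(real \<Rightarrow> complex^'p) set hspace"
    and A A0 :: "((real \<Rightarrow> complex^'p) set \<times> (real \<Rightarrow> complex^'p) set) set"
    and G0 G1 :: "(real \<Rightarrow> complex^'p) set \<times> (real \<Rightarrow> complex^'p) set \<Rightarrow> complex^'p"
    and L :: "complex^'p \<Rightarrow> ((real \<Rightarrow> complex^'p) set \<Rightarrow> complex)"
  assumes l: "0 < l"
    and J: "invertible J" "hadj J = matrix_inv J" "matrix_inv J = - J"
    and A1: "condition_A1 l F H"
    and A2: "condition_A2 l J F H"
    and standing: "delta_standing l J F H"
    and U: "fundamental_matrix l J F H U"
    and E: "E = L2H l H"
    and A: "A = A_min l J F H"
    and G0: "G0 = Gamma0 l J F H"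
    and G1: "G1 = Gamma1 l J F H"
    and A0: "A0 = ker_ext E A G0"
    and L: "L = gauge_map l J F H"
    and M: "\<And>z. M z = - J ** (mat 1 - U l z) ** matrix_inv (mat 1 + U l z)"
    and K: "K = J ** re_part (M \<i>) ** J"
  shows
    "(\<forall>z u. calP_adj E A L z u
        = L2_class l H (\<lambda>t. (1 / sqrt 2) *\<^sub>R (U t (cnj z) *v u)))
     \<and> (\<forall>z (S :: 'k hspace) \<iota> At.
          selfadjoint_extension E A S \<iota> At \<and> z \<in> resolvent_set S At \<longrightarrow>
          (\<forall>u. calQ_adj E A A0 L (generalized_resolvent E S \<iota> At) z u
             = L2_class l H (\<lambda>t. - ((1 / sqrt 2) *\<^sub>R ((U t (cnj z) ** (J + K)) *v u)))))
     \<and> (\<forall>z \<in> resolvent_set E A0.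
          left_resolvent_matrix E A G0 G1 L z
          = (1 / 2) *\<^sub>R block_matrix
              ((U l z - mat 1) ** J + (U l z + mat 1) ** K)   (U l z + mat 1)
              (J ** (U l z + mat 1) ** J + J ** (U l z - mat 1) ** K)   (J ** (U l z - mat 1)))"
proof -
  \<comment> \<open>\<open>matrix_inv\<close> is defined by choice; invertibility is what turns the
    equation for it into \<open>J ** J = - mat 1\<close>.\<close>
  have "J ** matrix_inv J = mat 1" by (rule matrix_inv_mult(2)[OF J(1)])
  then have "- (J ** J) = mat 1" unfolding J(3) by (simp add: matrix_mul_minus)
  then have JJ: "J ** J = - mat 1" by (metis minus_minus)
  interpret C: canonical_gauge l H J F U
  proof
    show "integrable (lebesgue_on {0<..<l}) (\<lambda>t. H t $ i $ j)" for i j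
      using A1 unfolding condition_A1_def by blast
    show "AE t in lebesgue_on {0<..<l}. pos_semidef (H t)"
      using A1 unfolding condition_A1_def by blast
    have "AE t in lebesgue_on {0<..<l}. real_hermitian (F t)"
      using A1 unfolding condition_A1_def by blast
    then show "AE t in lebesgue_on {0<..<l}. hadj (F t) = F t"
      by eventually_elim (simp add: real_hermitian_def)
    show "hadj J = - J" using J by simp
  qed (rule l JJ A2 U standing)+
  have "M \<i> = C.weyl \<i>" unfolding M C.weyl_def C.P_def ..
  then have K_eq: "K = C.KK" unfolding K C.KK_def by (rule arg_cong)
  have i: "L2_class l H (\<lambda>t. (1 / sqrt 2) *\<^sub>R (U t w *v u)) = C.ker w ((1 / sqrt 2) *\<^sub>R u)" for w u
    unfolding C.ker_def matrix_vector_scaleR ..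
  have ii: "L2_class l H (\<lambda>t. - ((1 / sqrt 2) *\<^sub>R ((U t w ** (J + K)) *v u)))
      = C.ker w (- ((1 / sqrt 2) *\<^sub>R ((J + K) *v u)))" for w u
    unfolding C.ker_def matrix_vector_minus matrix_vector_scaleR matrix_vector_mul_assoc ..
  show ?thesis
    unfolding i ii unfolding A0 unfolding E A G0 G1 L K_eq
  proof (intro conjI allI impI ballI)
    show "calP_adj (L2H l H) (A_min l J F H) (gauge_map l J F H) z u = C.ker (cnj z) ((1 / sqrt 2) *\<^sub>R u)" for z u
      by (rule C.calP_adj_eq)
  next
    fix z u and S :: "'k hspace" and \<iota> At
    assume "selfadjoint_extension (L2H l H) (A_min l J F H) S \<iota> At \<and> z \<in> resolvent_set S At"
    then show "calQ_adj (L2H l H) (A_min l J F H) (ker_ext (L2H l H) (A_min l J F H) (Gamma0 l J F H))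
        (gauge_map l J F H) (generalized_resolvent (L2H l H) S \<iota> At) z u
      = C.ker (cnj z) (- ((1 / sqrt 2) *\<^sub>R ((J + C.KK) *v u)))"
      by (intro C.calQ_adj_eq) blast+
  next
    fix z assume "z \<in> resolvent_set (L2H l H) (ker_ext (L2H l H) (A_min l J F H) (Gamma0 l J F H))"
    from C.left_resolvent_matrix_eq[OF this]
    show "left_resolvent_matrix (L2H l H) (A_min l J F H) (Gamma0 l J F H) (Gamma1 l J F H) (gauge_map l J F H) z
      = (1 / 2) *\<^sub>R block_matrix ((U l z - mat 1) ** J + (U l z + mat 1) ** C.KK) (U l z + mat 1)
          (J ** (U l z + mat 1) ** J + J ** (U l z - mat 1) ** C.KK) (J ** (U l z - mat 1))" .
  qed
qed

end
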